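(* Let $\Lambda$ be a locally finite measure on $\mathbb{R}^2$ with $\sup_{x\in\mathbb{R}^2}\int_{\mathbb{R}^2}h(x,y)\,\Lambda(dy)<\infty$. For every measurable $v:\mathbb{R}^2\to[0,1]$ with $\int_{\mathbb{R}^2}|1-v(x)|\,\Lambda(dx)<\infty$, the functional $f_{\infty,\Lambda}$ satisfies $f_{\infty,\Lambda}(0,v)=1$ and, for all $t\ge 0$ (right derivative at $t=0$), $t\mapsto f_{\infty,\Lambda}(t,v)$ is differentiable with $$\frac{d f_{\infty,\Lambda}(t,v)}{dt}=-\int_{\mathbb{R}^2} f_{\infty,\Lambda}\bigl(t,H(v,x)\bigr)\,(1-v(x))\,\Lambda(dx),$$ where $H(v,x)$ is the function $y\mapsto v(y)(1-h(x,y))$.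
   Context: Contention: $h:\mathbb{R}^2\times\mathbb{R}^2\to[0,1]$ is measurable, symmetric and translation invariant ($h(x,y)=h(0,y-x)$). $\Phi$ is a Poisson point process on $\mathbb{R}^2\times[0,\infty)$ with intensity measure $\Lambda(dx)\,dt$; a point is identified with its position $x\in\mathbb{R}^2$, and its second coordinate $t(x)$ is called its timer. To each unordered pair of distinct points $x,y$ is attached a Boolean variable $C(x,y)=C(y,x)$; given all points and timers these variables are independent with $\mathbf{P}(C(x,y)=1)=h(x,y)$. For a set $A\subseteq[0,\infty)$, $T_A(\Phi)=\{x\in\Phi: t(x)\in A\}$. For a point process $\Xi$ with timers, the $\infty$-Mat\'ern model is $M^\infty(\Xi,C)=\{x\in\Xi: e_\infty(x)=1\}$, where $e_\infty:\Xi\to\{0,1\}$ is the solution of $$e_\infty(x)=\prod_{y\in\Xi,\ t(y)<t(x)}\bigl(1-e_\infty(y)C(x,y)\bigr)\quad\text{for all }x\in\Xi$$ (empty products equal $1$); under $\sup_x\int h(x,y)\Lambda(dy)<\infty$ this solution exists and is unique almost surely for $\Xi=T_{[0,t)}(\Phi)$, for every $t\geq 0$. $f_{\infty,\Lambda}(t,v)=\mathbf{E}\Bigl[\prod_{x\in M^\infty(T_{[0,t)}(\Phi),C)}v(x)\Bigr]$ is the generating functional of $M^\infty(T_{[0,t)}(\Phi),C)$. *)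

theory Defs
  imports "HOL-Probability.Probability"
begin

definition locally_finite_measure :: "'a::topological_space measure \<Rightarrow> bool" where
  "locally_finite_measure L \<longleftrightarrow>
     sets L = sets borel \<and> (\<forall>K. compact K \<longrightarrow> emeasure L K < \<infinity>)"

(* Multiplicative analogue of infsum: the limit of the net of finite partial products.
   For factors in [0,1] this net is decreasing, so it always converges, possibly to 0. *)
definition unordered_prod ::
    "('a \<Rightarrow> 'b::{comm_monoid_mult, t2_space}) \<Rightarrow> 'a set \<Rightarrow> 'b" where
  "unordered_prod f S = Lim (finite_subsets_at_top S) (\<lambda>F. \<Prod>x\<in>F. f x)"

(* The process is represented by its random set of points. This loses nothing when the intensity
   measure has no atoms, since a Poisson process is then almost surely simple. *)
definition poisson_point_process ::
    "'w measure \<Rightarrow> 'a::euclidean_space measure \<Rightarrow> ('w \<Rightarrow> 'a set) \<Rightarrow> bool" where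
  "poisson_point_process P \<mu> \<Phi> \<longleftrightarrow>
     (\<forall>\<omega>\<in>space P. \<Phi> \<omega> \<subseteq> space \<mu> \<and> (\<forall>B. bounded B \<longrightarrow> finite (\<Phi> \<omega> \<inter> B))) \<and>
     (\<forall>B\<in>sets \<mu>. bounded B \<longrightarrow>
        (\<forall>k. measure P {\<omega> \<in> space P. card (\<Phi> \<omega> \<inter> B) = k}
               = exp (- measure \<mu> B) * measure \<mu> B ^ k / fact k)) \<and>
     (\<forall>(n::nat) B. (\<forall>i<n. B i \<in> sets \<mu> \<and> bounded (B i)) \<longrightarrow> disjoint_family_on B {..<n} \<longrightarrow>
        prob_space.indep_vars P (\<lambda>_. count_space UNIV) (\<lambda>i \<omega>. card (\<Phi> \<omega> \<inter> B i)) {..<n})"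

(* A point of the process is a pair (position, timer). Timers disambiguate points sharing
   a position, which occur when L has atoms. *)
type_synonym point = "(real^2) \<times> real"

definition timed_intensity :: "(real^2) measure \<Rightarrow> point measure" where
  "timed_intensity L = L \<Otimes>\<^sub>M restrict_space lborel {0..}"

(* The points of \<Phi> \<omega> are \<xi> n \<omega> for n in I \<omega>, without repetition; the value of \<xi> n \<omega> for
   other n is irrelevant. *)
definition measurable_enumeration ::
    "'w measure \<Rightarrow> ('w \<Rightarrow> 'a::topological_space set) \<Rightarrow> ('w \<Rightarrow> nat set) \<Rightarrow> (nat \<Rightarrow> 'w \<Rightarrow> 'a) \<Rightarrow> bool"
  where
  "measurable_enumeration P \<Phi> I \<xi> \<longleftrightarrow>
     (\<forall>\<omega>\<in>space P. bij_betw (\<lambda>n. \<xi> n \<omega>) (I \<omega>) (\<Phi> \<omega>)) \<and>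
     (\<forall>n. \<forall>B\<in>sets borel. {\<omega> \<in> space P. n \<in> I \<omega> \<and> \<xi> n \<omega> \<in> B} \<in> sets P)"

definition enumeration_algebra ::
    "'w measure \<Rightarrow> ('w \<Rightarrow> nat set) \<Rightarrow> (nat \<Rightarrow> 'w \<Rightarrow> 'a::topological_space) \<Rightarrow> 'w measure" where
  "enumeration_algebra P I \<xi> =
     sigma (space P) {{\<omega> \<in> space P. n \<in> I \<omega> \<and> \<xi> n \<omega> \<in> B} | n B. B \<in> sets borel}"

(* C \<omega> p q is the Boolean variable of the pair {p, q} of points of \<Phi> \<omega>. To speak about its
   conditional law given all points, the points are enumerated, and each unordered pair of
   distinct points is represented by its indices i < j. The last clause says that, given the
   points, any finitely many of these variables are independent, the one of the pair
   {(x, s), (y, t)} being true with probability h x y. *)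
definition contention_variables ::
    "'w measure \<Rightarrow> (real^2 \<Rightarrow> real^2 \<Rightarrow> real) \<Rightarrow> ('w \<Rightarrow> point set) \<Rightarrow>
     ('w \<Rightarrow> point \<Rightarrow> point \<Rightarrow> bool) \<Rightarrow> bool" where
  "contention_variables P h \<Phi> C \<longleftrightarrow>
     (\<forall>\<omega>\<in>space P. \<forall>p\<in>\<Phi> \<omega>. \<forall>q\<in>\<Phi> \<omega>. C \<omega> p q = C \<omega> q p) \<and>
     (\<exists>I \<xi>. measurable_enumeration P \<Phi> I \<xi> \<and>
        (\<forall>i j. i < j \<longrightarrow>
           {\<omega> \<in> space P. i \<in> I \<omega> \<and> j \<in> I \<omega> \<and> C \<omega> (\<xi> i \<omega>) (\<xi> j \<omega>)} \<in> sets P) \<and>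
        (\<forall>F b. finite F \<longrightarrow> F \<subseteq> {(i, j). i < j} \<longrightarrow>
           (AE \<omega> in P.
              real_cond_exp P (enumeration_algebra P I \<xi>)
                (indicator {\<omega> \<in> space P. \<forall>(i, j)\<in>F. i \<in> I \<omega> \<and> j \<in> I \<omega> \<and>
                                (C \<omega> (\<xi> i \<omega>) (\<xi> j \<omega>) \<longleftrightarrow> b (i, j))}) \<omega>
              = indicator {\<omega> \<in> space P. \<forall>(i, j)\<in>F. i \<in> I \<omega> \<and> j \<in> I \<omega>} \<omega> *
                (\<Prod>(i, j)\<in>F. if b (i, j) then h (fst (\<xi> i \<omega>)) (fst (\<xi> j \<omega>))
                               else 1 - h (fst (\<xi> i \<omega>)) (fst (\<xi> j \<omega>))))))"

definition thin :: "real set \<Rightarrow> point set \<Rightarrow> point set" where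
  "thin A \<Xi> = {p \<in> \<Xi>. snd p \<in> A}"

definition retention_solution ::
    "point set \<Rightarrow> (point \<Rightarrow> point \<Rightarrow> bool) \<Rightarrow> (point \<Rightarrow> real) \<Rightarrow> bool" where
  "retention_solution \<Xi> c e \<longleftrightarrow>
     e \<in> \<Xi> \<rightarrow>\<^sub>E {0, 1} \<and>
     (\<forall>p\<in>\<Xi>. e p = unordered_prod (\<lambda>q. 1 - e q * of_bool (c p q)) {q \<in> \<Xi>. snd q < snd p})"

(* Meaningful when the solution exists and is unique, which under the standing assumption on h
   holds almost surely for the configurations of interest. *)
definition matern_infinity :: "point set \<Rightarrow> (point \<Rightarrow> point \<Rightarrow> bool) \<Rightarrow> point set" where
  "matern_infinity \<Xi> c = {p \<in> \<Xi>. (THE e. retention_solution \<Xi> c e) p = 1}"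

(* The integrand is determined only almost surely, hence the completion of P: with respect to P
   itself it could fail to be measurable because of its values on a null set. *)
definition gen_functional ::
    "'w measure \<Rightarrow> ('w \<Rightarrow> point set) \<Rightarrow> ('w \<Rightarrow> point \<Rightarrow> point \<Rightarrow> bool) \<Rightarrow>
     real \<Rightarrow> (real^2 \<Rightarrow> real) \<Rightarrow> real" where
  "gen_functional P \<Phi> C t v =
     (\<integral>\<omega>. unordered_prod (\<lambda>p. v (fst p)) (matern_infinity (thin {0..<t} (\<Phi> \<omega>)) (C \<omega>))
        \<partial>completion P)"

definition H :: "(real^2 \<Rightarrow> real^2 \<Rightarrow> real) \<Rightarrow> (real^2 \<Rightarrow> real) \<Rightarrow> real^2 \<Rightarrow> real^2 \<Rightarrow> real" where
  "H h v x = (\<lambda>y. v y * (1 - h x y))"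

end

theory Submission
  imports Defs
begin

text \<open>
  Let \<open>M(S)\<close> be the set of points retained from a finite configuration \<open>S\<close> with distinct timers.
  Adding a latest point \<open>p\<close> changes \<open>\<Prod>q\<in>M(S). v q\<close> by \<open>-(1 - v p) * (\<Prod>q\<in>M(S). v q * (1 - C p q))\<close>.
  Iterating this expands the product as an alternating sum over the tuples of points of \<open>S\<close> ordered by
  timer; in the summand of a tuple \<open>x\<close> each contention variable occurs at most once, so given the points
  its mean is obtained by replacing \<open>C\<close> by \<open>h\<close>. The Campbell formula for ordered tuples needs only the
  independence of the counts in disjoint sets. In a bounded window it turns the generating functional
  into an absolutely convergent alternating series of iterated integrals, and peeling off the last
  point of every tuple gives \<open>f(t,v) = 1 - \<integral>\<^sub>0\<^sup>t \<integral> (1 - v x) f(s, H(v,x)) \<Lambda>(dx) ds\<close>.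

  To let the window grow, one needs that almost surely the contention graph, directed towards earlier
  points, is finitely branching and well-founded: the expected number of descending chains with
  \<open>m + 1\<close> points and top in a bounded set is at most a constant times \<open>(M t)\<^sup>m / m!\<close>, where \<open>M\<close> bounds
  the integrals of \<open>h\<close>. Finally \<open>f\<close> is Lipschitz in \<open>t\<close>, so the integrand over \<open>s\<close> is continuous and
  the integral equation can be differentiated.
\<close>

section \<open>Retention on a point configuration\<close>

text \<open>Why windows are needed: integrated over the whole plane, with each factor estimated as
  in \<open>H_deficit\<close>, the summand of order m is bounded by d (d + M) ... (d + (m - 1) M)
  t^m / m!, where d is the integral of 1 - v. If d > 0, these bounds are summable only while M t <
  1. In a bounded window W every weight is at most 1, and the bound (\<Lambda>(W) t)^m / m! is
  summable for every t. The limit over windows is therefore taken after summation. The uniform bound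
  needed for it is not visible in the alternating series; it comes from the probabilistic meaning,
  each window functional being the mean of a product of factors in [0,1]. The window functionals
  also supply the joint measurability of f(s, H(v,x)) in s and x, which the definition as an
  expectation does not show. A second obstacle is that the contention variables are indexed by an
  enumeration of the points whose order is unrelated to the timers. Sums over random tuples of
  points are therefore rewritten as countable sums over tuples of indices before
  conditioning.\<close>

lemma prod_unit_antimono:
  fixes f :: "'a \<Rightarrow> real"
  assumes "\<And>x. x \<in> G \<Longrightarrow> f x \<in> {0..1}" "finite G" "F \<subseteq> G"
  shows "prod f G \<le> prod f F"
proof -
  have "prod f G = prod f F * prod f (G - F)"
    using prod.subset_diff[OF assms(3,2)] by (simp add: mult.commute)
  also have "\<dots> \<le> prod f F * 1"
    using assms by (intro mult_left_mono prod_le_1 prod_nonneg) auto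
  finally show ?thesis by simp
qed

lemma unordered_prod_finite:
  fixes f :: "'a \<Rightarrow> real"
  assumes "finite S"
  shows "unordered_prod f S = prod f S"
  unfolding unordered_prod_def
proof (rule tendsto_Lim)
  show "((\<lambda>F. prod f F) \<longlongrightarrow> prod f S) (finite_subsets_at_top S)"
    using assms by (simp add: finite_subsets_at_top_finite tendsto_principal_singleton)
qed simp

text \<open>For factors in [0,1] the net of finite products is decreasing, so it converges to the
  infimum of its values. Identifying the limit with that infimum gives all three claims.\<close>

lemma unordered_prod_unit:
  fixes f :: "'a \<Rightarrow> real"
  assumes f: "\<And>x. x \<in> S \<Longrightarrow> f x \<in> {0..1}"
  shows "((\<lambda>F. prod f F) \<longlongrightarrow> unordered_prod f S) (finite_subsets_at_top S)"
    and "unordered_prod f S \<in> {0..1}"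
    and "\<And>F. finite F \<Longrightarrow> F \<subseteq> S \<Longrightarrow> unordered_prod f S \<le> prod f F"
proof -
  define A where "A = {prod f F | F. finite F \<and> F \<subseteq> S}"
  have A0: "\<And>a. a \<in> A \<Longrightarrow> 0 \<le> a"
    unfolding A_def using f by (auto intro!: prod_nonneg)
  then have bdd: "bdd_below A" by (auto simp: bdd_below_def)
  have 1: "1 \<in> A" unfolding A_def by (auto intro!: exI[of _ "{}"])
  have lim: "((\<lambda>F. prod f F) \<longlongrightarrow> Inf A) (finite_subsets_at_top S)"
  proof (rule order_tendstoI)
    fix a assume "a < Inf A"
    have "eventually (\<lambda>F. finite F \<and> F \<subseteq> S) (finite_subsets_at_top S)"
      by (rule eventually_finite_subsets_at_top_weakI) auto
    then show "eventually (\<lambda>F. a < prod f F) (finite_subsets_at_top S)"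
    proof (rule eventually_mono)
      fix F assume "finite F \<and> F \<subseteq> S"
      then have "Inf A \<le> prod f F" by (intro cInf_lower bdd) (auto simp: A_def)
      with \<open>a < Inf A\<close> show "a < prod f F" by simp
    qed
  next
    fix a assume "Inf A < a"
    then obtain F where F: "finite F" "F \<subseteq> S" "prod f F < a"
      using cInf_lessD[of A a] 1 by (auto simp: A_def)
    have "prod f G < a" if "finite G" "F \<subseteq> G" "G \<subseteq> S" for G
    proof -
      have "prod f G \<le> prod f F"
        by (rule prod_unit_antimono) (use that f in auto)
      with F(3) show ?thesis by simp
    qed
    with F show "eventually (\<lambda>F. prod f F < a) (finite_subsets_at_top S)"
      unfolding eventually_finite_subsets_at_top by blast
  qed
  have eq: "unordered_prod f S = Inf A"
    unfolding unordered_prod_def by (rule tendsto_Lim[OF _ lim]) simp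
  show "((\<lambda>F. prod f F) \<longlongrightarrow> unordered_prod f S) (finite_subsets_at_top S)"
    using lim eq by simp
  show "unordered_prod f S \<in> {0..1}"
    unfolding eq atLeastAtMost_iff
    by (intro conjI cInf_greatest cInf_lower bdd 1 A0) (use 1 in auto)
  show "unordered_prod f S \<le> prod f F" if "finite F" "F \<subseteq> S" for F
    unfolding eq using that by (intro cInf_lower bdd) (auto simp: A_def)
qed

text \<open>A single zero factor pushes the infimum to 0. This turns the retention equation into a
  purely logical condition, even with infinitely many factors.\<close>

lemma unordered_prod_zero_one:
  fixes f :: "'a \<Rightarrow> real"
  assumes f: "\<And>x. x \<in> S \<Longrightarrow> f x \<in> {0, 1}"
  shows "unordered_prod f S = of_bool (\<forall>x\<in>S. f x = 1)"
proof (cases "\<forall>x\<in>S. f x = 1")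
  case True
  have "((\<lambda>F. prod f F) \<longlongrightarrow> 1) (finite_subsets_at_top S)"
  proof (rule tendsto_eventually, rule eventually_finite_subsets_at_top_weakI)
    show "prod f F = 1" if "finite F" "F \<subseteq> S" for F
      using True that by (intro prod.neutral) auto
  qed
  then have "unordered_prod f S = 1"
    unfolding unordered_prod_def by (intro tendsto_Lim) auto
  with True show ?thesis by simp
next
  case False
  then obtain x where x: "x \<in> S" "f x = 0" using f by auto
  have *: "\<And>x. x \<in> S \<Longrightarrow> f x \<in> {0..1}" using f by fastforce
  have "unordered_prod f S \<le> 0"
    using unordered_prod_unit(3)[of S f "{x}"] x * by auto
  with unordered_prod_unit(2)[of S f] * False show ?thesis by auto
qed

text \<open>Oriented from the earlier point to the later one, so that \<open>wf\<close> says that no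
  chain of contending points runs backwards in time for ever. Retention is then defined by recursion
  along this relation.\<close>

definition earlier_nbr :: "point set \<Rightarrow> (point \<Rightarrow> point \<Rightarrow> bool) \<Rightarrow> (point \<times> point) set" where
  "earlier_nbr \<Xi> c = {(q, p). p \<in> \<Xi> \<and> q \<in> \<Xi> \<and> snd q < snd p \<and> c p q}"

lemma retention_solution_iff:
  "retention_solution \<Xi> c e \<longleftrightarrow> e \<in> \<Xi> \<rightarrow>\<^sub>E {0, 1} \<and>
     (\<forall>p\<in>\<Xi>. e p = of_bool (\<forall>q. (q, p) \<in> earlier_nbr \<Xi> c \<longrightarrow> e q = 0))"
proof (cases "e \<in> \<Xi> \<rightarrow>\<^sub>E {0, 1}")
  case True
  then have e: "\<And>p. p \<in> \<Xi> \<Longrightarrow> e p \<in> {0, 1}" by auto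
  have "unordered_prod (\<lambda>q. 1 - e q * of_bool (c p q)) {q \<in> \<Xi>. snd q < snd p}
      = of_bool (\<forall>q. (q, p) \<in> earlier_nbr \<Xi> c \<longrightarrow> e q = 0)" if "p \<in> \<Xi>" for p
  proof -
    have "unordered_prod (\<lambda>q. 1 - e q * of_bool (c p q)) {q \<in> \<Xi>. snd q < snd p}
      = of_bool (\<forall>q\<in>{q \<in> \<Xi>. snd q < snd p}. 1 - e q * of_bool (c p q) = 1)"
      using e by (intro unordered_prod_zero_one) fastforce
    also have "\<dots> = of_bool (\<forall>q. (q, p) \<in> earlier_nbr \<Xi> c \<longrightarrow> e q = 0)"
      using that by (intro arg_cong[where f=of_bool]) (auto simp: earlier_nbr_def)
    finally show ?thesis .
  qed
  with True show ?thesis by (auto simp: retention_solution_def)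
qed (auto simp: retention_solution_def)

text \<open>Both sets are kernels of the same directed graph: a vertex belongs exactly when none of
  its predecessors does. Along a well-founded relation membership is decided recursively, so there
  is at most one kernel.\<close>

lemma wf_retention_unique:
  assumes wf: "wf (earlier_nbr \<Xi> c)"
    and A: "\<And>p. p \<in> A \<longleftrightarrow> p \<in> \<Xi> \<and> (\<forall>q. (q, p) \<in> earlier_nbr \<Xi> c \<longrightarrow> q \<notin> A)"
    and B: "\<And>p. p \<in> B \<longleftrightarrow> p \<in> \<Xi> \<and> (\<forall>q. (q, p) \<in> earlier_nbr \<Xi> c \<longrightarrow> q \<notin> B)"
  shows "A = B"
proof -
  have "p \<in> A \<longleftrightarrow> p \<in> B" for p
    using wf by (induction p rule: wf_induct_rule) (use A B in blast)
  then show ?thesis by blast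
qed

text \<open>Well-founded recursion produces a solution and uniqueness of kernels makes it the only
  one, so the definite description in \<open>matern_infinity\<close> denotes it. Later arguments
  work with this fixed point property instead of the description.\<close>

lemma mem_matern_infinity_iff:
  assumes wf: "wf (earlier_nbr \<Xi> c)"
  shows "p \<in> matern_infinity \<Xi> c \<longleftrightarrow>
    p \<in> \<Xi> \<and> (\<forall>q. (q, p) \<in> earlier_nbr \<Xi> c \<longrightarrow> q \<notin> matern_infinity \<Xi> c)"
proof -
  define R where "R = earlier_nbr \<Xi> c"
  define g where "g = wfrec R (\<lambda>f p. p \<in> \<Xi> \<and> (\<forall>q. (q, p) \<in> R \<longrightarrow> \<not> f q))"
  have g: "g p \<longleftrightarrow> p \<in> \<Xi> \<and> (\<forall>q. (q, p) \<in> R \<longrightarrow> \<not> g q)" for p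
  proof -
    have "g p = (p \<in> \<Xi> \<and> (\<forall>q. (q, p) \<in> R \<longrightarrow> \<not> cut g R p q))"
      unfolding g_def using wf by (subst wfrec) (auto simp: R_def)
    then show ?thesis by (auto simp: cut_apply)
  qed
  \<comment> \<open>Solutions are extensional functions; without \<open>restrict\<close> the values
    outside \<open>\<Xi>\<close> would spoil both membership in the function space and
    uniqueness.\<close>
  define e where "e = restrict (\<lambda>p. of_bool (g p) :: real) \<Xi>"
  have R_in: "q \<in> \<Xi>" if "(q, p) \<in> R" for p q
    using that by (auto simp: R_def earlier_nbr_def)
  have e: "retention_solution \<Xi> c e"
    unfolding retention_solution_iff
  proof (intro conjI ballI)
    show "e \<in> \<Xi> \<rightarrow>\<^sub>E {0, 1}" by (auto simp: e_def)
    fix p assume "p \<in> \<Xi>"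
    then show "e p = of_bool (\<forall>q. (q, p) \<in> earlier_nbr \<Xi> c \<longrightarrow> e q = 0)"
      using g[of p] R_in by (auto simp: e_def R_def[symmetric])
  qed
  have "e' = e" if e': "retention_solution \<Xi> c e'" for e'
  proof -
    \<comment> \<open>Two solutions are compared through the sets where they equal 1, each of which
      is a kernel.\<close>
    have "{p\<in>\<Xi>. e' p = 1} = {p\<in>\<Xi>. e p = 1}"
    proof (rule wf_retention_unique[OF wf])
      fix p
      show "p \<in> {p\<in>\<Xi>. e' p = 1} \<longleftrightarrow> p \<in> \<Xi> \<and>
        (\<forall>q. (q, p) \<in> earlier_nbr \<Xi> c \<longrightarrow> q \<notin> {p\<in>\<Xi>. e' p = 1})"
        using e' R_in[of _ p] unfolding retention_solution_iff R_def
        by (fastforce simp: PiE_def Pi_def)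
      show "p \<in> {p\<in>\<Xi>. e p = 1} \<longleftrightarrow> p \<in> \<Xi> \<and>
        (\<forall>q. (q, p) \<in> earlier_nbr \<Xi> c \<longrightarrow> q \<notin> {p\<in>\<Xi>. e p = 1})"
        using e R_in[of _ p] unfolding retention_solution_iff R_def
        by (fastforce simp: PiE_def Pi_def)
    qed
    then have same: "e' p = 1 \<longleftrightarrow> e p = 1" if "p \<in> \<Xi>" for p
      using that unfolding set_eq_iff mem_Collect_eq by metis
    have mem: "e' \<in> \<Xi> \<rightarrow>\<^sub>E {0, 1}" "e \<in> \<Xi> \<rightarrow>\<^sub>E {0, 1}"
      using e e' by (auto simp: retention_solution_def)
    show ?thesis
    proof (rule PiE_ext[OF mem])
      fix p assume p: "p \<in> \<Xi>"
      from PiE_mem[OF mem(1) p] PiE_mem[OF mem(2) p] same[OF p] show "e' p = e p" by auto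
    qed
  qed
  then have "(THE e. retention_solution \<Xi> c e) = e"
    by (rule the_equality[where P="retention_solution \<Xi> c", OF e])
  then have M: "q \<in> matern_infinity \<Xi> c \<longleftrightarrow> q \<in> \<Xi> \<and> g q" for q
    by (simp add: matern_infinity_def e_def)
  have "p \<in> matern_infinity \<Xi> c \<longleftrightarrow> p \<in> \<Xi> \<and> (\<forall>q. (q, p) \<in> R \<longrightarrow> \<not> g q)"
    unfolding M by (subst g) blast
  also have "\<dots> \<longleftrightarrow> p \<in> \<Xi> \<and> (\<forall>q. (q, p) \<in> R \<longrightarrow> q \<notin> matern_infinity \<Xi> c)"
    unfolding M using R_in by blast
  finally show ?thesis by (simp only: R_def)
qed

lemma matern_infinity_eqI:
  assumes "wf (earlier_nbr \<Xi> c)"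
    and "\<And>p. p \<in> A \<longleftrightarrow> p \<in> \<Xi> \<and> (\<forall>q. (q, p) \<in> earlier_nbr \<Xi> c \<longrightarrow> q \<notin> A)"
  shows "matern_infinity \<Xi> c = A"
  by (rule wf_retention_unique[OF assms(1) mem_matern_infinity_iff[OF assms(1)] assms(2)])

text \<open>Timers strictly increase along paths, which excludes cycles, and a finite acyclic
  relation is well-founded.\<close>

lemma wf_earlier_nbr_finite:
  assumes "finite \<Xi>"
  shows "wf (earlier_nbr \<Xi> c)"
proof (rule finite_acyclic_wf)
  show "finite (earlier_nbr \<Xi> c)"
    by (rule finite_subset[of _ "\<Xi> \<times> \<Xi>"]) (use assms in \<open>auto simp: earlier_nbr_def\<close>)
  have "snd a < snd b" if "(a, b) \<in> (earlier_nbr \<Xi> c)\<^sup>+" for a b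
    using that by (induction rule: trancl_induct) (auto simp: earlier_nbr_def)
  then show "acyclic (earlier_nbr \<Xi> c)" by (fastforce simp: acyclic_def)
qed

lemma matern_infinity_subset: "matern_infinity \<Xi> c \<subseteq> \<Xi>"
  by (auto simp: matern_infinity_def)

text \<open>The latest point is nobody's earlier neighbour, so it leaves the fate of all others
  unchanged and is itself judged against the points already retained.\<close>

lemma matern_infinity_insert_latest:
  assumes fin: "finite \<Xi>" and late: "\<And>q. q \<in> \<Xi> \<Longrightarrow> snd q < snd p"
  shows "matern_infinity (insert p \<Xi>) c =
    (if \<forall>q\<in>matern_infinity \<Xi> c. \<not> c p q then insert p (matern_infinity \<Xi> c) else matern_infinity \<Xi> c)"
proof -
  let ?M = "matern_infinity \<Xi> c"
  have p: "p \<notin> \<Xi>" using late[of p] by auto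
  have M: "q \<in> ?M \<longleftrightarrow> q \<in> \<Xi> \<and> (\<forall>r. (r, q) \<in> earlier_nbr \<Xi> c \<longrightarrow> r \<notin> ?M)" for q
    by (rule mem_matern_infinity_iff[OF wf_earlier_nbr_finite[OF fin]])
  have sub: "?M \<subseteq> \<Xi>" by (rule matern_infinity_subset)
  have nb: "(r, q) \<in> earlier_nbr (insert p \<Xi>) c \<longleftrightarrow> (r, q) \<in> earlier_nbr \<Xi> c" if "q \<in> \<Xi>" for r q
    using that p late[of q] by (auto simp: earlier_nbr_def)
  have nbp: "(r, p) \<in> earlier_nbr (insert p \<Xi>) c \<longleftrightarrow> r \<in> \<Xi> \<and> c p r" for r
    using late[of r] by (auto simp: earlier_nbr_def)
  have nbi: "r \<in> \<Xi>" if "(r, q) \<in> earlier_nbr \<Xi> c" for r q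
    using that by (auto simp: earlier_nbr_def)
  show ?thesis
  proof (rule matern_infinity_eqI)
    show "wf (earlier_nbr (insert p \<Xi>) c)" using fin by (intro wf_earlier_nbr_finite) auto
    fix q
    let ?A = "if \<forall>q\<in>?M. \<not> c p q then insert p ?M else ?M"
    consider "q = p" | "q \<in> \<Xi>" "q \<noteq> p" | "q \<notin> insert p \<Xi>" by blast
    then show "q \<in> ?A \<longleftrightarrow> q \<in> insert p \<Xi> \<and>
        (\<forall>r. (r, q) \<in> earlier_nbr (insert p \<Xi>) c \<longrightarrow> r \<notin> ?A)"
    proof cases
      case 1
      with p sub nbp show ?thesis by (auto split: if_splits)
    next
      case 2
      then have "q \<in> ?A \<longleftrightarrow> q \<in> ?M" by auto
      moreover have "r \<notin> ?A \<longleftrightarrow> r \<notin> ?M" if "(r, q) \<in> earlier_nbr \<Xi> c" for r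
        using nbi[OF that] p by auto
      ultimately show ?thesis using M[of q] nb[of q] 2 by auto
    next
      case 3
      with sub show ?thesis by auto
    qed
  qed
qed

section \<open>Alternating expansion over tuples ordered by timer\<close>

definition ordered_tuples :: "nat \<Rightarrow> point set \<Rightarrow> (nat \<Rightarrow> point) set" where
  "ordered_tuples m S = {x \<in> {..<m} \<rightarrow>\<^sub>E S. \<forall>k<m. \<forall>j<k. snd (x j) < snd (x k)}"

lemma ordered_tuples_0 [simp]: "ordered_tuples 0 S = {\<lambda>_. undefined}"
  by (auto simp: ordered_tuples_def)

lemma finite_ordered_tuples: "finite S \<Longrightarrow> finite (ordered_tuples m S)"
  unfolding ordered_tuples_def by (rule finite_subset[OF Collect_subset]) (auto intro: finite_PiE)

text \<open>The entries of a tuple have increasing timers, so a point later than all of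
  \<open>S\<close> can only occupy the last place.\<close>

lemma ordered_tuples_insert_latest:
  assumes late: "\<And>q. q \<in> S \<Longrightarrow> snd q < snd p"
  shows "ordered_tuples (Suc m) (insert p S) =
    ordered_tuples (Suc m) S \<union> (\<lambda>x. x(m := p)) ` ordered_tuples m S"
proof (intro equalityI subsetI)
  fix x assume x: "x \<in> ordered_tuples (Suc m) (insert p S)"
  then have xin: "\<And>k. k \<le> m \<Longrightarrow> x k \<in> insert p S"
    and ord: "\<And>j k. j < k \<Longrightarrow> k \<le> m \<Longrightarrow> snd (x j) < snd (x k)"
    and ext: "\<And>k. k > m \<Longrightarrow> x k = undefined"
    by (auto simp: ordered_tuples_def PiE_def Pi_def extensional_def)
  have "x k \<noteq> p" if "k < m" for k
    using ord[OF that order_refl] xin[of m] late[of "x m"] by auto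
  then have xS: "x k \<in> S" if "k < m" for k using xin[of k] that by auto
  show "x \<in> ordered_tuples (Suc m) S \<union> (\<lambda>x. x(m := p)) ` ordered_tuples m S"
  proof (cases "x m = p")
    case True
    have "x = (restrict x {..<m})(m := p)"
      using True ext by (auto simp: fun_eq_iff restrict_def)
    moreover have "restrict x {..<m} \<in> ordered_tuples m S"
      using xS ord by (auto simp: ordered_tuples_def)
    ultimately show ?thesis by blast
  next
    case False
    then have "x k \<in> S" if "k \<le> m" for k using xin[OF that] xS[of k] that
      by (cases "k = m") auto
    then have "x \<in> ordered_tuples (Suc m) S"
      using ord ext by (auto simp: ordered_tuples_def PiE_def Pi_def extensional_def)
    then show ?thesis by blast
  qed
next
  fix x assume "x \<in> ordered_tuples (Suc m) S \<union> (\<lambda>x. x(m := p)) ` ordered_tuples m S"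
  then consider "x \<in> ordered_tuples (Suc m) S"
    | y where "y \<in> ordered_tuples m S" "x = y(m := p)" by blast
  then show "x \<in> ordered_tuples (Suc m) (insert p S)"
  proof cases
    case 1
    then show ?thesis by (auto simp: ordered_tuples_def PiE_def Pi_def)
  next
    case 2
    have "y k \<in> S" if "k < m" for k using 2(1) that by (auto simp: ordered_tuples_def)
    with 2 late show ?thesis
      by (auto simp: ordered_tuples_def PiE_def Pi_def extensional_def less_Suc_eq)
  qed
qed

text \<open>The kernel \<open>c\<close> is real valued so that one formula serves twice: with
  \<open>of_bool\<close> of the contention variables for a realisation, and with \<open>h\<close>
  for the conditional mean. Each pair of places enters exactly one factor, that of its earlier
  point; this is what later permits averaging factor by factor.\<close>

definition survival_weight ::
    "(point \<Rightarrow> point \<Rightarrow> real) \<Rightarrow> nat \<Rightarrow> (point \<Rightarrow> real) \<Rightarrow> (nat \<Rightarrow> point) \<Rightarrow> real" where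
  "survival_weight c m u x = (\<Prod>k<m. 1 - u (x k) * (\<Prod>j\<in>{k<..<m}. 1 - c (x j) (x k)))"

text \<open>The latest entry has an empty inner product, and its effect on the earlier ones is
  absorbed into \<open>u\<close>. For \<open>c\<close> given by \<open>h\<close> the new
  \<open>u\<close> is the function \<open>H\<close> of the theorem.\<close>

lemma survival_weight_Suc:
  "survival_weight c (Suc m) u x =
     (1 - u (x m)) * survival_weight c m (\<lambda>q. u q * (1 - c (x m) q)) x"
proof -
  have "{k<..<Suc m} = insert m {k<..<m}" if "k < m" for k using that by auto
  then have "(\<Prod>j\<in>{k<..<Suc m}. 1 - c (x j) (x k))
      = (1 - c (x m) (x k)) * (\<Prod>j\<in>{k<..<m}. 1 - c (x j) (x k))" if "k < m" for k
    using that by simp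
  moreover have "{m<..<Suc m} = {}" by auto
  ultimately show ?thesis by (simp add: survival_weight_def mult.assoc mult.commute)
qed

lemma survival_weight_cong:
  assumes "\<And>k. k < m \<Longrightarrow> x k = y k"
  shows "survival_weight c m u x = survival_weight c m u y"
  unfolding survival_weight_def using assms by (intro prod.cong) auto

text \<open>Strictly increasing timers make a tuple injective. This cuts the alternating sum of a
  finite configuration off at its cardinality.\<close>

lemma ordered_tuples_empty:
  assumes "finite S" "card S < m"
  shows "ordered_tuples m S = {}"
proof (rule ccontr)
  assume "ordered_tuples m S \<noteq> {}"
  then obtain x where x: "x \<in> {..<m} \<rightarrow>\<^sub>E S" "\<And>j k. j < k \<Longrightarrow> k < m \<Longrightarrow> snd (x j) < snd (x k)"
    by (auto simp: ordered_tuples_def)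
  have "inj_on x {..<m}"
    using x(2) by (intro linorder_inj_onI) (metis lessThan_iff order_less_irrefl, auto)
  then have "card {..<m} \<le> card S"
    using x(1) assms(1) by (intro card_inj_on_le[of x]) (auto simp: PiE_def)
  with assms show False by simp
qed

text \<open>Points are inserted in the order of their timers, which is where distinctness of the
  timers enters. The correction caused by a new point is the same expansion for a modified
  \<open>u\<close>, so the induction must leave \<open>u\<close> arbitrary.\<close>

lemma matern_inclusion_exclusion:
  assumes "finite S" "inj_on snd S"
  shows "(\<Prod>q\<in>matern_infinity S c. u q) =
    (\<Sum>m\<le>card S. (-1)^m * (\<Sum>x\<in>ordered_tuples m S. survival_weight (\<lambda>p q. of_bool (c p q)) m u x))"
proof -
  let ?w = "\<lambda>m u x. survival_weight (\<lambda>p q. of_bool (c p q)) m u x :: real"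
  \<comment> \<open>Any upper limit from \<open>card S\<close> on is allowed, because in the
    induction the expansion of the smaller set is needed with two different upper limits,
    \<open>N\<close> and \<open>N'\<close>.\<close>
  have "(\<Prod>q\<in>matern_infinity S c. u q) =
    (\<Sum>m\<le>N. (-1)^m * (\<Sum>x\<in>ordered_tuples m S. ?w m u x))" if "card S \<le> N" for N
    using assms that
  proof (induction S arbitrary: u N rule: finite_ranking_induct[where f=snd])
    case empty
    have "ordered_tuples m {} = {}" if "m > 0" for m
      by (rule ordered_tuples_empty) (use that in auto)
    then have "(\<Sum>m\<le>N. (-1)^m * (\<Sum>x\<in>ordered_tuples m {}. ?w m u x)) =
       (\<Sum>m\<in>{0}. (-1)^m * (\<Sum>x\<in>ordered_tuples m {}. ?w m u x))"
      by (intro sum.mono_neutral_right) auto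
    moreover have "matern_infinity {} c = {}" using matern_infinity_subset[of "{}"] by auto
    ultimately show ?case by (simp add: survival_weight_def)
  next
    case (insert p S)
    show ?case
    proof (cases "p \<in> S")
      case True
      then show ?thesis using insert by (simp add: insert_absorb)
    next
      case False
      then obtain N' where N: "N = Suc N'" "card S \<le> N'"
        using insert by (cases N) auto
      have inj: "inj_on snd S" using insert by auto
      have late: "snd q < snd p" if "q \<in> S" for q
        using insert(2)[of q] insert(4) that False by (auto simp: inj_on_def less_le)
      have ot: "ordered_tuples (Suc m) (insert p S) =
          ordered_tuples (Suc m) S \<union> (\<lambda>x. x(m := p)) ` ordered_tuples m S" for m
        by (intro ordered_tuples_insert_latest late)
      have mi: "matern_infinity (insert p S) c =
          (if \<forall>q\<in>matern_infinity S c. \<not> c p q then insert p (matern_infinity S c) else matern_infinity S c)"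
        by (intro matern_infinity_insert_latest insert(1) late)
      let ?u = "\<lambda>q. u q * (1 - of_bool (c p q))"
      \<comment> \<open>The sum splits into tuples that avoid \<open>p\<close> and tuples that end
        in \<open>p\<close>; peeling \<open>p\<close> off the latter lowers the order by one and so
        flips the sign.\<close>
      have S1: "(\<Sum>x\<in>ordered_tuples (Suc m) (insert p S). ?w (Suc m) u x) =
        (\<Sum>x\<in>ordered_tuples (Suc m) S. ?w (Suc m) u x) +
        (1 - u p) * (\<Sum>x\<in>ordered_tuples m S. ?w m ?u x)" for m
      proof -
        have inj': "inj_on (\<lambda>x. x(m := p)) (ordered_tuples m S)"
        proof (rule inj_onI)
          fix x y assume "x \<in> ordered_tuples m S" "y \<in> ordered_tuples m S" "x(m := p) = y(m := p)"
          then have "x \<in> extensional {..<m}" "y \<in> extensional {..<m}" "\<And>k. k \<noteq> m \<Longrightarrow> x k = y k"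
            by (auto simp: ordered_tuples_def PiE_def fun_eq_iff split: if_splits)
          then show "x = y" by (intro extensionalityI) auto
        qed
        have disj: "ordered_tuples (Suc m) S \<inter> (\<lambda>x. x(m := p)) ` ordered_tuples m S = {}"
          using False by (auto simp: ordered_tuples_def PiE_def Pi_def)
        have "(\<Sum>x\<in>ordered_tuples (Suc m) (insert p S). ?w (Suc m) u x) =
          (\<Sum>x\<in>ordered_tuples (Suc m) S. ?w (Suc m) u x) +
          (\<Sum>x\<in>ordered_tuples m S. ?w (Suc m) u (x(m := p)))"
          unfolding ot
          using insert(1) disj inj'
          by (subst sum.union_disjoint) (auto simp: finite_ordered_tuples sum.reindex)
        also have "(\<lambda>x. ?w (Suc m) u (x(m := p))) = (\<lambda>x. (1 - u p) * ?w m ?u x)"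
        proof
          fix x
          have "?w m ?u (x(m := p)) = ?w m ?u x" by (rule survival_weight_cong) auto
          then show "?w (Suc m) u (x(m := p)) = (1 - u p) * ?w m ?u x"
            by (simp add: survival_weight_Suc)
        qed
        finally show ?thesis by (simp add: sum_distrib_left)
      qed
      have "(\<Sum>m\<le>N. (-1)^m * (\<Sum>x\<in>ordered_tuples m (insert p S). ?w m u x)) =
        (\<Sum>m\<le>N. (-1)^m * (\<Sum>x\<in>ordered_tuples m S. ?w m u x))
        - (1 - u p) * (\<Sum>m\<le>N'. (-1)^m * (\<Sum>x\<in>ordered_tuples m S. ?w m ?u x))"
        unfolding N(1) sum.atMost_Suc_shift S1
        by (simp add: algebra_simps sum.distrib sum_distrib_left sum_negf sum_subtractf)
      also have "\<dots> = (\<Prod>q\<in>matern_infinity S c. u q) - (1 - u p) * (\<Prod>q\<in>matern_infinity S c. ?u q)"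
        using insert(3)[OF inj N(2), of ?u] insert(3)[OF inj, of N u] N by simp
      also have "\<dots> = (\<Prod>q\<in>matern_infinity (insert p S) c. u q)"
      proof -
        have fin: "finite (matern_infinity S c)"
          using insert(1) matern_infinity_subset finite_subset by blast
        have notin: "p \<notin> matern_infinity S c" using False matern_infinity_subset by blast
        \<comment> \<open>If no retained point contends with \<open>p\<close>, then
          \<open>?u\<close> agrees with \<open>u\<close> on the retained set and the difference
          leaves the factor \<open>u p\<close>. Otherwise the corrected product contains a zero
          factor, in accordance with the rejection of \<open>p\<close>.\<close>
        show ?thesis
        proof (cases "\<forall>q\<in>matern_infinity S c. \<not> c p q")
          case True
          then have "(\<Prod>q\<in>matern_infinity S c. ?u q) = (\<Prod>q\<in>matern_infinity S c. u q)"
            by (intro prod.cong) auto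
          with True fin notin show ?thesis
            by (simp add: mi algebra_simps)
        next
          case False
          then have "(\<Prod>q\<in>matern_infinity S c. ?u q) = 0"
            using fin by (intro prod_zero) auto
          then show ?thesis unfolding mi if_not_P[OF False] by simp
        qed
      qed
      finally show ?thesis by simp
    qed
  qed
  then show ?thesis by blast
qed

section \<open>Convergence of retention over growing windows\<close>

lemma one_minus_sum_le_prod:
  fixes u :: "'a \<Rightarrow> real"
  assumes "finite F" "\<And>x. x \<in> F \<Longrightarrow> u x \<in> {0..1}"
  shows "1 - (\<Sum>x\<in>F. 1 - u x) \<le> prod u F"
  using assms
proof (induction F)
  case (insert x F)
  have "1 - (\<Sum>y\<in>F. 1 - u y) \<le> prod u F" "prod u F \<le> 1" "0 \<le> u x" "u x \<le> 1"
    using insert by (auto intro: prod_le_1)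
  moreover have "0 \<le> (1 - u x) * (1 - prod u F)"
    using calculation by (intro mult_nonneg_nonneg) auto
  ultimately show ?case using insert(1,2) by (simp add: algebra_simps)
qed simp

text \<open>By the Weierstrass product inequality \<open>one_minus_sum_le_prod\<close>, the factors
  outside \<open>F\<close> multiply to at least 1 - e, so dropping them costs at most e. The error
  is independent of \<open>A\<close> as long as the tail condition holds.\<close>

lemma unordered_prod_approx:
  fixes u :: "'a \<Rightarrow> real"
  assumes u: "\<And>x. x \<in> A \<Longrightarrow> u x \<in> {0..1}"
    and tail: "\<And>G. finite G \<Longrightarrow> G \<subseteq> A - F \<Longrightarrow> (\<Sum>x\<in>G. 1 - u x) \<le> e"
    and F: "finite F"
  shows "\<bar>unordered_prod u A - prod u (A \<inter> F)\<bar> \<le> e"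
proof -
  have "(\<Sum>x\<in>{}. 1 - u x) \<le> e" by (rule tail) auto
  then have e: "0 \<le> e" by simp
  have upper: "unordered_prod u A \<le> prod u (A \<inter> F)"
    using u F by (intro unordered_prod_unit(3)) auto
  have "prod u (A \<inter> F) - e \<le> prod u G" if G: "finite G" "A \<inter> F \<subseteq> G" "G \<subseteq> A" for G
  proof -
    let ?P = "prod u (A \<inter> F)" and ?Q = "prod u (G - F)"
    have "0 \<le> ?P" "?P \<le> 1"
      using u F by (auto intro!: prod_nonneg prod_le_1)
    moreover have "1 - (\<Sum>x\<in>G - F. 1 - u x) \<le> ?Q"
      using u G by (intro one_minus_sum_le_prod) auto
    moreover have "(\<Sum>x\<in>G - F. 1 - u x) \<le> e"
      using G by (intro tail) auto
    moreover have "?Q \<le> 1"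
      using u G by (intro prod_le_1) auto
    ultimately have "?P * (1 - ?Q) \<le> 1 * e"
      using e by (intro mult_mono) auto
    moreover have "prod u G = ?P * ?Q"
    proof -
      have "G - (A \<inter> F) = G - F" using G by auto
      with prod.subset_diff[OF G(2,1), of u] show ?thesis by (simp add: mult.commute)
    qed
    ultimately show ?thesis by (simp add: algebra_simps)
  qed
  then have "eventually (\<lambda>G. prod u (A \<inter> F) - e \<le> prod u G) (finite_subsets_at_top A)"
    unfolding eventually_finite_subsets_at_top using F by (intro exI[of _ "A \<inter> F"]) auto
  then have "prod u (A \<inter> F) - e \<le> unordered_prod u A"
    by (intro tendsto_lowerbound[OF unordered_prod_unit(1)[OF u]]) auto
  with upper e show ?thesis by auto
qed

text \<open>Well-founded induction on \<open>p\<close>: its fate depends only on its earlier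
  neighbours, and finite branching lets the thresholds from which they are all present and settled
  be replaced by a common one.\<close>

lemma matern_infinity_window_eventually:
  assumes wf: "wf (earlier_nbr \<Xi> c)"
    and fb: "\<And>p. p \<in> \<Xi> \<Longrightarrow> finite {q. (q, p) \<in> earlier_nbr \<Xi> c}"
    and V: "incseq V" "(\<Union>n. V n) = \<Xi>"
  shows "eventually (\<lambda>n. p \<in> matern_infinity (V n) c \<longleftrightarrow> p \<in> matern_infinity \<Xi> c) sequentially"
  using wf
proof (induction p rule: wf_induct_rule)
  case (less p)
  have sub: "V n \<subseteq> \<Xi>" for n using V by auto
  have wfV: "wf (earlier_nbr (V n) c)" for n
    by (rule wf_subset[OF wf]) (use sub in \<open>auto simp: earlier_nbr_def\<close>)
  have ev: "eventually (\<lambda>n. q \<in> V n) sequentially" if "q \<in> \<Xi>" for q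
  proof -
    from \<open>q \<in> \<Xi>\<close> V(2) obtain N where "q \<in> V N" by blast
    then have "q \<in> V n" if "n \<ge> N" for n using V(1) that by (auto dest: incseqD)
    then show ?thesis by (auto simp: eventually_sequentially)
  qed
  show ?case
  proof (cases "p \<in> \<Xi>")
    case False
    then have "p \<notin> matern_infinity (V n) c" "p \<notin> matern_infinity \<Xi> c" for n
      using sub[of n] matern_infinity_subset[of "V n" c] matern_infinity_subset[of \<Xi> c] by auto
    then show ?thesis by simp
  next
    case True
    let ?Q = "{q. (q, p) \<in> earlier_nbr \<Xi> c}"
    have "eventually (\<lambda>n. \<forall>q\<in>?Q. q \<in> V n \<and>
        (q \<in> matern_infinity (V n) c \<longleftrightarrow> q \<in> matern_infinity \<Xi> c)) sequentially"
      using less.IH ev by (intro eventually_ball_finite fb True ballI eventually_conj)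
        (auto simp: earlier_nbr_def)
    then show ?thesis using ev[OF True]
    proof eventually_elim
      case (elim n)
      have "(q, p) \<in> earlier_nbr (V n) c \<longleftrightarrow> q \<in> ?Q" for q
      proof -
        have "q \<in> V n" if "q \<in> ?Q" using elim(1) that by blast
        with elim(2) sub[of n] show ?thesis by (auto simp: earlier_nbr_def)
      qed
      then show ?case
        using mem_matern_infinity_iff[OF wfV, of p n] mem_matern_infinity_iff[OF wf, of p] elim True
        by auto
    qed
  qed
qed

text \<open>Summability of 1 - u gives a finite set \<open>F\<close> outside which every
  configuration changes the product by at most e, uniformly over all subsets of
  \<open>\<Xi>\<close>. On \<open>F\<close> itself the retained set is eventually constant.\<close>

lemma matern_infinity_window_limit:
  assumes wf: "wf (earlier_nbr \<Xi> c)"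
    and fb: "\<And>p. p \<in> \<Xi> \<Longrightarrow> finite {q. (q, p) \<in> earlier_nbr \<Xi> c}"
    and V: "incseq V" "(\<Union>n. V n) = \<Xi>"
    and u: "\<And>p. p \<in> \<Xi> \<Longrightarrow> u p \<in> {0..1}"
    and summ: "(\<lambda>p. 1 - u p) summable_on \<Xi>"
  shows "(\<lambda>n. unordered_prod u (matern_infinity (V n) c))
    \<longlonglongrightarrow> (unordered_prod u (matern_infinity \<Xi> c) :: real)"
proof (rule LIMSEQ_I)
  fix r :: real assume r: "0 < r"
  \<comment> \<open>Two approximation errors of size e occur, one for the window and one for the
    limit; the third part makes the inequality strict.\<close>
  define e where "e = r / 3"
  have e: "0 < e" using r by (simp add: e_def)
  have "\<exists>F. finite F \<and> F \<subseteq> \<Xi> \<and> (\<forall>G. finite G \<longrightarrow> G \<subseteq> \<Xi> - F \<longrightarrow> (\<Sum>x\<in>G. 1 - u x) \<le> e)"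
  proof -
    let ?f = "\<lambda>p. 1 - u p"
    have "(sum ?f \<longlongrightarrow> infsum ?f \<Xi>) (finite_subsets_at_top \<Xi>)"
      using has_sum_infsum[OF summ] by (simp add: has_sum_def)
    then have "eventually (\<lambda>F. infsum ?f \<Xi> - e < sum ?f F) (finite_subsets_at_top \<Xi>)"
      using e by (intro order_tendstoD(1)) auto
    then obtain F where F: "finite F" "F \<subseteq> \<Xi>" "infsum ?f \<Xi> - e < sum ?f F"
      unfolding eventually_finite_subsets_at_top by blast
    have "sum ?f G \<le> e" if G: "finite G" "G \<subseteq> \<Xi> - F" for G
    proof -
      have "sum ?f (F \<union> G) \<le> infsum ?f \<Xi>"
        using F G u by (intro finite_sum_le_infsum summ) auto
      moreover have "sum ?f (F \<union> G) = sum ?f F + sum ?f G"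
        using F G by (intro sum.union_disjoint) auto
      ultimately show ?thesis using F by simp
    qed
    with F show ?thesis by blast
  qed
  then obtain F where F: "finite F" "F \<subseteq> \<Xi>"
    and tail: "\<And>G. finite G \<Longrightarrow> G \<subseteq> \<Xi> - F \<Longrightarrow> (\<Sum>x\<in>G. 1 - u x) \<le> e" by blast
  have approx: "\<bar>unordered_prod u A - prod u (A \<inter> F)\<bar> \<le> e" if "A \<subseteq> \<Xi>" for A
    using that F u by (intro unordered_prod_approx tail) auto
  have "eventually (\<lambda>n. \<forall>p\<in>F. p \<in> matern_infinity (V n) c \<longleftrightarrow> p \<in> matern_infinity \<Xi> c) sequentially"
    using matern_infinity_window_eventually[OF wf fb V] F
    by (intro eventually_ball_finite) auto
  then obtain N where "\<And>n. n \<ge> N \<Longrightarrow> \<forall>p\<in>F. p \<in> matern_infinity (V n) c \<longleftrightarrow> p \<in> matern_infinity \<Xi> c"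
    unfolding eventually_sequentially by blast
  then have N: "matern_infinity (V n) c \<inter> F = matern_infinity \<Xi> c \<inter> F" if "n \<ge> N" for n
    using that by blast
  have "norm (unordered_prod u (matern_infinity (V n) c) - unordered_prod u (matern_infinity \<Xi> c)) < r"
    if "n \<ge> N" for n
  proof -
    have "matern_infinity (V n) c \<subseteq> \<Xi>" using matern_infinity_subset[of "V n" c] V(2) by blast
    note approx[OF this, unfolded N[OF that]] approx[OF matern_infinity_subset[of \<Xi> c]]
    moreover have "r = 3 * e" by (simp add: e_def)
    ultimately show ?thesis unfolding real_norm_def using e by linarith
  qed
  then show "\<exists>N. \<forall>n\<ge>N. norm (unordered_prod u (matern_infinity (V n) c)
      - unordered_prod u (matern_infinity \<Xi> c)) < r" by blast
qed

section \<open>Counts of a Poisson process\<close>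

text \<open>The cover may overlap. Its disjointed version cuts \<open>D\<close> into countably many
  pieces, each still inside a member of the cover, and countable additivity assembles them.\<close>

lemma emeasure_eq_on_countable_cover:
  assumes sets: "sets M = sets N"
    and \<U>: "countable \<U>" "\<U> \<subseteq> sets M"
    and eq: "\<And>U D. U \<in> \<U> \<Longrightarrow> D \<in> sets M \<Longrightarrow> D \<subseteq> U \<Longrightarrow> emeasure M D = emeasure N D"
    and D: "D \<in> sets M" "D \<subseteq> \<Union>\<U>"
  shows "emeasure M D = emeasure N D"
proof (cases "\<U> = {}")
  case True
  with D show ?thesis by auto
next
  case False
  define A where "A = from_nat_into \<U>"
  have A: "A n \<in> \<U>" for n unfolding A_def using False by (rule from_nat_into)
  then have Am: "range A \<subseteq> sets M" using \<U> by auto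
  have "\<Union>\<U> = (\<Union>n. A n)"
    unfolding A_def using False \<U>(1) by (simp add: range_from_nat_into)
  then have DU: "D = (\<Union>n. D \<inter> disjointed A n)"
    using D(2) UN_disjointed_eq[of A] by auto
  have dm: "D \<inter> disjointed A n \<in> sets M" for n
    using sets.range_disjointed_sets[OF Am] D(1) by auto
  have disj: "disjoint_family (\<lambda>n. D \<inter> disjointed A n)"
    using disjoint_family_disjointed[of A] by (auto simp: disjoint_family_on_def)
  have "emeasure M D = (\<Sum>n. emeasure M (D \<inter> disjointed A n))"
    by (subst DU, rule suminf_emeasure[symmetric]) (use dm disj in auto)
  also have "\<dots> = (\<Sum>n. emeasure N (D \<inter> disjointed A n))"
    using disjointed_subset[of A] A dm by (intro suminf_cong eq) auto
  also have "\<dots> = emeasure N D"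
    by (subst (2) DU, rule suminf_emeasure) (use dm disj sets in auto)
  finally show ?thesis .
qed

text \<open>Unlike \<open>timed_intensity\<close>, this lives on all of the time axis, so that its
  sigma-algebra is the Borel one on all points. Nonnegativity of timers is imposed on the sets and
  integrands instead.\<close>

definition product_intensity :: "(real^2) measure \<Rightarrow> point measure" where
  "product_intensity L = L \<Otimes>\<^sub>M lborel"

context
  fixes L :: "(real^2) measure"
  assumes lf: "locally_finite_measure L"
begin

lemma sets_L: "sets L = sets borel" and space_L: "space L = UNIV"
  using lf sets_eq_imp_space_eq[of L borel] by (auto simp: locally_finite_measure_def)

lemma emeasure_cball_finite: "emeasure L (cball x r) < \<infinity>"
  using lf by (auto simp: locally_finite_measure_def)

lemma sigma_finite_L: "sigma_finite_measure L"
proof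
  have "x \<in> (\<Union>n. cball 0 (real n))" for x :: "real^2"
    using real_arch_simple[of "norm x"] by auto
  then have "(\<Union>n. cball 0 (real n)) = (UNIV :: (real^2) set)" by blast
  then show "\<exists>A. countable A \<and> A \<subseteq> sets L \<and> \<Union>A = space L \<and> (\<forall>a\<in>A. emeasure L a \<noteq> \<infinity>)"
    using emeasure_cball_finite
    by (intro exI[of _ "range (\<lambda>n. cball 0 (real n))"]) (auto simp: sets_L space_L less_top)
qed

lemma sets_product_intensity: "sets (product_intensity L) = sets borel"
  unfolding product_intensity_def borel_prod[symmetric]
  by (intro sets_pair_measure_cong sets_L) simp

lemma space_product_intensity: "space (product_intensity L) = UNIV"
  using sets_eq_imp_space_eq[OF sets_product_intensity] by simp

lemma sigma_finite_product_intensity: "sigma_finite_measure (product_intensity L)"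
  unfolding product_intensity_def
  by (intro sigma_finite_pair_measure sigma_finite_L sigma_finite_lborel)

lemma timed_intensity_borel:
  assumes B: "B \<in> sets borel" "B \<subseteq> UNIV \<times> {0..}"
  shows "B \<in> sets (timed_intensity L)"
    and "emeasure (timed_intensity L) B = emeasure (product_intensity L) B"
proof -
  let ?R = "restrict_space lborel {0::real..}"
  have sp: "space (timed_intensity L) = UNIV \<times> {0..}"
    by (simp add: timed_intensity_def space_pair_measure space_L space_restrict_space)
  have "(\<lambda>p. (fst p, snd p)) \<in> timed_intensity L \<rightarrow>\<^sub>M borel \<Otimes>\<^sub>M borel"
  proof (rule measurable_Pair)
    show "fst \<in> timed_intensity L \<rightarrow>\<^sub>M borel"
      unfolding timed_intensity_def
      by (rule measurable_compose[OF measurable_fst]) (simp add: measurable_ident_sets sets_L)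
    have "(\<lambda>x. x) \<in> ?R \<rightarrow>\<^sub>M borel" by (rule measurable_restrict_space1) simp
    then show "snd \<in> timed_intensity L \<rightarrow>\<^sub>M borel"
      unfolding timed_intensity_def by (rule measurable_compose[OF measurable_snd])
  qed
  then have "(\<lambda>p. p) \<in> timed_intensity L \<rightarrow>\<^sub>M borel"
    by (simp add: borel_prod)
  from measurable_sets[OF this B(1)] show Bm: "B \<in> sets (timed_intensity L)"
    using B(2) by (simp add: sp Int_absorb2)
  interpret R: sigma_finite_measure ?R
    by (intro sigma_finite_measure_restrict_space sigma_finite_lborel) auto
  have "emeasure (timed_intensity L) B = (\<integral>\<^sup>+x. emeasure ?R (Pair x -` B) \<partial>L)"
    unfolding timed_intensity_def
    by (rule R.emeasure_pair_measure_alt) (use Bm in \<open>simp add: timed_intensity_def\<close>)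
  also have "\<dots> = (\<integral>\<^sup>+x. emeasure lborel (Pair x -` B) \<partial>L)"
    using B(2) by (intro nn_integral_cong emeasure_restrict_space) auto
  also have "\<dots> = emeasure (product_intensity L) B"
    unfolding product_intensity_def
    by (rule lborel.emeasure_pair_measure_alt[symmetric])
      (use B(1) sets_product_intensity in \<open>simp only: product_intensity_def\<close>)
  finally show "emeasure (timed_intensity L) B = emeasure (product_intensity L) B" .
qed

lemma emeasure_product_intensity_bounded:
  assumes "bounded B"
  shows "emeasure (product_intensity L) B < \<infinity>"
proof -
  obtain r where r: "\<forall>p\<in>B. norm p \<le> r" using assms unfolding bounded_iff by blast
  have "B \<subseteq> cball 0 r \<times> {-r..r}"
  proof
    fix p assume "p \<in> B"
    then have "norm p \<le> r" using r by blast
    moreover have "norm (fst p) \<le> norm p" "norm (snd p) \<le> norm p"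
      using norm_fst_le[of "fst p" "snd p"] norm_snd_le[of "snd p" "fst p"] by simp_all
    ultimately have "norm (fst p) \<le> r" "\<bar>snd p\<bar> \<le> r" by auto
    then show "p \<in> cball 0 r \<times> {-r..r}"
      by (auto simp: mem_Times_iff)
  qed
  then have "emeasure (product_intensity L) B \<le> emeasure (product_intensity L) (cball 0 r \<times> {-r..r})"
    by (intro emeasure_mono)
      (auto simp: sets_product_intensity borel_prod[symmetric] intro!: pair_measureI)
  also have "\<dots> = emeasure L (cball 0 r) * emeasure lborel {-r..r}"
    unfolding product_intensity_def by (rule lborel.emeasure_pair_measure_Times) (auto simp: sets_L)
  also have "\<dots> < \<infinity>"
    using emeasure_cball_finite[of 0 r] by (auto simp: ennreal_mult_less_top emeasure_lborel_Icc_eq)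
  finally show ?thesis .
qed

end

lemma nn_integral_poisson_count:
  assumes "prob_space P" and X: "X \<in> P \<rightarrow>\<^sub>M count_space (UNIV :: nat set)"
    and pois: "\<And>k. measure P {\<omega> \<in> space P. X \<omega> = k} = exp (- l) * l ^ k / fact k"
    and l: "0 \<le> l"
  shows "(\<integral>\<^sup>+\<omega>. ennreal (real (X \<omega>)) \<partial>P) = ennreal l"
proof -
  interpret prob_space P by fact
  have [measurable]: "{\<omega> \<in> space P. X \<omega> = k} \<in> sets P" for k
    using measurable_sets[OF X, of "{k}"] by (simp add: vimage_def Int_def conj_commute)
  have "ennreal (real (X \<omega>)) = (\<Sum>k. ennreal (real k) * indicator {\<omega> \<in> space P. X \<omega> = k} \<omega>)"
    if "\<omega> \<in> space P" for \<omega>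
    using that by (subst suminf_finite[of "{X \<omega>}"]) auto
  then have "(\<integral>\<^sup>+\<omega>. ennreal (real (X \<omega>)) \<partial>P) =
      (\<integral>\<^sup>+\<omega>. (\<Sum>k. ennreal (real k) * indicator {\<omega> \<in> space P. X \<omega> = k} \<omega>) \<partial>P)"
    by (intro nn_integral_cong) auto
  also have "\<dots> = (\<Sum>k. ennreal (real k) * emeasure P {\<omega> \<in> space P. X \<omega> = k})"
    by (subst nn_integral_suminf) (auto simp: nn_integral_cmult_indicator)
  also have "\<dots> = (\<Sum>k. ennreal (real k * (exp (- l) * l ^ k / fact k)))"
    by (intro suminf_cong) (simp add: emeasure_eq_measure pois ennreal_mult'[symmetric])
  also have "\<dots> = ennreal l"
  proof -
    have "(\<lambda>k. exp (- l) * l * (l ^ k / fact k)) sums (exp (- l) * l * exp l)"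
      using exp_converges[of l] by (intro sums_mult) (simp add: divide_inverse_commute)
    moreover have "exp (- l) * l * (l ^ k / fact k) =
        real (Suc k) * (exp (- l) * l ^ Suc k / fact (Suc k))" for k
      by (simp add: fact_reduce[of "Suc k"] nonzero_divide_mult_cancel_left del: of_nat_Suc)
    moreover have "exp (- l) * l * exp l = l" by (simp add: exp_minus)
    ultimately have "(\<lambda>k. real (Suc k) * (exp (- l) * l ^ Suc k / fact (Suc k))) sums l"
      by (simp only:)
    \<comment> \<open>The term for k = 0 vanishes, so undoing the index shift leaves the sum
      unchanged.\<close>
    then have "(\<lambda>k. real k * (exp (- l) * l ^ k / fact k)) sums l"
      by (subst (asm) sums_Suc_iff) simp
    then show ?thesis
      using l by (subst suminf_ennreal2) (auto simp: sums_iff)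
  qed
  finally show ?thesis .
qed

locale poisson_points = prob_space P
  for P :: "'w measure" +
  fixes L :: "(real^2) measure" and \<Phi> :: "'w \<Rightarrow> point set"
  assumes lf: "locally_finite_measure L"
    and pp: "poisson_point_process P (timed_intensity L) \<Phi>"
begin

abbreviation "\<mu> \<equiv> product_intensity L"

abbreviation tuple_intensity :: "nat \<Rightarrow> (nat \<Rightarrow> point) measure" where
  "tuple_intensity m \<equiv> PiM {..<m} (\<lambda>_. \<mu>)"

sublocale mu: sigma_finite_measure \<mu>
  by (rule sigma_finite_product_intensity[OF lf])

lemma sets_mu [measurable_cong]: "sets \<mu> = sets borel"
  by (rule sets_product_intensity[OF lf])

lemma space_mu: "space \<mu> = UNIV"
  by (rule space_product_intensity[OF lf])

lemma timer_nonneg: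
  assumes "\<omega> \<in> space P" "p \<in> \<Phi> \<omega>"
  shows "0 \<le> snd p"
proof -
  have "\<Phi> \<omega> \<subseteq> space (timed_intensity L)"
    using pp assms(1) by (simp add: poisson_point_process_def)
  with assms(2) have "p \<in> space (timed_intensity L)" by blast
  then show ?thesis
    by (auto simp: timed_intensity_def space_pair_measure space_restrict_space)
qed

lemma finite_points: "\<omega> \<in> space P \<Longrightarrow> bounded B \<Longrightarrow> finite (\<Phi> \<omega> \<inter> B)"
  using pp by (auto simp: poisson_point_process_def)

lemma count_distribution:
  assumes "B \<in> sets borel" "bounded B" "B \<subseteq> UNIV \<times> {0..}"
  shows "measure P {\<omega> \<in> space P. card (\<Phi> \<omega> \<inter> B) = k} =
    exp (- measure \<mu> B) * measure \<mu> B ^ k / fact k"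
  using pp[unfolded poisson_point_process_def, THEN conjunct2, THEN conjunct1]
    assms timed_intensity_borel[OF lf assms(1,3)]
  by (simp add: measure_def)

lemma count_indep:
  fixes n :: nat
  assumes "\<And>i. i < n \<Longrightarrow> B i \<in> sets borel" "\<And>i. i < n \<Longrightarrow> bounded (B i)"
    "\<And>i. i < n \<Longrightarrow> B i \<subseteq> UNIV \<times> {0..}" "disjoint_family_on B {..<n}"
  shows "indep_vars (\<lambda>_. count_space UNIV) (\<lambda>i \<omega>. card (\<Phi> \<omega> \<inter> B i)) {..<n}"
proof -
  have "\<forall>i<n. B i \<in> sets (timed_intensity L) \<and> bounded (B i)"
    by (intro allI impI conjI timed_intensity_borel(1)[OF lf] assms)
  with assms(4) show ?thesis
    using pp[unfolded poisson_point_process_def, THEN conjunct2, THEN conjunct2] by simp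
qed

lemma count_measurable:
  assumes "B \<in> sets borel" "bounded B" "B \<subseteq> UNIV \<times> {0..}"
  shows "(\<lambda>\<omega>. card (\<Phi> \<omega> \<inter> B)) \<in> P \<rightarrow>\<^sub>M count_space UNIV"
  using count_indep[of 1 "\<lambda>_. B"] assms
  by (auto simp: indep_vars_def disjoint_family_on_def lessThan_Suc)

lemma count_mean:
  assumes "B \<in> sets borel" "bounded B" "B \<subseteq> UNIV \<times> {0..}"
  shows "(\<integral>\<^sup>+\<omega>. ennreal (real (card (\<Phi> \<omega> \<inter> B))) \<partial>P) = emeasure \<mu> B"
proof -
  have "(\<integral>\<^sup>+\<omega>. ennreal (real (card (\<Phi> \<omega> \<inter> B))) \<partial>P) = ennreal (measure \<mu> B)"
    using assms by (intro nn_integral_poisson_count prob_space_axioms count_measurable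
        count_distribution) auto
  also have "\<dots> = emeasure \<mu> B"
    using emeasure_product_intensity_bounded[OF lf assms(2)]
    by (intro emeasure_eq_ennreal_measure[symmetric]) auto
  finally show ?thesis .
qed

text \<open>Since the sets are disjoint, independence reduces the mean of the product to first
  moments; no higher moment of a single count is ever computed.\<close>

lemma count_prod_mean:
  fixes n :: nat
  assumes "\<And>i. i < n \<Longrightarrow> B i \<in> sets borel" "\<And>i. i < n \<Longrightarrow> bounded (B i)"
    "\<And>i. i < n \<Longrightarrow> B i \<subseteq> UNIV \<times> {0..}" "disjoint_family_on B {..<n}"
  shows "(\<integral>\<^sup>+\<omega>. (\<Prod>i<n. ennreal (real (card (\<Phi> \<omega> \<inter> B i)))) \<partial>P) = (\<Prod>i<n. emeasure \<mu> (B i))"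
proof -
  have "indep_vars (\<lambda>_. borel) (\<lambda>i \<omega>. ennreal (real (card (\<Phi> \<omega> \<inter> B i)))) {..<n}"
    using count_indep[OF assms] by (rule indep_vars_compose2) auto
  then have "(\<integral>\<^sup>+\<omega>. (\<Prod>i<n. ennreal (real (card (\<Phi> \<omega> \<inter> B i)))) \<partial>P) =
      (\<Prod>i<n. \<integral>\<^sup>+\<omega>. ennreal (real (card (\<Phi> \<omega> \<inter> B i))) \<partial>P)"
    by (subst indep_vars_nn_integral) auto
  also have "\<dots> = (\<Prod>i<n. emeasure \<mu> (B i))"
    using assms by (intro prod.cong count_mean) auto
  finally show ?thesis .
qed

end

section \<open>The ordered Campbell formula\<close>

abbreviation tuple_borel :: "nat \<Rightarrow> (nat \<Rightarrow> point) measure" where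
  "tuple_borel m \<equiv> PiM {..<m} (\<lambda>_. borel)"

text \<open>Tuples are extensional functions as in \<open>ordered_tuples\<close>, hence points of a
  product space. The sign condition compensates for the negative times that
  \<open>product_intensity\<close> admits.\<close>

definition time_ordered :: "nat \<Rightarrow> (nat \<Rightarrow> point) set" where
  "time_ordered m = {x \<in> {..<m} \<rightarrow>\<^sub>E UNIV. (\<forall>k<m. 0 \<le> snd (x k)) \<and> (\<forall>k<m. \<forall>j<k. snd (x j) < snd (x k))}"

lemma time_ordered_measurable [measurable]:
  "time_ordered m \<in> sets (tuple_borel m)"
proof -
  have "{x \<in> space (tuple_borel m).
      (\<forall>k\<in>{..<m}. 0 \<le> snd (x k)) \<and> (\<forall>k\<in>{..<m}. \<forall>j\<in>{..<k}. snd (x j) < snd (x k))}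
    \<in> sets (tuple_borel m)"
  proof (intro sets.sets_Collect_conj sets.sets_Collect_finite_All finite_lessThan)
    fix k assume k: "k \<in> {..<m}"
    have c: "(\<lambda>x. snd (x i)) \<in> borel_measurable (tuple_borel m)"
      if "i < m" for i
      using that by (intro measurable_compose[OF measurable_component_singleton[of i] borel_measurable_continuous_onI])
        (auto intro: continuous_intros)
    show "{x \<in> space (tuple_borel m). 0 \<le> snd (x k)} \<in> sets (tuple_borel m)"
      using c[of k] k by simp
    fix j assume "j \<in> {..<k}"
    then show "{x \<in> space (tuple_borel m). snd (x j) < snd (x k)} \<in> sets (tuple_borel m)"
      using c[of k] c[of j] k by simp
  qed
  also have "{x \<in> space (tuple_borel m).
      (\<forall>k\<in>{..<m}. 0 \<le> snd (x k)) \<and> (\<forall>k\<in>{..<m}. \<forall>j\<in>{..<k}. snd (x j) < snd (x k))} = time_ordered m"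
    by (auto simp: time_ordered_def space_PiM)
  finally show ?thesis .
qed

text \<open>The time intervals are half open, so consecutive slots are disjoint for a sorted list of
  endpoints. Rational endpoints and integer radii make the family of boxes countable.\<close>

definition slot_box :: "nat \<Rightarrow> rat list \<Rightarrow> nat \<Rightarrow> point set" where
  "slot_box R r k = cball 0 (real R) \<times> {of_rat (r ! k)..<of_rat (r ! Suc k)}"

text \<open>Strictly increasing timers can be separated by rationals, so every ordered tuple lies in
  a box whose sides occupy disjoint time slots. This is why disjoint counts determine the law of
  ordered tuples.\<close>

lemma time_ordered_cover:
  assumes x: "x \<in> time_ordered m"
  shows "\<exists>R r. length r = Suc m \<and> sorted r \<and> 0 \<le> r ! 0 \<and> x \<in> PiE {..<m} (slot_box R r)"
proof -
  let ?t = "\<lambda>k. snd (x k)"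
  have t0: "k < m \<Longrightarrow> 0 \<le> ?t k" and t: "j < k \<Longrightarrow> k < m \<Longrightarrow> ?t j < ?t k" for j k
    using x by (auto simp: time_ordered_def)
  \<comment> \<open>The endpoint of index k lies after timer k - 1 and not after timer k. The first
    endpoint is 0 because the first timer may itself be 0; the last one only has to exceed the last
    timer.\<close>
  have "\<exists>q::rat. (k = 0 \<longrightarrow> q = 0) \<and> (k > 0 \<longrightarrow> ?t (k - 1) < of_rat q) \<and> (k < m \<longrightarrow> of_rat q \<le> ?t k)"
    if "k \<le> m" for k
  proof -
    from that consider "k = 0" | "0 < k" "k < m" | "0 < k" "k = m" by (cases "k = 0"; cases "k = m"; auto)
    then show ?thesis
    proof cases
      case 1
      then show ?thesis using t0[of 0] by (intro exI[of _ 0]) auto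
    next
      case 2
      then have "?t (k - 1) < ?t k" by (intro t) auto
      from of_rat_dense[OF this] obtain q where "?t (k - 1) < of_rat q" "of_rat q < ?t k" by blast
      with 2 show ?thesis by (intro exI[of _ q]) auto
    next
      case 3
      have "?t (k - 1) < ?t (k - 1) + 1" by simp
      from of_rat_dense[OF this] obtain q where "?t (k - 1) < of_rat q" by blast
      with 3 show ?thesis by (intro exI[of _ q]) auto
    qed
  qed
  then obtain q :: "nat \<Rightarrow> rat" where q: "\<And>k. k \<le> m \<Longrightarrow> (k = 0 \<longrightarrow> q k = 0) \<and>
      (k > 0 \<longrightarrow> ?t (k - 1) < of_rat (q k)) \<and> (k < m \<longrightarrow> of_rat (q k) \<le> ?t k)"
    by metis
  have q0: "q 0 = 0" using q[of 0] by simp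
  have qt: "of_rat (q k) \<le> ?t k" "?t k < of_rat (q (Suc k))" if "k < m" for k
    using q[of k] q[of "Suc k"] that by auto
  define r where "r = map q [0..<Suc m]"
  have rk: "r ! k = q k" if "k \<le> m" for k using that by (simp add: r_def del: upt_Suc)
  have len: "length r = Suc m" by (simp add: r_def)
  have "sorted r"
    unfolding sorted_iff_nth_Suc
  proof (intro allI impI)
    fix k assume "Suc k < length r"
    then have k: "k < m" by (simp add: len)
    from qt[OF k] have "(of_rat (q k) :: real) < of_rat (q (Suc k))" by linarith
    then show "r ! k \<le> r ! Suc k" using k by (simp add: rk of_rat_less)
  qed
  obtain R where R: "(\<Sum>k<m. norm (fst (x k))) \<le> real R"
    using real_arch_simple by blast
  have "x \<in> PiE {..<m} (slot_box R r)"
  proof (rule PiE_I)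
    fix k assume k: "k \<in> {..<m}"
    have "norm (fst (x k)) \<le> (\<Sum>k<m. norm (fst (x k)))"
      using k by (intro member_le_sum) auto
    with R qt[of k] k show "x k \<in> slot_box R r k"
      by (auto simp: slot_box_def mem_Times_iff rk)
  next
    fix k assume "k \<notin> {..<m}"
    then show "x k = undefined" using x by (auto simp: time_ordered_def PiE_def extensional_def)
  qed
  with len \<open>sorted r\<close> q0 rk[of 0] show ?thesis
    by (intro exI[of _ R] exI[of _ r]) simp
qed

section \<open>Enumerated points and their moment measures\<close>

locale enumerated_points = poisson_points P L \<Phi>
  for P :: "'w measure" and L :: "(real^2) measure" and \<Phi> :: "'w \<Rightarrow> point set" +
  fixes I :: "'w \<Rightarrow> nat set" and \<xi> :: "nat \<Rightarrow> 'w \<Rightarrow> point"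
  assumes enum: "measurable_enumeration P \<Phi> I \<xi>"
begin

abbreviation "G \<equiv> enumeration_algebra P I \<xi>"

lemma bij_enum: "\<omega> \<in> space P \<Longrightarrow> bij_betw (\<lambda>n. \<xi> n \<omega>) (I \<omega>) (\<Phi> \<omega>)"
  using enum by (simp add: measurable_enumeration_def)

lemma enum_generator: "{{\<omega> \<in> space P. n \<in> I \<omega> \<and> \<xi> n \<omega> \<in> B} | n B. B \<in> sets borel} \<subseteq> Pow (space P)"
  by auto

lemma space_G [simp]: "space G = space P"
  unfolding enumeration_algebra_def by (rule space_measure_of[OF enum_generator])

lemma sets_G_basic: "B \<in> sets borel \<Longrightarrow> {\<omega> \<in> space P. n \<in> I \<omega> \<and> \<xi> n \<omega> \<in> B} \<in> sets G"
  unfolding enumeration_algebra_def by (rule in_measure_of) auto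

lemma subalg_G: "subalgebra P G"
  unfolding subalgebra_def
proof
  have "sets G = sigma_sets (space P) {{\<omega> \<in> space P. n \<in> I \<omega> \<and> \<xi> n \<omega> \<in> B} | n B. B \<in> sets borel}"
    unfolding enumeration_algebra_def by (rule sets_measure_of[OF enum_generator])
  also have "\<dots> \<subseteq> sets P"
    using enum by (intro sets.sigma_sets_subset) (auto simp: measurable_enumeration_def)
  finally show "sets G \<subseteq> sets P" .
qed simp

lemma sets_G_P: "A \<in> sets G \<Longrightarrow> A \<in> sets P"
  using subalg_G by (auto simp: subalgebra_def)

lemma sets_G_index: "{\<omega> \<in> space P. n \<in> I \<omega>} \<in> sets G"
  using sets_G_basic[of UNIV n] by simp

text \<open>Total version of the enumeration: \<open>\<xi> n\<close> need not be measurable where the index is unused.\<close>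

definition X :: "nat \<Rightarrow> 'w \<Rightarrow> point" where
  "X n \<omega> = (if n \<in> I \<omega> then \<xi> n \<omega> else 0)"

lemma X_measurable_G [measurable]: "X n \<in> G \<rightarrow>\<^sub>M borel"
proof (rule measurableI)
  fix B :: "point set" assume B: "B \<in> sets borel"
  have "X n -` B \<inter> space G = {\<omega> \<in> space P. n \<in> I \<omega> \<and> \<xi> n \<omega> \<in> B} \<union>
      (if 0 \<in> B then space G - {\<omega> \<in> space P. n \<in> I \<omega>} else {})"
  proof (rule set_eqI)
    fix \<omega>
    show "\<omega> \<in> X n -` B \<inter> space G \<longleftrightarrow> \<omega> \<in> {\<omega> \<in> space P. n \<in> I \<omega> \<and> \<xi> n \<omega> \<in> B} \<union>
        (if 0 \<in> B then space G - {\<omega> \<in> space P. n \<in> I \<omega>} else {})"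
      by (cases "n \<in> I \<omega>"; cases "\<omega> \<in> space P"; simp add: X_def)
  qed
  also have "\<dots> \<in> sets G"
    using sets_G_basic[OF B, of n] sets.compl_sets[OF sets_G_index[of n]]
    by (cases "0 \<in> B") (simp_all add: sets.Un)
  finally show "X n -` B \<inter> space G \<in> sets G" .
qed simp

lemma X_measurable_P [measurable]: "X n \<in> P \<rightarrow>\<^sub>M borel"
  by (rule measurable_from_subalg[OF subalg_G X_measurable_G])

text \<open>A countable index set that does not depend on the outcome. Sums over the random set of
  tuples of points become sums over it, weighted by the events \<open>used\<close>, which settles
  measurability and allows exchanging sum and expectation.\<close>

definition index_tuples :: "nat \<Rightarrow> (nat \<Rightarrow> nat) set" where
  "index_tuples m = {..<m} \<rightarrow>\<^sub>E UNIV"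

definition used :: "nat \<Rightarrow> (nat \<Rightarrow> nat) \<Rightarrow> 'w set" where
  "used m i = {\<omega> \<in> space P. \<forall>k<m. i k \<in> I \<omega>}"

definition tuple :: "nat \<Rightarrow> (nat \<Rightarrow> nat) \<Rightarrow> 'w \<Rightarrow> nat \<Rightarrow> point" where
  "tuple m i \<omega> = (\<lambda>k\<in>{..<m}. X (i k) \<omega>)"

lemma countable_index_tuples: "countable (index_tuples m)"
  unfolding index_tuples_def by (intro countable_PiE) auto

lemma used_G: "used m i \<in> sets G"
proof -
  have "used m i = {\<omega> \<in> space G. \<forall>k\<in>{..<m}. \<omega> \<in> {\<omega> \<in> space P. i k \<in> I \<omega>}}"
    by (auto simp: used_def)
  also have "\<dots> \<in> sets G"
    using sets_G_index by (intro sets.sets_Collect_finite_All) (auto simp: Int_def[symmetric] Collect_conj_eq)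
  finally show ?thesis .
qed

lemma used_P [measurable]: "used m i \<in> sets P"
  using used_G sets_G_P by blast

lemma tuple_measurable_G: "tuple m i \<in> G \<rightarrow>\<^sub>M tuple_borel m"
  unfolding tuple_def by (rule measurable_restrict) auto

lemma tuple_measurable_P [measurable]: "tuple m i \<in> P \<rightarrow>\<^sub>M tuple_borel m"
  by (rule measurable_from_subalg[OF subalg_G tuple_measurable_G])

lemma bij_tuple:
  assumes \<omega>: "\<omega> \<in> space P"
  shows "bij_betw (\<lambda>i. tuple m i \<omega>) {i \<in> index_tuples m. \<omega> \<in> used m i} ({..<m} \<rightarrow>\<^sub>E \<Phi> \<omega>)"
proof -
  let ?f = "\<lambda>n. \<xi> n \<omega>" and ?A = "{i \<in> index_tuples m. \<omega> \<in> used m i}"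
  note b = bij_enum[OF \<omega>]
  have val: "tuple m i \<omega> k = ?f (i k)" if "i \<in> ?A" "k < m" for i k
    using that by (auto simp: tuple_def X_def used_def)
  have A: "?A = {..<m} \<rightarrow>\<^sub>E I \<omega>"
    using \<omega> by (auto simp: index_tuples_def used_def PiE_def Pi_def)
  have mem: "tuple m i \<omega> \<in> {..<m} \<rightarrow>\<^sub>E \<Phi> \<omega>" if i: "i \<in> ?A" for i
  proof (rule PiE_I)
    fix k assume k: "k \<in> {..<m}"
    then have "i k \<in> I \<omega>" using i by (auto simp: used_def)
    then have "?f (i k) \<in> \<Phi> \<omega>" using b by (auto simp: bij_betw_def)
    then show "tuple m i \<omega> k \<in> \<Phi> \<omega>" using val[OF i] k by simp
  qed (simp add: tuple_def)
  show ?thesis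
  proof (rule bij_betwI')
    fix i j assume i: "i \<in> ?A" and j: "j \<in> ?A"
    show "tuple m i \<omega> = tuple m j \<omega> \<longleftrightarrow> i = j"
    proof
      assume eq: "tuple m i \<omega> = tuple m j \<omega>"
      show "i = j"
      proof (rule PiE_ext)
        show "i \<in> {..<m} \<rightarrow>\<^sub>E I \<omega>" "j \<in> {..<m} \<rightarrow>\<^sub>E I \<omega>" using i j A by auto
        fix k assume k: "k \<in> {..<m}"
        then have "?f (i k) = ?f (j k)" using eq val[OF i, of k] val[OF j, of k] by simp
        moreover have "i k \<in> I \<omega>" "j k \<in> I \<omega>" using i j k by (auto simp: used_def)
        ultimately show "i k = j k" using b by (auto simp: bij_betw_def inj_on_def)
      qed
    qed simp
  next
    show "\<And>i. i \<in> ?A \<Longrightarrow> tuple m i \<omega> \<in> {..<m} \<rightarrow>\<^sub>E \<Phi> \<omega>" by (rule mem)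
  next
    fix x assume x: "x \<in> {..<m} \<rightarrow>\<^sub>E \<Phi> \<omega>"
    define i where "i = (\<lambda>k\<in>{..<m}. inv_into (I \<omega>) ?f (x k))"
    have xk: "x k \<in> ?f ` I \<omega>" if "k < m" for k using x that b by (auto simp: bij_betw_def)
    have i: "i \<in> ?A" unfolding A i_def using xk by (auto intro: inv_into_into)
    have "x = tuple m i \<omega>"
    proof (rule PiE_ext[OF x mem[OF i]])
      show "x k = tuple m i \<omega> k" if "k \<in> {..<m}" for k
        using val[OF i, of k] f_inv_into_f[OF xk[of k]] that by (simp add: i_def)
    qed
    with i show "\<exists>i\<in>?A. x = tuple m i \<omega>" by blast
  qed
qed

lemma nn_integral_tuples:
  assumes \<omega>: "\<omega> \<in> space P"
  shows "(\<integral>\<^sup>+i. indicator (used m i) \<omega> * f (tuple m i \<omega>) \<partial>count_space (index_tuples m)) =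
    (\<integral>\<^sup>+x. f x \<partial>count_space ({..<m} \<rightarrow>\<^sub>E \<Phi> \<omega>))"
proof -
  have "(\<integral>\<^sup>+i. indicator (used m i) \<omega> * f (tuple m i \<omega>) \<partial>count_space (index_tuples m)) =
    (\<integral>\<^sup>+i. f (tuple m i \<omega>) * indicator {i. \<omega> \<in> used m i} i \<partial>count_space (index_tuples m))"
    by (intro nn_integral_cong) (auto split: split_indicator)
  also have "\<dots> = (\<integral>\<^sup>+i. f (tuple m i \<omega>) \<partial>count_space {i \<in> index_tuples m. \<omega> \<in> used m i})"
    by (subst nn_integral_count_space_indicator[of "index_tuples m"], simp,
        subst (2) nn_integral_count_space_indicator, simp)
      (auto intro!: nn_integral_cong split: split_indicator)
  also have "\<dots> = (\<integral>\<^sup>+x. f x \<partial>count_space ({..<m} \<rightarrow>\<^sub>E \<Phi> \<omega>))"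
    by (rule nn_integral_bij_count_space[OF bij_tuple[OF \<omega>]])
  finally show ?thesis .
qed

lemma nn_integral_ordered_tuples:
  assumes \<omega>: "\<omega> \<in> space P"
  shows "(\<integral>\<^sup>+x. f x * indicator (time_ordered m) x \<partial>count_space ({..<m} \<rightarrow>\<^sub>E \<Phi> \<omega>)) =
    (\<integral>\<^sup>+x. f x \<partial>count_space (ordered_tuples m (\<Phi> \<omega>)))"
proof -
  have "ordered_tuples m (\<Phi> \<omega>) = {x \<in> {..<m} \<rightarrow>\<^sub>E \<Phi> \<omega>. x \<in> time_ordered m}"
  proof -
    have "0 \<le> snd (x k)" if "x \<in> {..<m} \<rightarrow>\<^sub>E \<Phi> \<omega>" "k < m" for x k
      using timer_nonneg[OF \<omega> PiE_mem[OF that(1)]] that(2) by simp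
    moreover have "x \<in> {..<m} \<rightarrow>\<^sub>E UNIV" if "x \<in> {..<m} \<rightarrow>\<^sub>E \<Phi> \<omega>" for x
      using that by (simp add: PiE_def)
    ultimately show ?thesis
      unfolding ordered_tuples_def time_ordered_def by blast
  qed
  then show ?thesis
    by (subst (1 2) nn_integral_count_space_indicator)
      (auto intro!: nn_integral_cong split: split_indicator)
qed

text \<open>The m-th moment measure of the process: the expected number of m-tuples of its points
  lying in a given set, repetitions included. It is built as an image measure so that its
  integration formula follows from Tonelli.\<close>

definition moment_measure :: "nat \<Rightarrow> (nat \<Rightarrow> point) measure" where
  "moment_measure m = distr (density (count_space (index_tuples m) \<Otimes>\<^sub>M P)
     (\<lambda>(i, \<omega>). indicator (used m i) \<omega>)) (tuple_borel m) (\<lambda>(i, \<omega>). tuple m i \<omega>)"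

lemma sets_moment_measure: "sets (moment_measure m) = sets (tuple_borel m)"
  by (simp add: moment_measure_def)

lemma nn_integral_moment_measure:
  assumes f[measurable]: "f \<in> borel_measurable (tuple_borel m)"
  shows "(\<integral>\<^sup>+x. f x \<partial>moment_measure m) =
    (\<integral>\<^sup>+\<omega>. (\<integral>\<^sup>+x. f x \<partial>count_space ({..<m} \<rightarrow>\<^sub>E \<Phi> \<omega>)) \<partial>P)"
proof -
  let ?C = "count_space (index_tuples m)"
  interpret C: sigma_finite_measure ?C
    by (rule sigma_finite_measure_count_space_countable[OF countable_index_tuples])
  interpret CP: pair_sigma_finite ?C P ..
  have ind: "(\<lambda>(i, \<omega>). indicator (used m i) \<omega> :: ennreal) \<in> borel_measurable (?C \<Otimes>\<^sub>M P)"
    by (rule measurable_pair_measure_countable1[OF countable_index_tuples]) simp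
  have tup: "(\<lambda>(i, \<omega>). tuple m i \<omega>) \<in> ?C \<Otimes>\<^sub>M P \<rightarrow>\<^sub>M tuple_borel m"
    by (rule measurable_pair_measure_countable1[OF countable_index_tuples]) simp
  have tup': "(\<lambda>(i, \<omega>). tuple m i \<omega>) \<in>
      density (?C \<Otimes>\<^sub>M P) (\<lambda>(i, \<omega>). indicator (used m i) \<omega>) \<rightarrow>\<^sub>M tuple_borel m"
    using tup by simp
  have ft: "(\<lambda>(i, \<omega>). f (tuple m i \<omega>)) \<in> borel_measurable (?C \<Otimes>\<^sub>M P)"
    using measurable_compose[OF tup f] by (simp add: case_prod_unfold)
  have all: "(\<lambda>(i, \<omega>). indicator (used m i) \<omega> * f (tuple m i \<omega>)) \<in> borel_measurable (?C \<Otimes>\<^sub>M P)"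
    using borel_measurable_times_ennreal[OF ind ft] by (simp add: case_prod_unfold)
  have "(\<integral>\<^sup>+x. f x \<partial>moment_measure m) =
      (\<integral>\<^sup>+z. (case z of (i, \<omega>) \<Rightarrow> indicator (used m i) \<omega> * f (tuple m i \<omega>)) \<partial>(?C \<Otimes>\<^sub>M P))"
    unfolding moment_measure_def
    by (subst nn_integral_distr[OF tup'], simp, subst nn_integral_density[OF ind])
      (use ft in \<open>auto simp: case_prod_unfold\<close>)
  also have "\<dots> = (\<integral>\<^sup>+\<omega>. (\<integral>\<^sup>+i. indicator (used m i) \<omega> * f (tuple m i \<omega>) \<partial>?C) \<partial>P)"
    by (subst CP.nn_integral_snd[symmetric]) (use all in \<open>auto simp: case_prod_unfold\<close>)
  also have "\<dots> = (\<integral>\<^sup>+\<omega>. (\<integral>\<^sup>+x. f x \<partial>count_space ({..<m} \<rightarrow>\<^sub>E \<Phi> \<omega>)) \<partial>P)"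
    by (intro nn_integral_cong nn_integral_tuples)
  finally show ?thesis .
qed

text \<open>The tuples of points in the box number as many as the product of the counts in its
  sides, and disjoint sides make these counts independent.\<close>

lemma moment_measure_box:
  assumes B: "\<And>k. k < m \<Longrightarrow> B k \<in> sets borel" "\<And>k. k < m \<Longrightarrow> bounded (B k)"
    "\<And>k. k < m \<Longrightarrow> B k \<subseteq> UNIV \<times> {0..}" "disjoint_family_on B {..<m}"
  shows "emeasure (moment_measure m) (PiE {..<m} B) = (\<Prod>k<m. emeasure \<mu> (B k))"
proof -
  have BP: "PiE {..<m} B \<in> sets (tuple_borel m)"
    using B(1) by (intro sets_PiM_I_finite) auto
  then have "emeasure (moment_measure m) (PiE {..<m} B) =
      (\<integral>\<^sup>+x. indicator (PiE {..<m} B) x \<partial>moment_measure m)"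
    by (simp add: sets_moment_measure)
  also have "\<dots> = (\<integral>\<^sup>+\<omega>. (\<integral>\<^sup>+x. indicator (PiE {..<m} B) x \<partial>count_space ({..<m} \<rightarrow>\<^sub>E \<Phi> \<omega>)) \<partial>P)"
    using BP by (intro nn_integral_moment_measure) simp
  also have "\<dots> = (\<integral>\<^sup>+\<omega>. (\<Prod>k<m. ennreal (real (card (\<Phi> \<omega> \<inter> B k)))) \<partial>P)"
  proof (intro nn_integral_cong)
    fix \<omega> assume \<omega>: "\<omega> \<in> space P"
    have eq: "PiE {..<m} B \<inter> ({..<m} \<rightarrow>\<^sub>E \<Phi> \<omega>) = PiE {..<m} (\<lambda>k. \<Phi> \<omega> \<inter> B k)"
      by (auto simp: PiE_def Pi_def)
    have "finite (PiE {..<m} (\<lambda>k. \<Phi> \<omega> \<inter> B k))"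
      using finite_points[OF \<omega> B(2)] by (intro finite_PiE) auto
    then have "(\<integral>\<^sup>+x. indicator (PiE {..<m} B) x \<partial>count_space ({..<m} \<rightarrow>\<^sub>E \<Phi> \<omega>)) =
        ennreal (real (card (PiE {..<m} (\<lambda>k. \<Phi> \<omega> \<inter> B k))))"
      by (subst nn_integral_indicator')
        (simp_all add: eq emeasure_count_space_finite ennreal_of_nat_eq_real_of_nat PiE_mono)
    also have "\<dots> = (\<Prod>k<m. ennreal (real (card (\<Phi> \<omega> \<inter> B k))))"
      by (simp add: card_PiE prod_ennreal)
    finally show "(\<integral>\<^sup>+x. indicator (PiE {..<m} B) x \<partial>count_space ({..<m} \<rightarrow>\<^sub>E \<Phi> \<omega>)) =
        (\<Prod>k<m. ennreal (real (card (\<Phi> \<omega> \<inter> B k))))" .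
  qed
  also have "\<dots> = (\<Prod>k<m. emeasure \<mu> (B k))"
    by (rule count_prod_mean[OF B])
  finally show ?thesis .
qed

sublocale mus: product_sigma_finite "\<lambda>_::nat. \<mu>"
  by standard

lemma sets_PiM_mu [measurable_cong]: "sets (PiM J (\<lambda>_. \<mu>)) = sets (PiM J (\<lambda>_. borel))"
  by (intro sets_PiM_cong refl sets_mu)

text \<open>The moment measure also charges tuples with repeated points, so the comparison with the
  product measure is made only where timers increase. There it is local: on each box of the
  countable cover, sub-boxes have disjoint sides and form a generating class closed under
  intersection.\<close>

lemma moment_measure_time_ordered:
  assumes D: "D \<in> sets (tuple_borel m)" "D \<subseteq> time_ordered m"
  shows "emeasure (moment_measure m) D = emeasure (tuple_intensity m) D"
proof -
  define \<U> where "\<U> = {PiE {..<m} (slot_box R r) | R r. length r = Suc m \<and> sorted r \<and> 0 \<le> r ! 0}"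
  let ?B = "tuple_borel m"
  have sb: "slot_box R r k \<in> sets borel" for R r k
    unfolding slot_box_def borel_prod[symmetric] by (intro pair_measureI) auto
  have Usets: "PiE {..<m} (slot_box R r) \<in> sets ?B" for R r
    using sb by (intro sets_PiM_I_finite) auto
  show ?thesis
  proof (rule emeasure_eq_on_countable_cover[where \<U>=\<U>])
    show "sets (moment_measure m) = sets (tuple_intensity m)"
      by (simp add: sets_moment_measure sets_PiM_mu)
    have "\<U> \<subseteq> (\<lambda>(R, r). PiE {..<m} (slot_box R r)) ` UNIV"
      by (auto simp: \<U>_def)
    then show "countable \<U>" by (rule countable_subset) simp
    show "\<U> \<subseteq> sets (moment_measure m)"
      using Usets by (auto simp: \<U>_def sets_moment_measure)
    show "D \<in> sets (moment_measure m)" using D by (simp add: sets_moment_measure)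
    show "D \<subseteq> \<Union>\<U>"
    proof
      fix x assume "x \<in> D"
      with D(2) have "x \<in> time_ordered m" by blast
      from time_ordered_cover[OF this] show "x \<in> \<Union>\<U>" unfolding \<U>_def by blast
    qed
    fix U D assume "U \<in> \<U>" and D: "D \<in> sets (moment_measure m)" "D \<subseteq> U"
    then obtain R r where U: "U = PiE {..<m} (slot_box R r)" and r: "length r = Suc m" "sorted r" "0 \<le> r ! 0"
      by (auto simp: \<U>_def)
    have Um: "U \<in> sets ?B" using Usets U by simp
    have disj: "disjoint_family_on (slot_box R r) {..<m}"
    proof -
      have "slot_box R r j \<inter> slot_box R r k = {}" if "j < k" "k < m" for j k
      proof -
        have "r ! Suc j \<le> r ! k" using that r by (intro sorted_nth_mono) auto
        then have "(of_rat (r ! Suc j) :: real) \<le> of_rat (r ! k)" by (simp add: of_rat_less_eq)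
        then show ?thesis by (auto simp: slot_box_def)
      qed
      then show ?thesis unfolding disjoint_family_on_def
        by (metis Int_commute lessThan_iff linorder_neqE_nat)
    qed
    have nonneg: "slot_box R r k \<subseteq> UNIV \<times> {0..}" if "k < m" for k
    proof -
      have "r ! 0 \<le> r ! k" using that r by (intro sorted_nth_mono) auto
      then have "0 \<le> r ! k" using r(3) by linarith
      then have "0 \<le> (of_rat (r ! k) :: real)" by simp
      then show ?thesis
        by (auto simp: slot_box_def simp del: zero_le_of_rat_iff intro: order_trans)
    qed
    have bdd: "bounded (slot_box R r k)" for k
      unfolding slot_box_def by (intro bounded_Times bounded_cball)
        (rule bounded_subset[of "cbox (of_rat (r ! k)) (of_rat (r ! Suc k))"], auto)
    have box: "emeasure (moment_measure m) (PiE {..<m} A \<inter> U) = emeasure (tuple_intensity m) (PiE {..<m} A \<inter> U)"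
      if A: "\<And>k. k \<in> {..<m} \<Longrightarrow> A k \<in> sets borel" for A
    proof -
      have AU: "PiE {..<m} A \<inter> U = PiE {..<m} (\<lambda>k. A k \<inter> slot_box R r k)"
        unfolding U by (auto simp: PiE_def Pi_def)
      have "emeasure (moment_measure m) (PiE {..<m} A \<inter> U) = (\<Prod>k<m. emeasure \<mu> (A k \<inter> slot_box R r k))"
        unfolding AU
      proof (rule moment_measure_box)
        fix k assume k: "k < m"
        show "A k \<inter> slot_box R r k \<in> sets borel" using A[of k] sb k by auto
        show "bounded (A k \<inter> slot_box R r k)" using bdd by (rule bounded_subset) auto
        show "A k \<inter> slot_box R r k \<subseteq> UNIV \<times> {0..}" using nonneg[OF k] by blast
      qed (use disj in \<open>auto simp: disjoint_family_on_def\<close>)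
      also have "\<dots> = emeasure (tuple_intensity m) (PiE {..<m} A \<inter> U)"
        unfolding AU using A sb by (subst mus.emeasure_PiM) (auto simp: sets_mu)
      finally show ?thesis .
    qed
    \<comment> \<open>Restriction to \<open>U\<close> by a density makes both measures finite on the
      whole space, as the uniqueness theorem for product spaces requires.\<close>
    let ?M = "density (moment_measure m) (indicator U)" and ?N = "density (tuple_intensity m) (indicator U)"
    have dens: "emeasure ?M A = emeasure (moment_measure m) (A \<inter> U)"
        "emeasure ?N A = emeasure (tuple_intensity m) (A \<inter> U)" if "A \<in> sets ?B" for A
      using that Um
      by (subst emeasure_density; simp add: sets_moment_measure sets_PiM_mu indicator_inter_arith[symmetric] Int_commute
          measurable_cong_sets[OF sets_moment_measure refl] measurable_cong_sets[OF sets_PiM_mu refl])+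
    have "?M = ?N"
    proof (rule measure_eqI_PiM_finite[of "{..<m}" _ "\<lambda>_. borel" _ "\<lambda>_. space ?B"])
      show "sets ?M = sets ?B" "sets ?N = sets ?B"
        by (simp_all add: sets_moment_measure sets_PiM_mu)
      fix A :: "nat \<Rightarrow> point set" assume A: "\<And>i. i \<in> {..<m} \<Longrightarrow> A i \<in> sets borel"
      then have "PiE {..<m} A \<in> sets ?B" by (intro sets_PiM_I_finite) auto
      with box[OF A] dens[of "PiE {..<m} A"] show "emeasure ?M (PiE {..<m} A) = emeasure ?N (PiE {..<m} A)" by simp
    next
      show "range (\<lambda>_::nat. space ?B) \<subseteq> prod_algebra {..<m} (\<lambda>_. borel)"
        unfolding space_PiM by (auto intro!: prod_algebraI_finite)
      have "emeasure ?M (space ?B) = emeasure (moment_measure m) U"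
        using dens(1)[of "space ?B"] sets.sets_into_space[OF Um] by (simp add: Int_absorb1)
      also have "\<dots> = (\<Prod>k<m. emeasure \<mu> (slot_box R r k))"
        unfolding U by (intro moment_measure_box sb bdd nonneg disj)
      also have "\<dots> < \<infinity>"
        using emeasure_product_intensity_bounded[OF lf bdd] by (simp add: ennreal_prod_eq_top less_top[symmetric])
      finally show "emeasure ?M (space ?B) \<noteq> \<infinity>" by simp
    qed auto
    then show "emeasure (moment_measure m) D = emeasure (tuple_intensity m) D"
      using dens[of D] D by (simp add: sets_moment_measure Int_absorb2)
  qed
qed

text \<open>No factorial occurs, since a set of points with distinct timers is listed only once, in
  the order of its timers.\<close>

lemma ordered_campbell:
  assumes f[measurable]: "f \<in> borel_measurable (tuple_borel m)"
  shows "(\<integral>\<^sup>+\<omega>. (\<integral>\<^sup>+x. f x \<partial>count_space (ordered_tuples m (\<Phi> \<omega>))) \<partial>P) =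
    (\<integral>\<^sup>+x. f x * indicator (time_ordered m) x \<partial>tuple_intensity m)"
proof -
  let ?O = "time_ordered m"
  have eq: "density (moment_measure m) (indicator ?O) = density (tuple_intensity m) (indicator ?O)"
  proof (rule measure_eqI)
    show "sets (density (moment_measure m) (indicator ?O)) = sets (density (tuple_intensity m) (indicator ?O))"
      by (simp add: sets_moment_measure sets_PiM_mu)
    fix A assume "A \<in> sets (density (moment_measure m) (indicator ?O))"
    then have A: "A \<in> sets (tuple_borel m)" by (simp add: sets_moment_measure)
    then have "emeasure (density (moment_measure m) (indicator ?O)) A = emeasure (moment_measure m) (A \<inter> ?O)"
      by (subst emeasure_density; simp add: sets_moment_measure indicator_inter_arith[symmetric] Int_commute
          measurable_cong_sets[OF sets_moment_measure refl])
    also have "\<dots> = emeasure (tuple_intensity m) (A \<inter> ?O)"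
      using A by (intro moment_measure_time_ordered) auto
    also have "\<dots> = emeasure (density (tuple_intensity m) (indicator ?O)) A"
      using A by (subst emeasure_density; simp add: sets_PiM_mu indicator_inter_arith[symmetric] Int_commute
          measurable_cong_sets[OF sets_PiM_mu refl])
    finally show "emeasure (density (moment_measure m) (indicator ?O)) A =
      emeasure (density (tuple_intensity m) (indicator ?O)) A" .
  qed
  have "(\<integral>\<^sup>+\<omega>. (\<integral>\<^sup>+x. f x \<partial>count_space (ordered_tuples m (\<Phi> \<omega>))) \<partial>P) =
      (\<integral>\<^sup>+\<omega>. (\<integral>\<^sup>+x. f x * indicator ?O x \<partial>count_space ({..<m} \<rightarrow>\<^sub>E \<Phi> \<omega>)) \<partial>P)"
    by (intro nn_integral_cong nn_integral_ordered_tuples[symmetric])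
  also have "\<dots> = (\<integral>\<^sup>+x. f x * indicator ?O x \<partial>moment_measure m)"
    by (rule nn_integral_moment_measure[symmetric]) simp
  also have "\<dots> = (\<integral>\<^sup>+x. f x \<partial>density (moment_measure m) (indicator ?O))"
    by (subst nn_integral_density)
      (auto simp: mult.commute measurable_cong_sets[OF sets_moment_measure refl])
  also have "\<dots> = (\<integral>\<^sup>+x. f x * indicator ?O x \<partial>tuple_intensity m)"
    unfolding eq by (subst nn_integral_density)
      (auto simp: mult.commute measurable_cong_sets[OF sets_PiM_mu refl])
  finally show ?thesis .
qed

end

section \<open>Contention variables as marks\<close>

text \<open>In a tuple ordered by timer, \<open>marks c m x k\<close> is the set of the indices of the later points that
  contend with \<open>x k\<close>: every unordered pair of points is recorded once, at its earlier point.\<close>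

definition marks :: "(point \<Rightarrow> point \<Rightarrow> bool) \<Rightarrow> nat \<Rightarrow> (nat \<Rightarrow> point) \<Rightarrow> nat \<Rightarrow> nat set" where
  "marks c m x = (\<lambda>k\<in>{..<m}. {j \<in> {k<..<m}. c (x j) (x k)})"

definition mark_space :: "nat \<Rightarrow> (nat \<Rightarrow> nat set) set" where
  "mark_space m = (\<Pi>\<^sub>E k\<in>{..<m}. Pow {k<..<m})"

text \<open>The conditional probability of the pattern \<open>E\<close> given the points: one
  independent trial for each pair of places k < j.\<close>

definition mark_prob ::
    "(real^2 \<Rightarrow> real^2 \<Rightarrow> real) \<Rightarrow> nat \<Rightarrow> (nat \<Rightarrow> point) \<Rightarrow> (nat \<Rightarrow> nat set) \<Rightarrow> real" where
  "mark_prob h m x E = (\<Prod>k<m. \<Prod>j\<in>{k<..<m}.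
     if j \<in> E k then h (fst (x j)) (fst (x k)) else 1 - h (fst (x j)) (fst (x k)))"

lemma marks_in_space: "marks c m x \<in> mark_space m"
  by (auto simp: marks_def mark_space_def)

lemma finite_mark_space: "finite (mark_space m)"
  unfolding mark_space_def by (intro finite_PiE) auto

lemma marks_eq_iff:
  assumes "E \<in> mark_space m"
  shows "marks c m x = E \<longleftrightarrow> (\<forall>k<m. \<forall>j\<in>{k<..<m}. c (x j) (x k) \<longleftrightarrow> j \<in> E k)"
proof
  assume *: "\<forall>k<m. \<forall>j\<in>{k<..<m}. c (x j) (x k) \<longleftrightarrow> j \<in> E k"
  show "marks c m x = E"
  proof (rule PiE_ext)
    show "marks c m x \<in> (\<Pi>\<^sub>E k\<in>{..<m}. Pow {k<..<m})" "E \<in> (\<Pi>\<^sub>E k\<in>{..<m}. Pow {k<..<m})"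
      using assms marks_in_space by (auto simp: mark_space_def)
    fix k assume k: "k \<in> {..<m}"
    then have "E k \<subseteq> {k<..<m}" using assms by (auto simp: mark_space_def)
    with * k show "marks c m x k = E k" by (auto simp: marks_def)
  qed
qed (auto simp: marks_def)

lemma mark_prob_nonneg:
  assumes "\<And>x y. h x y \<in> {0..1}"
  shows "0 \<le> mark_prob h m x E"
  using assms unfolding mark_prob_def by (intro prod_nonneg ballI) auto

lemma mark_prob_le_1:
  assumes "\<And>x y. h x y \<in> {0..1}"
  shows "mark_prob h m x E \<le> 1"
  using assms unfolding mark_prob_def by (intro prod_le_1 conjI prod_nonneg) auto

lemma measurable_component_fst:
  "k < m \<Longrightarrow> (\<lambda>x. fst (x k)) \<in> tuple_borel m \<rightarrow>\<^sub>M borel"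
  by (intro measurable_compose[OF measurable_component_singleton[of k] borel_measurable_continuous_onI])
    (auto intro: continuous_intros)

lemma measurable_component_snd:
  "k < m \<Longrightarrow> (\<lambda>x. snd (x k)) \<in> tuple_borel m \<rightarrow>\<^sub>M borel"
  by (intro measurable_compose[OF measurable_component_singleton[of k] borel_measurable_continuous_onI])
    (auto intro: continuous_intros)

lemma measurable_kernel_pair:
  assumes h: "case_prod h \<in> borel_measurable borel"
    and "f \<in> M \<rightarrow>\<^sub>M borel" "g \<in> M \<rightarrow>\<^sub>M borel"
  shows "(\<lambda>x. h (f x :: real^2) (g x :: real^2) :: real) \<in> borel_measurable M"
proof -
  have "(\<lambda>x. (f x, g x)) \<in> M \<rightarrow>\<^sub>M borel"
    using measurable_Pair[OF assms(2,3)] by (simp add: borel_prod)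
  from measurable_compose[OF this h] show ?thesis by simp
qed

lemma mark_prob_measurable:
  assumes h: "case_prod h \<in> borel_measurable borel"
  shows "(\<lambda>x. mark_prob h m x E) \<in> borel_measurable (tuple_borel m)"
proof -
  have hm: "(\<lambda>x. h (fst (x j)) (fst (x k))) \<in> borel_measurable (tuple_borel m)"
    if "k < m" "j \<in> {k<..<m}" for j k
    using that by (intro measurable_kernel_pair[OF h]) (auto intro: measurable_component_fst)
  show ?thesis
    unfolding mark_prob_def
  proof (intro borel_measurable_prod)
    fix k j assume "k \<in> {..<m}" "j \<in> {k<..<m}"
    then show "(\<lambda>x. if j \<in> E k then h (fst (x j)) (fst (x k)) else 1 - h (fst (x j)) (fst (x k)))
        \<in> borel_measurable (tuple_borel m)"
      using hm[of k j] by (cases "j \<in> E k") simp_all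
  qed
qed

section \<open>Conditional law of the marks given the points\<close>

locale marked_points = enumerated_points P L \<Phi> I \<xi>
  for P :: "'w measure" and L :: "(real^2) measure" and \<Phi> :: "'w \<Rightarrow> point set"
    and I :: "'w \<Rightarrow> nat set" and \<xi> :: "nat \<Rightarrow> 'w \<Rightarrow> point" +
  fixes h :: "real^2 \<Rightarrow> real^2 \<Rightarrow> real" and C :: "'w \<Rightarrow> point \<Rightarrow> point \<Rightarrow> bool"
  assumes h_meas: "case_prod h \<in> borel_measurable borel"
    and h_range: "\<And>x y. h x y \<in> {0..1}"
    and h_sym: "\<And>x y. h x y = h y x"
    and C_sym: "\<And>\<omega> p q. \<omega> \<in> space P \<Longrightarrow> p \<in> \<Phi> \<omega> \<Longrightarrow> q \<in> \<Phi> \<omega> \<Longrightarrow> C \<omega> p q = C \<omega> q p"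
    and C_meas: "\<And>i j. i < j \<Longrightarrow> {\<omega> \<in> space P. i \<in> I \<omega> \<and> j \<in> I \<omega> \<and> C \<omega> (\<xi> i \<omega>) (\<xi> j \<omega>)} \<in> sets P"
    and C_cond: "\<And>F b. finite F \<Longrightarrow> F \<subseteq> {(i, j). i < j} \<Longrightarrow>
      (AE \<omega> in P. real_cond_exp P (enumeration_algebra P I \<xi>)
          (indicator {\<omega> \<in> space P. \<forall>(i, j)\<in>F. i \<in> I \<omega> \<and> j \<in> I \<omega> \<and>
                          (C \<omega> (\<xi> i \<omega>) (\<xi> j \<omega>) \<longleftrightarrow> b (i, j))}) \<omega>
        = indicator {\<omega> \<in> space P. \<forall>(i, j)\<in>F. i \<in> I \<omega> \<and> j \<in> I \<omega>} \<omega> *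
          (\<Prod>(i, j)\<in>F. if b (i, j) then h (fst (\<xi> i \<omega>)) (fst (\<xi> j \<omega>))
                         else 1 - h (fst (\<xi> i \<omega>)) (fst (\<xi> j \<omega>))))"
begin

lemma points_in: "\<omega> \<in> space P \<Longrightarrow> n \<in> I \<omega> \<Longrightarrow> \<xi> n \<omega> \<in> \<Phi> \<omega>"
  using bij_enum by (auto simp: bij_betw_def)

lemma contention_event:
  assumes "i \<noteq> j"
  shows "{\<omega> \<in> space P. i \<in> I \<omega> \<and> j \<in> I \<omega> \<and> C \<omega> (\<xi> i \<omega>) (\<xi> j \<omega>)} \<in> sets P"
proof (cases "i < j")
  case True
  then show ?thesis by (rule C_meas)
next
  case False
  have "{\<omega> \<in> space P. i \<in> I \<omega> \<and> j \<in> I \<omega> \<and> C \<omega> (\<xi> i \<omega>) (\<xi> j \<omega>)} =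
    {\<omega> \<in> space P. j \<in> I \<omega> \<and> i \<in> I \<omega> \<and> C \<omega> (\<xi> j \<omega>) (\<xi> i \<omega>)}"
    using C_sym points_in by blast
  also have "\<dots> \<in> sets P" using False assms by (intro C_meas) auto
  finally show ?thesis .
qed

lemma tuple_used: "\<omega> \<in> used m i \<Longrightarrow> k < m \<Longrightarrow> tuple m i \<omega> k = \<xi> (i k) \<omega>"
  by (auto simp: tuple_def X_def used_def)

text \<open>Injectivity of \<open>i\<close> guarantees that only contention variables of two
  different indices are consulted, which are the ones known to be measurable.\<close>

lemma mark_event:
  assumes i: "inj_on i {..<m}" and E: "E \<in> mark_space m"
  shows "{\<omega> \<in> used m i. marks (C \<omega>) m (tuple m i \<omega>) = E} \<in> sets P"
proof -
  let ?D = "\<lambda>k j. {\<omega> \<in> space P. i j \<in> I \<omega> \<and> i k \<in> I \<omega> \<and> C \<omega> (\<xi> (i j) \<omega>) (\<xi> (i k) \<omega>)}"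
  have D: "?D k j \<in> sets P" if "k < m" "j \<in> {k<..<m}" for k j
    using i that by (intro contention_event) (auto dest!: inj_onD[of i _ j k])
  have "{\<omega> \<in> used m i. marks (C \<omega>) m (tuple m i \<omega>) = E} =
    used m i \<inter> {\<omega> \<in> space P. \<forall>k\<in>{..<m}. \<forall>j\<in>{k<..<m}. \<omega> \<in> ?D k j \<longleftrightarrow> j \<in> E k}"
    by (auto simp: marks_eq_iff[OF E] tuple_used used_def)
  also have "\<dots> \<in> sets P"
  proof (intro sets.Int used_P sets.sets_Collect_finite_All finite_lessThan finite_greaterThanLessThan)
    fix k j assume kj: "k \<in> {..<m}" "j \<in> {k<..<m}"
    have "{\<omega> \<in> space P. \<omega> \<in> ?D k j \<longleftrightarrow> j \<in> E k} = (if j \<in> E k then ?D k j else space P - ?D k j)"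
      by auto
    then show "{\<omega> \<in> space P. \<omega> \<in> ?D k j \<longleftrightarrow> j \<in> E k} \<in> sets P"
      using D[of k j] kj by auto
  qed
  finally show ?thesis .
qed

sublocale cond: sigma_finite_subalgebra P "enumeration_algebra P I \<xi>"
proof -
  interpret finite_measure_subalgebra P G by standard (rule subalg_G)
  show "sigma_finite_subalgebra P G" by unfold_locales
qed

text \<open>The defining property of conditional expectation, applied to the factor f times the
  indicator of \<open>used m i\<close>, which is measurable with respect to the points. The work
  lies in matching a pattern on the places of the tuple with a prescription on pairs of
  indices.\<close>

lemma mark_event_integral:
  assumes i: "inj_on i {..<m}" and E: "E \<in> mark_space m"
    and f: "f \<in> borel_measurable G" "\<And>\<omega>. \<bar>f \<omega>\<bar> \<le> (1::real)"
  shows "(\<integral>\<omega>. f \<omega> * indicator {\<omega> \<in> used m i. marks (C \<omega>) m (tuple m i \<omega>) = E} \<omega> \<partial>P) =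
    (\<integral>\<omega>. f \<omega> * (indicator (used m i) \<omega> * mark_prob h m (tuple m i \<omega>) E) \<partial>P)"
proof -
  define S where "S = Sigma {..<m} (\<lambda>k. {k<..<m})"
  \<comment> \<open>\<open>C_cond\<close> speaks of pairs ordered by index, whereas places are
    ordered by timer. The two orders are unrelated, hence \<open>min\<close> and \<open>max\<close>;
    symmetry of \<open>C\<close> and \<open>h\<close> makes the swap harmless.\<close>
  define e where "e = (\<lambda>(k, j). (min (i j) (i k), max (i j) (i k)))"
  define F where "F = e ` S"
  \<comment> \<open>The pattern \<open>E\<close> transported to pairs of indices. It is unambiguous
    because \<open>e\<close> is injective on \<open>S\<close>: \<open>i\<close> is injective, and k
    < j determines the order within a pair of places.\<close>
  define b where "b = (\<lambda>p. \<exists>(k, j)\<in>S. p = e (k, j) \<and> j \<in> E k)"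
  have neq: "i j \<noteq> i k" if "(k, j) \<in> S" for k j
    using that i by (auto simp: S_def dest!: inj_onD[of i _ j k])
  have inj_e: "inj_on e S"
  proof (rule inj_onI)
    fix p q assume pq: "p \<in> S" "q \<in> S" "e p = e q"
    obtain k j k' j' where [simp]: "p = (k, j)" "q = (k', j')" by fastforce
    have "{i j, i k} = {i j', i k'}"
      using pq by (auto simp: e_def min_def max_def split: if_splits)
    then have "i ` {j, k} = i ` {j', k'}" by simp
    then have "{j, k} = {j', k'}"
      using pq i by (subst (asm) inj_on_image_eq_iff[OF i]) (auto simp: S_def)
    then show "p = q" using pq by (auto simp: S_def doubleton_eq_iff)
  qed
  have b: "b (e (k, j)) \<longleftrightarrow> j \<in> E k" if "(k, j) \<in> S" for k j
    using that inj_e unfolding b_def by (auto dest: inj_onD)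
  have Ffin: "finite F" unfolding F_def S_def by auto
  have Fsub: "F \<subseteq> {(i, j). i < j}"
    unfolding F_def by (auto simp: e_def min_def max_def) (use neq in force)+
  let ?A = "{\<omega> \<in> space P. \<forall>(a, c)\<in>F. a \<in> I \<omega> \<and> c \<in> I \<omega> \<and> (C \<omega> (\<xi> a \<omega>) (\<xi> c \<omega>) \<longleftrightarrow> b (a, c))}"
  let ?U = "{\<omega> \<in> space P. \<forall>(a, c)\<in>F. a \<in> I \<omega> \<and> c \<in> I \<omega>}"
  let ?q = "\<lambda>\<omega>. (\<Prod>(a, c)\<in>F. if b (a, c) then h (fst (\<xi> a \<omega>)) (fst (\<xi> c \<omega>)) else 1 - h (fst (\<xi> a \<omega>)) (fst (\<xi> c \<omega>)))"
  let ?M = "{\<omega> \<in> used m i. marks (C \<omega>) m (tuple m i \<omega>) = E}"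
  have Csw: "C \<omega> (\<xi> (min (i j) (i k)) \<omega>) (\<xi> (max (i j) (i k)) \<omega>) = C \<omega> (\<xi> (i j) \<omega>) (\<xi> (i k) \<omega>)"
    if "\<omega> \<in> used m i" "(k, j) \<in> S" for \<omega> k j
    using that C_sym[of \<omega>] points_in[of \<omega>] by (auto simp: min_def max_def used_def S_def)
  have hsw: "h (fst (\<xi> (min (i j) (i k)) \<omega>)) (fst (\<xi> (max (i j) (i k)) \<omega>)) = h (fst (\<xi> (i j) \<omega>)) (fst (\<xi> (i k) \<omega>))" for \<omega> k j
    using h_sym by (auto simp: min_def max_def)
  have idx: "min (i j) (i k) \<in> I \<omega> \<and> max (i j) (i k) \<in> I \<omega>" if "\<omega> \<in> used m i" "(k, j) \<in> S" for \<omega> k j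
    using that by (auto simp: used_def S_def min_def max_def)
  have FS: "(\<forall>p\<in>F. Q p) \<longleftrightarrow> (\<forall>(k, j)\<in>S. Q (e (k, j)))" for Q
    unfolding F_def by auto
  have M_iff: "\<omega> \<in> ?A \<longleftrightarrow> \<omega> \<in> ?M" if \<omega>: "\<omega> \<in> used m i" for \<omega>
  proof -
    have "\<omega> \<in> space P" using \<omega> by (simp add: used_def)
    then have "\<omega> \<in> ?A \<longleftrightarrow> (\<forall>(k, j)\<in>S. C \<omega> (\<xi> (i j) \<omega>) (\<xi> (i k) \<omega>) \<longleftrightarrow> j \<in> E k)"
      using b Csw[OF \<omega>] idx[OF \<omega>] by (simp add: FS) (auto simp: e_def)
    also have "\<dots> \<longleftrightarrow> \<omega> \<in> ?M"
      using \<omega> by (auto simp: marks_eq_iff[OF E] tuple_used S_def)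
    finally show ?thesis .
  qed
  have U: "\<omega> \<in> ?U" if \<omega>: "\<omega> \<in> used m i" for \<omega>
  proof -
    have "\<omega> \<in> space P" using \<omega> by (simp add: used_def)
    then show ?thesis using idx[OF \<omega>] by (simp add: FS) (auto simp: e_def)
  qed
  have q: "?q \<omega> = mark_prob h m (tuple m i \<omega>) E" if \<omega>: "\<omega> \<in> used m i" for \<omega>
  proof -
    have "?q \<omega> = (\<Prod>(k, j)\<in>S. if j \<in> E k then h (fst (\<xi> (i j) \<omega>)) (fst (\<xi> (i k) \<omega>))
        else 1 - h (fst (\<xi> (i j) \<omega>)) (fst (\<xi> (i k) \<omega>)))"
      unfolding F_def using inj_e b hsw by (subst prod.reindex) (auto simp: e_def intro!: prod.cong)
    also have "\<dots> = mark_prob h m (tuple m i \<omega>) E"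
      unfolding mark_prob_def S_def
      by (subst prod.Sigma[symmetric]) (use \<omega> in \<open>auto simp: tuple_used intro!: prod.cong\<close>)
    finally show ?thesis .
  qed
  let ?f = "\<lambda>\<omega>. f \<omega> * indicator (used m i) \<omega>"
  have fG: "?f \<in> borel_measurable G"
    using f(1) used_G by (intro borel_measurable_times borel_measurable_indicator)
  have fP: "f \<in> borel_measurable P" by (rule measurable_from_subalg[OF subalg_G f(1)])
  have AP: "?A \<in> sets P"
  proof -
    have "?A = {\<omega> \<in> space P. \<forall>(a, c)\<in>F. \<omega> \<in> {\<omega> \<in> space P. a \<in> I \<omega>} \<and> \<omega> \<in> {\<omega> \<in> space P. c \<in> I \<omega>} \<and>
        (\<omega> \<in> {\<omega> \<in> space P. a \<in> I \<omega> \<and> c \<in> I \<omega> \<and> C \<omega> (\<xi> a \<omega>) (\<xi> c \<omega>)} \<longleftrightarrow> b (a, c))}"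
      by (rule Collect_cong) auto
    also have "\<dots> \<in> sets P"
      unfolding case_prod_unfold
    proof (intro sets.sets_Collect_finite_All Ffin sets.sets_Collect_conj)
      fix p assume "p \<in> F"
      then have lt: "fst p < snd p" using Fsub by auto
      let ?Z = "{\<omega> \<in> space P. fst p \<in> I \<omega> \<and> snd p \<in> I \<omega> \<and> C \<omega> (\<xi> (fst p) \<omega>) (\<xi> (snd p) \<omega>)}"
      show "{\<omega> \<in> space P. \<omega> \<in> {\<omega> \<in> space P. fst p \<in> I \<omega>}} \<in> sets P"
        "{\<omega> \<in> space P. \<omega> \<in> {\<omega> \<in> space P. snd p \<in> I \<omega>}} \<in> sets P"
        using sets_G_P[OF sets_G_index] by simp_all
      have "{\<omega> \<in> space P. \<omega> \<in> ?Z \<longleftrightarrow> b (fst p, snd p)} = (if b (fst p, snd p) then ?Z else space P - ?Z)"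
        by auto
      then show "{\<omega> \<in> space P. \<omega> \<in> ?Z \<longleftrightarrow> b (fst p, snd p)} \<in> sets P"
        using C_meas[OF lt] by auto
    qed
    finally show ?thesis .
  qed
  have int: "integrable P (\<lambda>\<omega>. ?f \<omega> * indicator ?A \<omega>)"
    by (rule integrable_const_bound[where B=1])
      (use f(2) AP fP in \<open>auto intro!: AE_I2 split: split_indicator simp: abs_mult\<close>)
  have "(\<integral>\<omega>. f \<omega> * indicator ?M \<omega> \<partial>P) = (\<integral>\<omega>. ?f \<omega> * indicator ?A \<omega> \<partial>P)"
    using M_iff by (intro Bochner_Integration.integral_cong refl) (auto split: split_indicator)
  also have "\<dots> = (\<integral>\<omega>. ?f \<omega> * real_cond_exp P G (indicator ?A) \<omega> \<partial>P)"
    using AP by (intro cond.real_cond_exp_intg(2)[symmetric] int fG) auto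
  also have "\<dots> = (\<integral>\<omega>. f \<omega> * (indicator (used m i) \<omega> * mark_prob h m (tuple m i \<omega>) E) \<partial>P)"
  proof (rule integral_cong_AE)
    show "(\<lambda>\<omega>. ?f \<omega> * real_cond_exp P G (indicator ?A) \<omega>) \<in> borel_measurable P"
      using fP by simp
    show "(\<lambda>\<omega>. f \<omega> * (indicator (used m i) \<omega> * mark_prob h m (tuple m i \<omega>) E)) \<in> borel_measurable P"
      using fP measurable_compose[OF tuple_measurable_P mark_prob_measurable[OF h_meas]] by simp
    show "AE \<omega> in P. ?f \<omega> * real_cond_exp P G (indicator ?A) \<omega> =
        f \<omega> * (indicator (used m i) \<omega> * mark_prob h m (tuple m i \<omega>) E)"
      using C_cond[OF Ffin Fsub, of b]
    proof eventually_elim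
      case (elim \<omega>)
      show ?case
        unfolding elim using U[of \<omega>] q[of \<omega>] by (auto split: split_indicator)
    qed
  qed
  finally show ?thesis .
qed

text \<open>A repeated index would repeat a timer. Index tuples with repetitions thus contribute
  nothing, and the variable of a point with itself never matters.\<close>

lemma ordered_tuple_inj:
  assumes "tuple m i \<omega> \<in> time_ordered m"
  shows "inj_on i {..<m}"
proof (rule linorder_inj_onI)
  fix j k assume jk: "j < k" "j \<in> {..<m}" "k \<in> {..<m}"
  show "i j \<noteq> i k"
  proof
    assume "i j = i k"
    then have "tuple m i \<omega> j = tuple m i \<omega> k" using jk by (simp add: tuple_def)
    moreover have "snd (tuple m i \<omega> j) < snd (tuple m i \<omega> k)"
      using assms jk by (simp add: time_ordered_def)
    ultimately show False by simp
  qed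
qed auto

text \<open>Only finitely many mark patterns exist, so a function of the marks is a finite sum over
  the events that fix the pattern. The functions \<Psi> need to be measurable for each pattern
  separately.\<close>

lemma tuple_marks_measurable:
  fixes \<Psi> :: "(nat \<Rightarrow> point) \<Rightarrow> (nat \<Rightarrow> nat set) \<Rightarrow> real"
  assumes \<Psi>: "\<And>E. E \<in> mark_space m \<Longrightarrow> (\<lambda>x. \<Psi> x E) \<in> borel_measurable (tuple_borel m)"
  shows "(\<lambda>\<omega>. indicator (used m i) \<omega> * (ennreal (\<Psi> (tuple m i \<omega>) (marks (C \<omega>) m (tuple m i \<omega>))) *
      indicator (time_ordered m) (tuple m i \<omega>))) \<in> borel_measurable P"
    and "indicator (used m i) \<omega> * (ennreal (\<Psi> (tuple m i \<omega>) (marks (C \<omega>) m (tuple m i \<omega>))) *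
      indicator (time_ordered m) (tuple m i \<omega>)) = (\<Sum>E\<in>mark_space m. ennreal (\<Psi> (tuple m i \<omega>) E) *
        indicator {\<omega> \<in> used m i. marks (C \<omega>) m (tuple m i \<omega>) = E} \<omega> * indicator (time_ordered m) (tuple m i \<omega>))"
proof -
  let ?A = "\<lambda>E. {\<omega> \<in> used m i. marks (C \<omega>) m (tuple m i \<omega>) = E}"
  let ?f = "\<lambda>\<omega>. indicator (used m i) \<omega> * (ennreal (\<Psi> (tuple m i \<omega>) (marks (C \<omega>) m (tuple m i \<omega>))) *
      indicator (time_ordered m) (tuple m i \<omega>)) :: ennreal"
  have eq: "?f \<omega> = (\<Sum>E\<in>mark_space m. ennreal (\<Psi> (tuple m i \<omega>) E) * indicator (?A E) \<omega> *
      indicator (time_ordered m) (tuple m i \<omega>))" for \<omega>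
  proof -
    let ?E = "marks (C \<omega>) m (tuple m i \<omega>)"
    have "(\<Sum>E\<in>mark_space m. ennreal (\<Psi> (tuple m i \<omega>) E) * indicator (?A E) \<omega> *
        indicator (time_ordered m) (tuple m i \<omega>)) =
      (\<Sum>E\<in>{?E}. ennreal (\<Psi> (tuple m i \<omega>) E) * indicator (?A E) \<omega> *
        indicator (time_ordered m) (tuple m i \<omega>))"
      using marks_in_space finite_mark_space by (intro sum.mono_neutral_right) auto
    also have "\<dots> = ?f \<omega>"
    proof -
      have "sum f {E} = f E" for f :: "(nat \<Rightarrow> nat set) \<Rightarrow> ennreal" and E by simp
      then show ?thesis by (simp only:) (cases "\<omega> \<in> used m i"; simp)
    qed
    finally show ?thesis by (rule sym)
  qed
  then show "?f \<omega> = (\<Sum>E\<in>mark_space m. ennreal (\<Psi> (tuple m i \<omega>) E) *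
        indicator (?A E) \<omega> * indicator (time_ordered m) (tuple m i \<omega>))" .
  show "?f \<in> borel_measurable P"
  proof (cases "inj_on i {..<m}")
    case True
    have "(\<lambda>\<omega>. ennreal (\<Psi> (tuple m i \<omega>) E) * indicator (?A E) \<omega> *
      indicator (time_ordered m) (tuple m i \<omega>)) \<in> borel_measurable P" if E: "E \<in> mark_space m" for E
    proof (intro borel_measurable_times_ennreal)
      show "(\<lambda>\<omega>. ennreal (\<Psi> (tuple m i \<omega>) E)) \<in> borel_measurable P"
        using measurable_compose[OF tuple_measurable_P \<Psi>[OF E]] by simp
      show "indicator (?A E) \<in> borel_measurable P"
        using mark_event[OF True E] by simp
      show "(\<lambda>\<omega>. indicator (time_ordered m) (tuple m i \<omega>) :: ennreal) \<in> borel_measurable P"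
        by (rule measurable_compose[OF tuple_measurable_P]) simp
    qed
    then have "(\<lambda>\<omega>. \<Sum>E\<in>mark_space m. ennreal (\<Psi> (tuple m i \<omega>) E) * indicator (?A E) \<omega> *
      indicator (time_ordered m) (tuple m i \<omega>)) \<in> borel_measurable P"
      by (rule borel_measurable_sum)
    moreover have "?f = (\<lambda>\<omega>. \<Sum>E\<in>mark_space m. ennreal (\<Psi> (tuple m i \<omega>) E) * indicator (?A E) \<omega> *
      indicator (time_ordered m) (tuple m i \<omega>))"
      by (rule ext) (rule eq)
    ultimately show ?thesis by (simp only:)
  next
    case False
    then have "tuple m i \<omega> \<notin> time_ordered m" for \<omega> using ordered_tuple_inj by blast
    then show ?thesis by simp
  qed
qed

text \<open>The decomposition over patterns again, now with \<open>mark_event_integral\<close> for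
  each of them. The bound on \<Psi> provides the integrability needed to pass between nonnegative
  and Bochner integrals.\<close>

lemma tuple_marks_integral:
  fixes \<Psi> :: "(nat \<Rightarrow> point) \<Rightarrow> (nat \<Rightarrow> nat set) \<Rightarrow> real"
  assumes \<Psi>: "\<And>E. E \<in> mark_space m \<Longrightarrow> (\<lambda>x. \<Psi> x E) \<in> borel_measurable (tuple_borel m)"
    and \<Psi>01: "\<And>x E. \<Psi> x E \<in> {0..1}"
  shows "(\<integral>\<^sup>+\<omega>. indicator (used m i) \<omega> * (ennreal (\<Psi> (tuple m i \<omega>) (marks (C \<omega>) m (tuple m i \<omega>))) *
      indicator (time_ordered m) (tuple m i \<omega>)) \<partial>P) =
    (\<integral>\<^sup>+\<omega>. indicator (used m i) \<omega> * (ennreal (\<Sum>E\<in>mark_space m. \<Psi> (tuple m i \<omega>) E * mark_prob h m (tuple m i \<omega>) E) *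
      indicator (time_ordered m) (tuple m i \<omega>)) \<partial>P)"
proof (cases "inj_on i {..<m}")
  case False
  then have "indicator (time_ordered m) (tuple m i \<omega>) = (0 :: ennreal)" for \<omega>
    using ordered_tuple_inj by (auto split: split_indicator)
  then show ?thesis by simp
next
  case True
  let ?A = "\<lambda>E. {\<omega> \<in> used m i. marks (C \<omega>) m (tuple m i \<omega>) = E}"
  let ?t = "tuple m i" and ?O = "time_ordered m"
  let ?f = "\<lambda>E \<omega>. \<Psi> (?t \<omega>) E * indicator ?O (?t \<omega>)"
  let ?g = "\<lambda>E \<omega>. indicator (used m i) \<omega> * mark_prob h m (?t \<omega>) E :: real"
  have fG: "?f E \<in> borel_measurable G" if "E \<in> mark_space m" for E
  proof (rule borel_measurable_times)
    show "(\<lambda>\<omega>. \<Psi> (?t \<omega>) E) \<in> borel_measurable G"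
      by (rule measurable_compose[OF tuple_measurable_G \<Psi>[OF that]])
    show "(\<lambda>\<omega>. indicator ?O (?t \<omega>) :: real) \<in> borel_measurable G"
      by (rule measurable_compose[OF tuple_measurable_G]) simp
  qed
  have f01: "0 \<le> ?f E \<omega>" "?f E \<omega> \<le> 1" for \<omega> E
    using \<Psi>01[of "?t \<omega>" E] by (auto split: split_indicator)
  have fP: "?f E \<in> borel_measurable P" if "E \<in> mark_space m" for E
    by (rule measurable_from_subalg[OF subalg_G fG[OF that]])
  have mp: "(\<lambda>\<omega>. mark_prob h m (?t \<omega>) E) \<in> borel_measurable P" for E
    by (rule measurable_compose[OF tuple_measurable_P mark_prob_measurable[OF h_meas]])
  have g01: "0 \<le> ?g E \<omega>" "?g E \<omega> \<le> 1" for \<omega> E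
    using mark_prob_nonneg[of h, OF h_range] mark_prob_le_1[of h, OF h_range] by (auto split: split_indicator)
  have single: "(\<integral>\<^sup>+\<omega>. ennreal (?f E \<omega> * indicator (?A E) \<omega>) \<partial>P) = (\<integral>\<^sup>+\<omega>. ennreal (?f E \<omega> * ?g E \<omega>) \<partial>P)"
    if E: "E \<in> mark_space m" for E
  proof -
    have int1: "integrable P (\<lambda>\<omega>. ?f E \<omega> * indicator (?A E) \<omega>)"
    proof (rule integrable_const_bound[where B=1])
      show "(\<lambda>\<omega>. ?f E \<omega> * indicator (?A E) \<omega>) \<in> borel_measurable P"
        by (rule borel_measurable_times[OF fP[OF E] borel_measurable_indicator[OF mark_event[OF True E]]])
      show "AE \<omega> in P. norm (?f E \<omega> * indicator (?A E) \<omega>) \<le> 1"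
      proof (rule AE_I2)
        fix \<omega>
        show "norm (?f E \<omega> * indicator (?A E) \<omega>) \<le> 1"
          using f01[of \<omega> E] by (cases "\<omega> \<in> ?A E") auto
      qed
    qed
    have int2: "integrable P (\<lambda>\<omega>. ?f E \<omega> * ?g E \<omega>)"
    proof (rule integrable_const_bound[where B=1])
      show "(\<lambda>\<omega>. ?f E \<omega> * ?g E \<omega>) \<in> borel_measurable P"
        by (rule borel_measurable_times[OF fP[OF E] borel_measurable_times[OF borel_measurable_indicator[OF used_P] mp]])
      have "\<bar>?f E \<omega> * ?g E \<omega>\<bar> \<le> 1 * 1" for \<omega>
      proof -
        have "\<bar>?f E \<omega>\<bar> \<le> 1" "\<bar>?g E \<omega>\<bar> \<le> 1"
          using f01[of \<omega> E] g01[of \<omega> E] by linarith+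
        then show ?thesis by (subst abs_mult) (intro mult_mono, auto)
      qed
      then show "AE \<omega> in P. norm (?f E \<omega> * ?g E \<omega>) \<le> 1" by simp
    qed
    have "(\<integral>\<^sup>+\<omega>. ennreal (?f E \<omega> * indicator (?A E) \<omega>) \<partial>P) = ennreal (\<integral>\<omega>. ?f E \<omega> * indicator (?A E) \<omega> \<partial>P)"
      by (intro nn_integral_eq_integral int1 AE_I2 mult_nonneg_nonneg f01) simp
    also have "\<dots> = ennreal (\<integral>\<omega>. ?f E \<omega> * ?g E \<omega> \<partial>P)"
    proof -
      have "\<bar>?f E \<omega>\<bar> \<le> 1" for \<omega> using f01[of \<omega> E] by linarith
      from mark_event_integral[OF True E fG[OF E] this] show ?thesis by simp
    qed
    also have "\<dots> = (\<integral>\<^sup>+\<omega>. ennreal (?f E \<omega> * ?g E \<omega>) \<partial>P)"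
      by (intro nn_integral_eq_integral[symmetric] int2 AE_I2 mult_nonneg_nonneg[OF f01(1) g01(1)])
    finally show ?thesis .
  qed
  have "(\<integral>\<^sup>+\<omega>. indicator (used m i) \<omega> * (ennreal (\<Psi> (?t \<omega>) (marks (C \<omega>) m (?t \<omega>))) *
      indicator ?O (?t \<omega>)) \<partial>P) = (\<integral>\<^sup>+\<omega>. (\<Sum>E\<in>mark_space m. ennreal (?f E \<omega> * indicator (?A E) \<omega>)) \<partial>P)"
  proof (intro nn_integral_cong)
    fix \<omega>
    have "indicator (used m i) \<omega> * (ennreal (\<Psi> (?t \<omega>) (marks (C \<omega>) m (?t \<omega>))) * indicator ?O (?t \<omega>)) =
      (\<Sum>E\<in>mark_space m. ennreal (\<Psi> (?t \<omega>) E) * indicator (?A E) \<omega> * indicator ?O (?t \<omega>))"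
      by (rule tuple_marks_measurable(2)[where \<Psi>=\<Psi>]) (rule \<Psi>)
    also have "\<dots> = (\<Sum>E\<in>mark_space m. ennreal (?f E \<omega> * indicator (?A E) \<omega>))"
      by (intro sum.cong refl) (auto split: split_indicator)
    finally show "indicator (used m i) \<omega> * (ennreal (\<Psi> (?t \<omega>) (marks (C \<omega>) m (?t \<omega>))) * indicator ?O (?t \<omega>)) =
      (\<Sum>E\<in>mark_space m. ennreal (?f E \<omega> * indicator (?A E) \<omega>))" .
  qed
  also have "\<dots> = (\<Sum>E\<in>mark_space m. \<integral>\<^sup>+\<omega>. ennreal (?f E \<omega> * indicator (?A E) \<omega>) \<partial>P)"
  proof (rule nn_integral_sum)
    fix E assume E: "E \<in> mark_space m"
    show "(\<lambda>\<omega>. ennreal (?f E \<omega> * indicator (?A E) \<omega>)) \<in> borel_measurable P"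
      using borel_measurable_times[OF fP[OF E] borel_measurable_indicator[OF mark_event[OF True E]]] by simp
  qed
  also have "\<dots> = (\<Sum>E\<in>mark_space m. \<integral>\<^sup>+\<omega>. ennreal (?f E \<omega> * ?g E \<omega>) \<partial>P)"
    by (intro sum.cong refl single)
  also have "\<dots> = (\<integral>\<^sup>+\<omega>. (\<Sum>E\<in>mark_space m. ennreal (?f E \<omega> * ?g E \<omega>)) \<partial>P)"
  proof (rule nn_integral_sum[symmetric])
    fix E assume E: "E \<in> mark_space m"
    show "(\<lambda>\<omega>. ennreal (?f E \<omega> * ?g E \<omega>)) \<in> borel_measurable P"
      using borel_measurable_times[OF fP[OF E] borel_measurable_times[OF borel_measurable_indicator[OF used_P] mp]] by simp
  qed
  also have "\<dots> = (\<integral>\<^sup>+\<omega>. indicator (used m i) \<omega> * (ennreal (\<Sum>E\<in>mark_space m. \<Psi> (?t \<omega>) E * mark_prob h m (?t \<omega>) E) *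
      indicator ?O (?t \<omega>)) \<partial>P)"
  proof (intro nn_integral_cong)
    fix \<omega>
    have "(\<Sum>E\<in>mark_space m. ennreal (?f E \<omega> * ?g E \<omega>)) = ennreal (\<Sum>E\<in>mark_space m. ?f E \<omega> * ?g E \<omega>)"
      by (intro sum_ennreal mult_nonneg_nonneg[OF f01(1) g01(1)])
    then show "(\<Sum>E\<in>mark_space m. ennreal (?f E \<omega> * ?g E \<omega>)) = indicator (used m i) \<omega> *
        (ennreal (\<Sum>E\<in>mark_space m. \<Psi> (?t \<omega>) E * mark_prob h m (?t \<omega>) E) * indicator ?O (?t \<omega>))"
      by (auto split: split_indicator)
  qed
  finally show ?thesis .
qed

text \<open>For each fixed index tuple the marks are averaged given the points; Tonelli over the
  countable index set then leaves a function of the points alone, to which the ordered Campbell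
  formula applies.\<close>

lemma marked_campbell:
  fixes \<Psi> :: "(nat \<Rightarrow> point) \<Rightarrow> (nat \<Rightarrow> nat set) \<Rightarrow> real"
  assumes \<Psi>: "\<And>E. E \<in> mark_space m \<Longrightarrow> (\<lambda>x. \<Psi> x E) \<in> borel_measurable (tuple_borel m)"
    and \<Psi>01: "\<And>x E. \<Psi> x E \<in> {0..1}"
  shows "(\<lambda>\<omega>. \<integral>\<^sup>+x. ennreal (\<Psi> x (marks (C \<omega>) m x)) \<partial>count_space (ordered_tuples m (\<Phi> \<omega>))) \<in> borel_measurable P"
    and "(\<integral>\<^sup>+\<omega>. (\<integral>\<^sup>+x. ennreal (\<Psi> x (marks (C \<omega>) m x)) \<partial>count_space (ordered_tuples m (\<Phi> \<omega>))) \<partial>P) =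
      (\<integral>\<^sup>+x. ennreal (\<Sum>E\<in>mark_space m. \<Psi> x E * mark_prob h m x E) * indicator (time_ordered m) x
         \<partial>tuple_intensity m)"
proof -
  let ?T = "count_space (index_tuples m)" and ?O = "time_ordered m"
  define u :: "(nat \<Rightarrow> nat) \<Rightarrow> 'w \<Rightarrow> ennreal" where "u = (\<lambda>i \<omega>. indicator (used m i) \<omega> * (ennreal (\<Psi> (tuple m i \<omega>) (marks (C \<omega>) m (tuple m i \<omega>))) *
      indicator ?O (tuple m i \<omega>)))"
  define g where "g = (\<lambda>x. \<Sum>E\<in>mark_space m. \<Psi> x E * mark_prob h m x E)"
  define w :: "(nat \<Rightarrow> nat) \<Rightarrow> 'w \<Rightarrow> ennreal" where
    "w = (\<lambda>i \<omega>. indicator (used m i) \<omega> * (ennreal (g (tuple m i \<omega>)) * indicator ?O (tuple m i \<omega>)))"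
  define F where "F = (\<lambda>\<omega>. \<integral>\<^sup>+x. ennreal (\<Psi> x (marks (C \<omega>) m x)) \<partial>count_space (ordered_tuples m (\<Phi> \<omega>)))"
  interpret T: sigma_finite_measure ?T
    by (rule sigma_finite_measure_count_space_countable[OF countable_index_tuples])
  have u: "u i \<in> borel_measurable P" for i
    unfolding u_def by (rule tuple_marks_measurable(1)[where \<Psi>=\<Psi>]) (rule \<Psi>)
  have F: "F \<omega> = (\<integral>\<^sup>+i. u i \<omega> \<partial>?T)" if "\<omega> \<in> space P" for \<omega>
  proof -
    have "(\<integral>\<^sup>+i. u i \<omega> \<partial>?T) =
        (\<integral>\<^sup>+x. ennreal (\<Psi> x (marks (C \<omega>) m x)) * indicator ?O x \<partial>count_space ({..<m} \<rightarrow>\<^sub>E \<Phi> \<omega>))"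
      unfolding u_def by (rule nn_integral_tuples[OF that, of m "\<lambda>x. ennreal (\<Psi> x (marks (C \<omega>) m x)) * indicator ?O x"])
    also have "\<dots> = F \<omega>" unfolding F_def by (rule nn_integral_ordered_tuples[OF that, where f="\<lambda>x. ennreal (\<Psi> x (marks (C \<omega>) m x))"])
    finally show ?thesis by (rule sym)
  qed
  have "(\<lambda>(i, \<omega>). u i \<omega>) \<in> borel_measurable (?T \<Otimes>\<^sub>M P)"
    by (rule measurable_pair_measure_countable1[OF countable_index_tuples]) (use u in simp)
  from measurable_pair_swap[OF this]
  have "(\<lambda>(\<omega>, i). u i \<omega>) \<in> borel_measurable (P \<Otimes>\<^sub>M ?T)" by simp
  then have "(\<lambda>\<omega>. \<integral>\<^sup>+i. u i \<omega> \<partial>?T) \<in> borel_measurable P"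
    by (rule T.borel_measurable_nn_integral)
  moreover have "F \<in> borel_measurable P \<longleftrightarrow> (\<lambda>\<omega>. \<integral>\<^sup>+i. u i \<omega> \<partial>?T) \<in> borel_measurable P"
    by (rule measurable_cong) (rule F)
  ultimately have "F \<in> borel_measurable P" by blast
  then show "(\<lambda>\<omega>. \<integral>\<^sup>+x. ennreal (\<Psi> x (marks (C \<omega>) m x)) \<partial>count_space (ordered_tuples m (\<Phi> \<omega>))) \<in> borel_measurable P"
    by (simp only: F_def)
  have g: "g \<in> borel_measurable (tuple_borel m)"
    unfolding g_def by (intro borel_measurable_sum borel_measurable_times \<Psi> mark_prob_measurable h_meas)
  have w: "w i \<in> borel_measurable P" for i
  proof -
    have "(\<lambda>x. ennreal (g x) * indicator ?O x) \<in> borel_measurable (tuple_borel m)"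
      using g by simp
    then have "(\<lambda>\<omega>. ennreal (g (tuple m i \<omega>)) * indicator ?O (tuple m i \<omega>)) \<in> borel_measurable P"
      by (rule measurable_compose[OF tuple_measurable_P])
    then show ?thesis unfolding w_def by simp
  qed
  have "(\<integral>\<^sup>+\<omega>. F \<omega> \<partial>P) = (\<integral>\<^sup>+\<omega>. (\<integral>\<^sup>+i. u i \<omega> \<partial>?T) \<partial>P)"
    by (rule nn_integral_cong) (rule F)
  also have "\<dots> = (\<integral>\<^sup>+i. (\<integral>\<^sup>+\<omega>. u i \<omega> \<partial>P) \<partial>?T)"
    by (rule nn_integral_count_space_nn_integral[OF countable_index_tuples u])
  also have "\<dots> = (\<integral>\<^sup>+i. (\<integral>\<^sup>+\<omega>. w i \<omega> \<partial>P) \<partial>?T)"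
  proof (rule nn_integral_cong)
    fix i
    show "(\<integral>\<^sup>+\<omega>. u i \<omega> \<partial>P) = (\<integral>\<^sup>+\<omega>. w i \<omega> \<partial>P)"
      unfolding u_def w_def g_def by (rule tuple_marks_integral[where \<Psi>=\<Psi>]) (rule \<Psi> \<Psi>01, assumption?)+
  qed
  also have "\<dots> = (\<integral>\<^sup>+\<omega>. (\<integral>\<^sup>+i. w i \<omega> \<partial>?T) \<partial>P)"
    by (rule nn_integral_count_space_nn_integral[OF countable_index_tuples w, symmetric])
  also have "\<dots> = (\<integral>\<^sup>+\<omega>. (\<integral>\<^sup>+x. ennreal (g x) \<partial>count_space (ordered_tuples m (\<Phi> \<omega>))) \<partial>P)"
  proof (rule nn_integral_cong)
    fix \<omega> assume \<omega>: "\<omega> \<in> space P"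
    have "(\<integral>\<^sup>+i. w i \<omega> \<partial>?T) =
        (\<integral>\<^sup>+x. ennreal (g x) * indicator ?O x \<partial>count_space ({..<m} \<rightarrow>\<^sub>E \<Phi> \<omega>))"
      unfolding w_def by (rule nn_integral_tuples[OF \<omega>, of m "\<lambda>x. ennreal (g x) * indicator ?O x"])
    also have "\<dots> = (\<integral>\<^sup>+x. ennreal (g x) \<partial>count_space (ordered_tuples m (\<Phi> \<omega>)))"
      by (rule nn_integral_ordered_tuples[OF \<omega>, where f="\<lambda>x. ennreal (g x)"])
    finally show "(\<integral>\<^sup>+i. w i \<omega> \<partial>?T) = (\<integral>\<^sup>+x. ennreal (g x) \<partial>count_space (ordered_tuples m (\<Phi> \<omega>)))" .
  qed
  also have "\<dots> = (\<integral>\<^sup>+x. ennreal (g x) * indicator ?O x \<partial>tuple_intensity m)"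
    using g by (intro ordered_campbell) simp
  finally show "(\<integral>\<^sup>+\<omega>. (\<integral>\<^sup>+x. ennreal (\<Psi> x (marks (C \<omega>) m x)) \<partial>count_space (ordered_tuples m (\<Phi> \<omega>))) \<partial>P) =
      (\<integral>\<^sup>+x. ennreal (\<Sum>E\<in>mark_space m. \<Psi> x E * mark_prob h m x E) * indicator (time_ordered m) x
         \<partial>tuple_intensity m)"
    by (simp only: F_def g_def)
qed

end

section \<open>Survival sums and chains\<close>

lemma sum_Pow_prod:
  fixes a b :: "'a \<Rightarrow> real"
  assumes "finite A"
  shows "(\<Sum>S\<in>Pow A. \<Prod>j\<in>A. if j \<in> S then a j else b j) = (\<Prod>j\<in>A. a j + b j)"
proof -
  have "(\<Prod>j\<in>A. if j \<in> S then a j else b j) = prod a S * prod b (A - S)" if "S \<in> Pow A" for S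
  proof -
    have "A \<inter> {j. j \<in> S} = S" "A \<inter> - {j. j \<in> S} = A - S" using that by auto
    then show ?thesis using assms by (simp add: prod.If_cases)
  qed
  then show ?thesis using assms by (simp add: prod_add)
qed

text \<open>Under \<open>mark_prob\<close> the rows of a pattern are independent, so the mean of a
  product over rows is the product of the row means.\<close>

lemma sum_mark_space:
  "(\<Sum>E\<in>mark_space m. (\<Prod>k<m. a k (E k)) * mark_prob h m x E) =
   (\<Prod>k<m. \<Sum>S\<in>Pow {k<..<m}. a k S * (\<Prod>j\<in>{k<..<m}.
      if j \<in> S then h (fst (x j)) (fst (x k)) else 1 - h (fst (x j)) (fst (x k))))"
  unfolding mark_space_def mark_prob_def
  by (subst prod_sum_PiE) (auto simp: prod.distrib)

lemma sum_mark_space_survival: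
  "(\<Sum>E\<in>mark_space m. (\<Prod>k<m. 1 - u (x k) * of_bool (E k = {})) * mark_prob h m x E) =
   survival_weight (\<lambda>p q. h (fst p) (fst q)) m u x"
proof -
  have "(\<Sum>S\<in>Pow {k<..<m}. (1 - u (x k) * of_bool (S = {})) * (\<Prod>j\<in>{k<..<m}.
      if j \<in> S then h (fst (x j)) (fst (x k)) else 1 - h (fst (x j)) (fst (x k)))) =
    1 - u (x k) * (\<Prod>j\<in>{k<..<m}. 1 - h (fst (x j)) (fst (x k)))" (is "(\<Sum>S\<in>_. _ * ?p S) = _") for k
  proof -
    have "(\<Sum>S\<in>Pow {k<..<m}. ?p S) = 1" by (subst sum_Pow_prod) auto
    moreover have "(\<Sum>S\<in>Pow {k<..<m}. of_bool (S = {}) * ?p S) = ?p {}"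
      by (subst sum.mono_neutral_right[of _ "{{}}"]) auto
    ultimately show ?thesis
      by (simp add: left_diff_distrib sum_subtractf mult.assoc sum_distrib_left[symmetric])
  qed
  then show ?thesis
    unfolding sum_mark_space[where a="\<lambda>k S. 1 - u (x k) * of_bool (S = {})"] survival_weight_def by simp
qed

text \<open>Only the pairs of consecutive places are prescribed; the probabilities of every other
  pair add up to 1.\<close>

lemma sum_mark_space_chain:
  "(\<Sum>E\<in>mark_space m. (\<Prod>k<m. if Suc k < m then of_bool (Suc k \<in> E k) else 1) * mark_prob h m x E) =
   (\<Prod>k<m. if Suc k < m then h (fst (x (Suc k))) (fst (x k)) else 1)"
  unfolding sum_mark_space[where a="\<lambda>k S. if Suc k < m then of_bool (Suc k \<in> S) else 1"]
proof (rule prod.cong[OF refl])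
  fix k assume "k \<in> {..<m}"
  let ?h = "\<lambda>j. h (fst (x j)) (fst (x k))"
  show "(\<Sum>S\<in>Pow {k<..<m}. (if Suc k < m then of_bool (Suc k \<in> S) else 1) * (\<Prod>j\<in>{k<..<m}.
      if j \<in> S then ?h j else 1 - ?h j)) = (if Suc k < m then ?h (Suc k) else 1)"
  proof (cases "Suc k < m")
    case True
    \<comment> \<open>The constraint is absorbed into the product by giving weight 0 to the outcome
      in which the pair does not contend, after which the sum over subsets factorises.\<close>
    have "of_bool (Suc k \<in> S) * (\<Prod>j\<in>{k<..<m}. if j \<in> S then ?h j else 1 - ?h j) =
      (\<Prod>j\<in>{k<..<m}. if j \<in> S then ?h j else (1 - ?h j) * of_bool (j \<noteq> Suc k))" for S
    proof (cases "Suc k \<in> S")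
      case True
      then show ?thesis by (auto intro!: prod.cong)
    next
      case False
      then have "(\<Prod>j\<in>{k<..<m}. if j \<in> S then ?h j else (1 - ?h j) * of_bool (j \<noteq> Suc k)) = 0"
        using \<open>Suc k < m\<close> by (intro prod_zero bexI[of _ "Suc k"]) auto
      with False show ?thesis by simp
    qed
    then have "(\<Sum>S\<in>Pow {k<..<m}. of_bool (Suc k \<in> S) * (\<Prod>j\<in>{k<..<m}. if j \<in> S then ?h j else 1 - ?h j)) =
        (\<Prod>j\<in>{k<..<m}. ?h j + (1 - ?h j) * of_bool (j \<noteq> Suc k))"
      by (simp add: sum_Pow_prod)
    also have "\<dots> = (\<Prod>j\<in>{Suc k}. ?h j + (1 - ?h j) * of_bool (j \<noteq> Suc k))"
      using True by (intro prod.mono_neutral_right) auto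
    finally show ?thesis using True by simp
  next
    case False
    then have "{k<..<m} = {}" by auto
    with False show ?thesis by simp
  qed
qed

definition time_ordered_before :: "nat \<Rightarrow> real \<Rightarrow> (nat \<Rightarrow> point) set" where
  "time_ordered_before m t = {x \<in> time_ordered m. \<forall>k<m. snd (x k) < t}"

lemma time_ordered_before_measurable [measurable]:
  "time_ordered_before m t \<in> sets (tuple_borel m)"
proof -
  have "{x \<in> space (tuple_borel m). \<forall>k\<in>{..<m}. snd (x k) < t} \<in> sets (tuple_borel m)"
  proof (intro sets.sets_Collect_finite_All finite_lessThan)
    fix k assume "k \<in> {..<m}"
    then show "{x \<in> space (tuple_borel m). snd (x k) < t} \<in> sets (tuple_borel m)"
      using measurable_component_snd[of k m] by simp
  qed
  moreover have "time_ordered_before m t = time_ordered m \<inter>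
      {x \<in> space (tuple_borel m). \<forall>k\<in>{..<m}. snd (x k) < t}"
    by (auto simp: time_ordered_before_def time_ordered_def space_PiM)
  ultimately show ?thesis by auto
qed

lemma prod_indicator:
  assumes "finite A"
  shows "(\<Prod>k\<in>A. indicator (B k) (y k)) = (of_bool (\<forall>k\<in>A. y k \<in> B k) :: 'b :: comm_semiring_1)"
proof (cases "\<forall>k\<in>A. y k \<in> B k")
  case True
  then show ?thesis by simp
next
  case False
  then obtain k where k: "k \<in> A" "y k \<notin> B k" by blast
  then have "(\<Prod>k\<in>A. indicator (B k) (y k)) = (0 :: 'b)"
    using assms by (intro prod_zero bexI[of _ k]) simp_all
  then show ?thesis unfolding of_bool_def if_not_P[OF False] .
qed

lemma ennreal_mult_indicator: "ennreal r * indicator A x = ennreal (indicator A x * r)"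
  by (simp split: split_indicator)

lemma unit_mult: "a \<in> {0..1} \<Longrightarrow> b \<in> {0..1} \<Longrightarrow> a * b \<in> {0..1 :: real}"
  by (simp add: mult_le_one)

lemma unit_prod: "(\<And>k. k \<in> K \<Longrightarrow> f k \<in> {0..1}) \<Longrightarrow> prod f K \<in> {0..1 :: real}"
  by (simp add: prod_nonneg prod_le_1)

lemma unit_indicator: "indicator A x \<in> {0..1 :: real}"
  by (simp split: split_indicator)

lemma nn_integral_count_space_Collect:
  "(\<integral>\<^sup>+x. f x \<partial>count_space {x \<in> A. Q x}) = (\<integral>\<^sup>+x. f x * indicator {x. Q x} x \<partial>count_space A)"
  by (subst (1 2) nn_integral_count_space_indicator)
    (auto intro!: nn_integral_cong split: split_indicator)

lemma nn_integral_ordered_tuples_restrict: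
  "(\<integral>\<^sup>+x. f x \<partial>count_space (ordered_tuples m (S \<inter> D))) =
   (\<integral>\<^sup>+x. f x * indicator {x. \<forall>k<m. x k \<in> D} x \<partial>count_space (ordered_tuples m S))"
proof -
  have "ordered_tuples m (S \<inter> D) = {x \<in> ordered_tuples m S. \<forall>k<m. x k \<in> D}"
    by (auto simp: ordered_tuples_def PiE_def Pi_def)
  then show ?thesis by (simp only: nn_integral_count_space_Collect)
qed

lemma survival_weight_unit:
  assumes "\<And>p q. c p q \<in> {0..1}" "\<And>p. u p \<in> {0..1}"
  shows "survival_weight c m u x \<in> {0..1}"
proof -
  have "1 - u (x k) * (\<Prod>j\<in>{k<..<m}. 1 - c (x j) (x k)) \<in> {0..1}" for k
  proof -
    have "(\<Prod>j\<in>{k<..<m}. 1 - c (x j) (x k)) \<in> {0..1}"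
    proof -
      have "0 \<le> c p q" "c p q \<le> 1" for p q using assms(1)[of p q] by auto
      then show ?thesis by (simp add: prod_nonneg prod_le_1)
    qed
    moreover have "u (x k) \<in> {0..1}" by (rule assms(2))
    ultimately show ?thesis by (auto intro: mult_le_one)
  qed
  then show ?thesis unfolding survival_weight_def
    by (auto intro!: prod_nonneg prod_le_1)
qed

lemma survival_weight_measurable:
  assumes h: "case_prod h \<in> borel_measurable borel"
    and u: "\<And>k. k < m \<Longrightarrow> (\<lambda>z. u (f z) (x z k)) \<in> borel_measurable M"
    and x: "\<And>k. k < m \<Longrightarrow> (\<lambda>z. fst (x z k)) \<in> M \<rightarrow>\<^sub>M borel"
  shows "(\<lambda>z. survival_weight (\<lambda>p q. h (fst p) (fst q)) m (u (f z)) (x z)) \<in> borel_measurable M"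
  unfolding survival_weight_def
proof (intro borel_measurable_prod borel_measurable_diff borel_measurable_times borel_measurable_const)
  fix k assume k: "k \<in> {..<m}"
  then show "(\<lambda>z. u (f z) (x z k)) \<in> borel_measurable M" by (intro u) auto
  fix j assume "j \<in> {k<..<m}"
  with k show "(\<lambda>z. h (fst (x z j)) (fst (x z k))) \<in> borel_measurable M"
    by (intro measurable_kernel_pair[OF h] x) auto
qed

section \<open>Expected survival sums and chain counts\<close>

context marked_points
begin

definition window_points :: "(real^2) set \<Rightarrow> real \<Rightarrow> 'w \<Rightarrow> point set" where
  "window_points W t \<omega> = \<Phi> \<omega> \<inter> W \<times> {..<t}"

lemma finite_window_points:
  assumes "\<omega> \<in> space P" "bounded W"
  shows "finite (window_points W t \<omega>)"
proof -
  have "bounded (W \<times> {0..<t})"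
    using assms(2) by (intro bounded_Times bounded_subset[OF bounded_cbox[of 0 t]]) auto
  from finite_points[OF assms(1) this]
  show ?thesis
    by (rule rev_finite_subset) (use timer_nonneg[OF assms(1)] in \<open>fastforce simp: window_points_def\<close>)
qed

text \<open>The order-m part of the alternating expansion without its sign. As an extended
  nonnegative integral it inherits measurability and mean directly from the marked Campbell formula;
  the signs are added in \<open>window_series\<close>.\<close>

definition survival_sum :: "(real^2) set \<Rightarrow> real \<Rightarrow> (real^2 \<Rightarrow> real) \<Rightarrow> nat \<Rightarrow> 'w \<Rightarrow> ennreal" where
  "survival_sum W t v m \<omega> = (\<integral>\<^sup>+x. ennreal (survival_weight (\<lambda>p q. of_bool (C \<omega> p q)) m (\<lambda>p. v (fst p)) x)
      \<partial>count_space (ordered_tuples m (window_points W t \<omega>)))"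

definition survival_integral :: "(real^2) set \<Rightarrow> nat \<Rightarrow> real \<Rightarrow> (real^2 \<Rightarrow> real) \<Rightarrow> ennreal" where
  "survival_integral W m t v = (\<integral>\<^sup>+x. (\<Prod>k<m. indicator W (fst (x k))) *
      ennreal (survival_weight (\<lambda>p q. h (fst p) (fst q)) m (\<lambda>p. v (fst p)) x) *
      indicator (time_ordered_before m t) x \<partial>tuple_intensity m)"

lemma window_indicator_measurable:
  fixes m :: nat
  assumes W: "W \<in> sets borel"
  shows "(\<lambda>x. indicator {x. \<forall>k<m. x k \<in> W \<times> {..<t}} x :: real) \<in> borel_measurable (tuple_borel m)"
proof -
  have "W \<times> {..<t} \<in> sets (borel :: point measure)"
    unfolding borel_prod[symmetric] using W by (intro pair_measureI) auto
  then have "(\<lambda>x. indicator (W \<times> {..<t}) (x k) :: real) \<in> borel_measurable (tuple_borel m)"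
    if "k \<in> {..<m}" for k
    by (intro measurable_compose[OF measurable_component_singleton[OF that]]) simp
  then have "(\<lambda>x. \<Prod>k<m. indicator (W \<times> {..<t}) (x k) :: real) \<in> borel_measurable (tuple_borel m)"
    by (rule borel_measurable_prod)
  also have "(\<lambda>x. \<Prod>k<m. indicator (W \<times> {..<t}) (x k) :: real) =
      (\<lambda>x. indicator {x. \<forall>k<m. x k \<in> W \<times> {..<t}} x)"
    by (rule ext, subst prod_indicator[OF finite_lessThan]) (simp add: indicator_def Ball_def)
  finally show ?thesis .
qed

text \<open>The weight depends on the contention variables only through which rows of the marks are
  empty, and the mean over the marks replaces the Boolean kernel by \<open>h\<close>.\<close>

lemma survival_sum_mean:
  assumes W: "W \<in> sets borel" and v: "v \<in> borel_measurable borel" "\<And>x. v x \<in> {0..1}"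
  shows "survival_sum W t v m \<in> borel_measurable P"
    and "(\<integral>\<^sup>+\<omega>. survival_sum W t v m \<omega> \<partial>P) = survival_integral W m t v"
proof -
  let ?D = "W \<times> {..<t}" and ?u = "\<lambda>p. v (fst p)"
  define \<Psi> where "\<Psi> x E = indicator {x. \<forall>k<m. x k \<in> ?D} x * (\<Prod>k<m. 1 - ?u (x k) * of_bool (E k = {}))"
    for x :: "nat \<Rightarrow> point" and E :: "nat \<Rightarrow> nat set"
  have vm: "(\<lambda>x. v (fst (x k))) \<in> borel_measurable (tuple_borel m)" if "k < m" for k
    using that by (intro measurable_compose[OF measurable_component_fst v(1)])
  have \<Psi>m: "(\<lambda>x. \<Psi> x E) \<in> borel_measurable (tuple_borel m)" for E
    unfolding \<Psi>_def
    by (intro borel_measurable_times window_indicator_measurable[OF W] borel_measurable_prod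
        borel_measurable_diff borel_measurable_const vm) auto
  have \<Psi>01: "\<Psi> x E \<in> {0..1}" for x E
  proof -
    have "1 - ?u (x k) * of_bool (E k = {}) \<in> {0..1}" for k
      using v(2)[of "fst (x k)"] by (cases "E k = {}") simp_all
    then show ?thesis unfolding \<Psi>_def by (intro unit_mult unit_prod unit_indicator)
  qed
  have marks: "(\<Prod>k<m. 1 - ?u (x k) * of_bool (marks (C \<omega>) m x k = {})) =
      survival_weight (\<lambda>p q. of_bool (C \<omega> p q)) m ?u x" for \<omega> x
    unfolding survival_weight_def
  proof (rule prod.cong[OF refl])
    fix k assume "k \<in> {..<m}"
    have "(\<Prod>j\<in>{k<..<m}. 1 - of_bool (C \<omega> (x j) (x k))) = (of_bool (\<forall>j\<in>{k<..<m}. \<not> C \<omega> (x j) (x k)) :: real)"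
    proof (cases "\<forall>j\<in>{k<..<m}. \<not> C \<omega> (x j) (x k)")
      case False
      then show ?thesis by (subst prod_zero) auto
    qed simp
    then show "1 - ?u (x k) * of_bool (marks (C \<omega>) m x k = {}) =
        1 - ?u (x k) * (\<Prod>j\<in>{k<..<m}. 1 - of_bool (C \<omega> (x j) (x k)))"
      using \<open>k \<in> {..<m}\<close> by (simp add: marks_def of_bool_def)
  qed
  have S: "survival_sum W t v m \<omega> =
      (\<integral>\<^sup>+x. ennreal (\<Psi> x (marks (C \<omega>) m x)) \<partial>count_space (ordered_tuples m (\<Phi> \<omega>)))" for \<omega>
    unfolding survival_sum_def window_points_def nn_integral_ordered_tuples_restrict \<Psi>_def marks
    by (intro nn_integral_cong ennreal_mult_indicator)
  show "survival_sum W t v m \<in> borel_measurable P"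
    using marked_campbell(1)[where \<Psi>=\<Psi>, OF \<Psi>m \<Psi>01] by (simp only: S[abs_def])
  have "(\<integral>\<^sup>+\<omega>. survival_sum W t v m \<omega> \<partial>P) =
      (\<integral>\<^sup>+x. ennreal (\<Sum>E\<in>mark_space m. \<Psi> x E * mark_prob h m x E) * indicator (time_ordered m) x
         \<partial>tuple_intensity m)"
    unfolding S by (rule marked_campbell(2)[where \<Psi>=\<Psi>, OF \<Psi>m \<Psi>01])
  also have "\<dots> = survival_integral W m t v"
    unfolding survival_integral_def
  proof (rule nn_integral_cong)
    fix x :: "nat \<Rightarrow> point"
    have sum: "(\<Sum>E\<in>mark_space m. \<Psi> x E * mark_prob h m x E) =
      indicator {x. \<forall>k<m. x k \<in> ?D} x * survival_weight (\<lambda>p q. h (fst p) (fst q)) m ?u x"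
      unfolding \<Psi>_def sum_mark_space_survival[symmetric] by (simp add: sum_distrib_left mult.assoc)
    have ind: "indicator {x. \<forall>k<m. x k \<in> ?D} x * indicator (time_ordered m) x =
      ((\<Prod>k<m. indicator W (fst (x k))) * indicator (time_ordered_before m t) x :: ennreal)"
    proof -
      have "x \<in> {x. \<forall>k<m. x k \<in> ?D} \<and> x \<in> time_ordered m \<longleftrightarrow>
          (\<forall>k\<in>{..<m}. fst (x k) \<in> W) \<and> x \<in> time_ordered_before m t"
        unfolding time_ordered_before_def mem_Times_iff mem_Collect_eq by fastforce
      then show ?thesis
        by (subst prod_indicator[OF finite_lessThan]) (simp only: indicator_def of_bool_conj[symmetric])
    qed
    show "ennreal (\<Sum>E\<in>mark_space m. \<Psi> x E * mark_prob h m x E) * indicator (time_ordered m) x =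
      (\<Prod>k<m. indicator W (fst (x k))) *
      ennreal (survival_weight (\<lambda>p q. h (fst p) (fst q)) m ?u x) * indicator (time_ordered_before m t) x"
    proof -
      let ?s = "survival_weight (\<lambda>p q. h (fst p) (fst q)) m ?u x" and ?A = "{x. \<forall>k<m. x k \<in> ?D}"
      have "ennreal (indicator ?A x * ?s) * indicator (time_ordered m) x =
          ennreal ?s * (indicator ?A x * indicator (time_ordered m) x)"
        by (simp split: split_indicator)
      also have "\<dots> = ennreal ?s * ((\<Prod>k<m. indicator W (fst (x k))) * indicator (time_ordered_before m t) x)"
        by (simp only: ind)
      also have "\<dots> = (\<Prod>k<m. indicator W (fst (x k))) * ennreal ?s * indicator (time_ordered_before m t) x"
        by (simp add: ac_simps)
      finally show ?thesis by (simp only: sum)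
    qed
  qed
  finally show "(\<integral>\<^sup>+\<omega>. survival_sum W t v m \<omega> \<partial>P) = survival_integral W m t v" .
qed

text \<open>The function \<open>g\<close> sits at the last place, hence at the point with the
  largest timer: it localises the top of a chain whose lower end may be anywhere in the
  plane.\<close>

definition chain_weight :: "nat \<Rightarrow> (real^2 \<Rightarrow> real) \<Rightarrow> (nat \<Rightarrow> point) \<Rightarrow> real" where
  "chain_weight m g x = g (fst (x (m - 1))) * (\<Prod>k<m. if Suc k < m then h (fst (x (Suc k))) (fst (x k)) else 1)"

text \<open>Read from the last place downwards, a chain is a path towards earlier and earlier
  contending points.\<close>

definition chains :: "nat \<Rightarrow> real \<Rightarrow> 'w \<Rightarrow> (nat \<Rightarrow> point) set" where
  "chains m t \<omega> = {x \<in> ordered_tuples m (\<Phi> \<omega> \<inter> UNIV \<times> {..<t}). \<forall>k. Suc k < m \<longrightarrow> C \<omega> (x (Suc k)) (x k)}"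

text \<open>Being a chain means that \<open>Suc k\<close> lies in row k of the marks for every k
  with a successor, so the marked Campbell formula applies with the product of these
  indicators.\<close>

lemma chain_mean:
  assumes m: "0 < m" and g: "g \<in> borel_measurable borel" "\<And>x. g x \<in> {0..1}"
  shows "(\<lambda>\<omega>. \<integral>\<^sup>+x. ennreal (g (fst (x (m - 1)))) \<partial>count_space (chains m t \<omega>)) \<in> borel_measurable P"
    and "(\<integral>\<^sup>+\<omega>. (\<integral>\<^sup>+x. ennreal (g (fst (x (m - 1)))) \<partial>count_space (chains m t \<omega>)) \<partial>P) =
      (\<integral>\<^sup>+x. ennreal (chain_weight m g x) * indicator (time_ordered_before m t) x \<partial>tuple_intensity m)"
proof -
  let ?D = "UNIV \<times> {..<t}"
  let ?a = "\<lambda>k S. if Suc k < m then of_bool (Suc k \<in> S) else 1 :: real"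
  define \<Psi> where "\<Psi> x E = indicator {x. \<forall>k<m. x k \<in> ?D} x * g (fst (x (m - 1))) * (\<Prod>k<m. ?a k (E k))"
    for x :: "nat \<Rightarrow> point" and E :: "nat \<Rightarrow> nat set"
  have gm: "(\<lambda>x. g (fst (x (m - 1)))) \<in> borel_measurable (tuple_borel m)"
    using m by (intro measurable_compose[OF measurable_component_fst g(1)]) auto
  have \<Psi>m: "(\<lambda>x. \<Psi> x E) \<in> borel_measurable (tuple_borel m)" for E
    unfolding \<Psi>_def
    by (intro borel_measurable_times window_indicator_measurable gm borel_measurable_const) auto
  have \<Psi>01: "\<Psi> x E \<in> {0..1}" for x E
    unfolding \<Psi>_def by (intro unit_mult unit_prod unit_indicator g(2)) simp
  have marks: "(\<Prod>k<m. ?a k (marks (C \<omega>) m x k)) = of_bool (\<forall>k. Suc k < m \<longrightarrow> C \<omega> (x (Suc k)) (x k))" for \<omega> x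
  proof (cases "\<forall>k. Suc k < m \<longrightarrow> C \<omega> (x (Suc k)) (x k)")
    case True
    then show ?thesis by (auto simp: marks_def intro!: prod.neutral)
  next
    case False
    then obtain k where "Suc k < m" "\<not> C \<omega> (x (Suc k)) (x k)" by blast
    then have "(\<Prod>k<m. ?a k (marks (C \<omega>) m x k)) = 0"
      by (intro prod_zero bexI[of _ k]) (auto simp: marks_def)
    then show ?thesis unfolding of_bool_def if_not_P[OF False] .
  qed
  have S: "(\<integral>\<^sup>+x. ennreal (g (fst (x (m - 1)))) \<partial>count_space (chains m t \<omega>)) =
      (\<integral>\<^sup>+x. ennreal (\<Psi> x (marks (C \<omega>) m x)) \<partial>count_space (ordered_tuples m (\<Phi> \<omega>)))" for \<omega>
  proof -
    have "(\<integral>\<^sup>+x. ennreal (g (fst (x (m - 1)))) \<partial>count_space (chains m t \<omega>)) =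
      (\<integral>\<^sup>+x. ennreal (g (fst (x (m - 1)))) * indicator {x. \<forall>k. Suc k < m \<longrightarrow> C \<omega> (x (Suc k)) (x k)} x
        \<partial>count_space (ordered_tuples m (\<Phi> \<omega> \<inter> ?D)))"
      unfolding chains_def
      by (rule nn_integral_count_space_Collect)
    also have "\<dots> = (\<integral>\<^sup>+x. ennreal (\<Psi> x (marks (C \<omega>) m x)) \<partial>count_space (ordered_tuples m (\<Phi> \<omega>)))"
      unfolding nn_integral_ordered_tuples_restrict \<Psi>_def marks
    proof (rule nn_integral_cong)
      fix x :: "nat \<Rightarrow> point"
      have "ennreal (g (fst (x (m - 1)))) * indicator {x. Q x} x * indicator A x =
        ennreal (indicator A x * g (fst (x (m - 1))) * of_bool (Q x))" for A Q
        by (simp split: split_indicator)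
      from this[of "\<lambda>x. \<forall>k. Suc k < m \<longrightarrow> C \<omega> (x (Suc k)) (x k)"]
      show "ennreal (g (fst (x (m - 1)))) * indicator {x. \<forall>k. Suc k < m \<longrightarrow> C \<omega> (x (Suc k)) (x k)} x *
          indicator {x. \<forall>k<m. x k \<in> ?D} x =
        ennreal (indicator {x. \<forall>k<m. x k \<in> ?D} x * g (fst (x (m - 1))) * of_bool (\<forall>k. Suc k < m \<longrightarrow> C \<omega> (x (Suc k)) (x k)))" .
    qed
    finally show ?thesis .
  qed
  have S': "(\<lambda>\<omega>. \<integral>\<^sup>+x. ennreal (g (fst (x (m - 1)))) \<partial>count_space (chains m t \<omega>)) =
      (\<lambda>\<omega>. \<integral>\<^sup>+x. ennreal (\<Psi> x (marks (C \<omega>) m x)) \<partial>count_space (ordered_tuples m (\<Phi> \<omega>)))"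
    by (rule ext) (rule S)
  show "(\<lambda>\<omega>. \<integral>\<^sup>+x. ennreal (g (fst (x (m - 1)))) \<partial>count_space (chains m t \<omega>)) \<in> borel_measurable P"
    unfolding S' by (rule marked_campbell(1)[where \<Psi>=\<Psi>, OF \<Psi>m \<Psi>01])
  have "(\<integral>\<^sup>+\<omega>. (\<integral>\<^sup>+x. ennreal (g (fst (x (m - 1)))) \<partial>count_space (chains m t \<omega>)) \<partial>P) =
      (\<integral>\<^sup>+x. ennreal (\<Sum>E\<in>mark_space m. \<Psi> x E * mark_prob h m x E) * indicator (time_ordered m) x
         \<partial>tuple_intensity m)"
    unfolding S' by (rule marked_campbell(2)[where \<Psi>=\<Psi>, OF \<Psi>m \<Psi>01])
  also have "\<dots> = (\<integral>\<^sup>+x. ennreal (chain_weight m g x) * indicator (time_ordered_before m t) x \<partial>tuple_intensity m)"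
  proof (rule nn_integral_cong)
    fix x :: "nat \<Rightarrow> point"
    have "(\<Sum>E\<in>mark_space m. \<Psi> x E * mark_prob h m x E) = indicator {x. \<forall>k<m. x k \<in> ?D} x * chain_weight m g x"
    proof -
      have "(\<Sum>E\<in>mark_space m. \<Psi> x E * mark_prob h m x E) = indicator {x. \<forall>k<m. x k \<in> ?D} x * g (fst (x (m - 1))) *
          (\<Sum>E\<in>mark_space m. (\<Prod>k<m. ?a k (E k)) * mark_prob h m x E)"
        unfolding \<Psi>_def sum_distrib_left by (intro sum.cong refl) (rule mult.assoc)
      also have "\<dots> = indicator {x. \<forall>k<m. x k \<in> ?D} x * chain_weight m g x"
        unfolding chain_weight_def by (subst sum_mark_space_chain) (rule mult.assoc)
      finally show ?thesis .
    qed
    then show "ennreal (\<Sum>E\<in>mark_space m. \<Psi> x E * mark_prob h m x E) * indicator (time_ordered m) x =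
        ennreal (chain_weight m g x) * indicator (time_ordered_before m t) x"
      by (auto simp: time_ordered_before_def mem_Times_iff split: split_indicator)
  qed
  finally show "(\<integral>\<^sup>+\<omega>. (\<integral>\<^sup>+x. ennreal (g (fst (x (m - 1)))) \<partial>count_space (chains m t \<omega>)) \<partial>P) =
      (\<integral>\<^sup>+x. ennreal (chain_weight m g x) * indicator (time_ordered_before m t) x \<partial>tuple_intensity m)" .
qed

end

section \<open>Iterated integrals over ordered tuples\<close>

lemma nn_integral_power_bound:
  assumes t: "0 \<le> t" and c: "0 \<le> c"
  shows "(\<integral>\<^sup>+s. indicator {0..<t} s * ennreal (c * s ^ m) \<partial>lborel) \<le> ennreal (c * t ^ Suc m / real (Suc m))"
proof -
  have "(\<integral>\<^sup>+s. indicator {0..<t} s * ennreal (c * s ^ m) \<partial>lborel) \<le>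
      (\<integral>\<^sup>+s. ennreal (c * s ^ m) * indicator {0..t} s \<partial>lborel)"
    by (intro nn_integral_mono) (auto split: split_indicator)
  also have "\<dots> = ennreal (c * t ^ Suc m / real (Suc m) - c * 0 ^ Suc m / real (Suc m))"
  proof (rule nn_integral_FTC_Icc)
    show "((\<lambda>s. c * s ^ Suc m / real (Suc m)) has_real_derivative c * x ^ m) (at x)" for x
    proof -
      have "((\<lambda>s. c * s ^ Suc m / real (Suc m)) has_real_derivative
          c * (real (Suc m) * x ^ m) / real (Suc m)) (at x)"
        by (rule derivative_eq_intros refl | simp)+
      then show ?thesis by simp
    qed
  qed (use t c in auto)
  finally show ?thesis by simp
qed

text \<open>Joint in the peeled point \<open>p\<close> and the remaining tuple, because
  \<open>p\<close> enters both through \<open>H h v\<close> and as the time horizon of the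
  rest.\<close>

lemma survival_integrand_measurable:
  assumes h: "case_prod h \<in> borel_measurable borel" and v: "v \<in> borel_measurable borel" and W: "W \<in> sets borel"
  shows "(\<lambda>(p, x). (\<Prod>k<m. indicator W (fst (x k))) *
      ennreal (survival_weight (\<lambda>p q. h (fst p) (fst q)) m (\<lambda>q. H h v (fst p) (fst q)) x) *
      indicator (time_ordered_before m (snd p)) x)
    \<in> borel_measurable (borel \<Otimes>\<^sub>M tuple_borel m)"
  unfolding case_prod_unfold
proof (intro borel_measurable_times_ennreal measurable_compose[OF _ measurable_ennreal])
  let ?N = "borel \<Otimes>\<^sub>M tuple_borel m"
  have x: "(\<lambda>z. fst (snd z k)) \<in> ?N \<rightarrow>\<^sub>M borel" and t: "(\<lambda>z. snd (snd z k)) \<in> ?N \<rightarrow>\<^sub>M borel" if "k < m" for k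
    using measurable_compose[OF measurable_snd measurable_component_fst[OF that]]
      measurable_compose[OF measurable_snd measurable_component_snd[OF that]] by auto
  have c: "fst \<in> borel \<rightarrow>\<^sub>M (borel :: (real^2) measure)" "snd \<in> borel \<rightarrow>\<^sub>M (borel :: real measure)"
    by (auto intro!: borel_measurable_continuous_onI continuous_intros)
  have p: "(\<lambda>z. fst (fst z)) \<in> ?N \<rightarrow>\<^sub>M (borel :: (real^2) measure)" "(\<lambda>z. snd (fst z)) \<in> ?N \<rightarrow>\<^sub>M (borel :: real measure)"
    by (intro measurable_compose[OF measurable_fst] c)+
  show "(\<lambda>z. \<Prod>k<m. indicator W (fst (snd z k)) :: ennreal) \<in> borel_measurable ?N"
    by (intro borel_measurable_prod_ennreal measurable_compose[OF x] borel_measurable_indicator W) auto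
  show "(\<lambda>z. survival_weight (\<lambda>p q. h (fst p) (fst q)) m (\<lambda>q. H h v (fst (fst z)) (fst q)) (snd z)) \<in> borel_measurable ?N"
  proof (rule survival_weight_measurable[OF h, where u="\<lambda>p q. H h v (fst p) (fst q)" and f=fst and x=snd])
    fix k assume k: "k < m"
    show "(\<lambda>z. fst (snd z k)) \<in> ?N \<rightarrow>\<^sub>M borel" by (rule x[OF k])
    show "(\<lambda>z. H h v (fst (fst z)) (fst (snd z k))) \<in> borel_measurable ?N"
      unfolding H_def
      by (intro borel_measurable_times borel_measurable_diff borel_measurable_const
          measurable_compose[OF x[OF k] v] measurable_kernel_pair[OF h p(1) x[OF k]])
  qed
  have "{z \<in> space ?N. \<forall>k\<in>{..<m}. snd (snd z k) < snd (fst z)} \<in> sets ?N"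
    by (intro sets.sets_Collect_finite_All borel_measurable_less t p(2)) auto
  moreover have "{z \<in> space ?N. snd z \<in> time_ordered m} \<in> sets ?N"
    using measurable_sets[OF measurable_snd time_ordered_measurable[of m], of borel]
    by (simp add: vimage_def Int_def conj_commute)
  ultimately have "{z \<in> space ?N. snd z \<in> time_ordered m} \<inter> {z \<in> space ?N. \<forall>k\<in>{..<m}. snd (snd z k) < snd (fst z)} \<in> sets ?N"
    by (rule sets.Int[rotated])
  also have "{z \<in> space ?N. snd z \<in> time_ordered m} \<inter> {z \<in> space ?N. \<forall>k\<in>{..<m}. snd (snd z k) < snd (fst z)} =
      {z \<in> space ?N. snd z \<in> time_ordered_before m (snd (fst z))}"
    by (auto simp: time_ordered_before_def)
  finally have "(\<lambda>z. indicator {z \<in> space ?N. snd z \<in> time_ordered_before m (snd (fst z))} z :: ennreal) \<in> borel_measurable ?N"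
    by (rule borel_measurable_indicator)
  then show "(\<lambda>z. indicator (time_ordered_before m (snd (fst z))) (snd z) :: ennreal) \<in> borel_measurable ?N"
    by (rule measurable_cong[THEN iffD1, rotated]) (simp add: indicator_def)
qed

lemma time_ordered_before_fun_upd:
  assumes "y \<in> {..<m} \<rightarrow>\<^sub>E UNIV"
  shows "y(m := p) \<in> time_ordered_before (Suc m) t \<longleftrightarrow> snd p \<in> {0..<t} \<and> y \<in> time_ordered_before m (snd p)"
proof -
  have "y(m := p) \<in> {..<Suc m} \<rightarrow>\<^sub>E UNIV" using assms by (auto simp: PiE_def extensional_def)
  moreover have "(\<forall>k<Suc m. 0 \<le> snd ((y(m := p)) k)) \<longleftrightarrow> 0 \<le> snd p \<and> (\<forall>k<m. 0 \<le> snd (y k))"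
    "(\<forall>k<Suc m. snd ((y(m := p)) k) < t) \<longleftrightarrow> snd p < t \<and> (\<forall>k<m. snd (y k) < t)"
    "(\<forall>k<Suc m. \<forall>j<k. snd ((y(m := p)) j) < snd ((y(m := p)) k)) \<longleftrightarrow>
      (\<forall>j<m. snd (y j) < snd p) \<and> (\<forall>k<m. \<forall>j<k. snd (y j) < snd (y k))"
    by (auto simp: less_Suc_eq)
  ultimately show ?thesis
    using assms unfolding time_ordered_before_def time_ordered_def
    by (auto intro: less_trans)
qed

context marked_points
begin

text \<open>The latest point is integrated outermost, and its timer takes over the role of t for the
  other points.\<close>

lemma nn_integral_time_ordered_Suc:
  assumes F: "F \<in> borel_measurable (tuple_borel (Suc m))"
  shows "(\<integral>\<^sup>+x. F x * indicator (time_ordered_before (Suc m) t) x \<partial>tuple_intensity (Suc m)) =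
    (\<integral>\<^sup>+p. indicator {0..<t} (snd p) *
      (\<integral>\<^sup>+y. F (y(m := p)) * indicator (time_ordered_before m (snd p)) y \<partial>tuple_intensity m) \<partial>\<mu>)"
proof -
  have "(\<lambda>x. F x * indicator (time_ordered_before (Suc m) t) x) \<in> borel_measurable (tuple_borel (Suc m))"
    using F by simp
  then have "(\<lambda>x. F x * indicator (time_ordered_before (Suc m) t) x) \<in> borel_measurable (PiM (insert m {..<m}) (\<lambda>_. \<mu>))"
    by (simp only: lessThan_Suc measurable_cong_sets[OF sets_PiM_mu refl])
  from mus.product_nn_integral_insert_rev[OF _ _ this]
  have "(\<integral>\<^sup>+x. F x * indicator (time_ordered_before (Suc m) t) x \<partial>tuple_intensity (Suc m)) =
    (\<integral>\<^sup>+p. (\<integral>\<^sup>+y. F (y(m := p)) * indicator (time_ordered_before (Suc m) t) (y(m := p)) \<partial>tuple_intensity m) \<partial>\<mu>)"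
    by (simp add: lessThan_Suc)
  also have "\<dots> = (\<integral>\<^sup>+p. indicator {0..<t} (snd p) *
      (\<integral>\<^sup>+y. F (y(m := p)) * indicator (time_ordered_before m (snd p)) y \<partial>tuple_intensity m) \<partial>\<mu>)"
  proof (rule nn_integral_cong)
    fix p :: point
    have "(\<integral>\<^sup>+y. F (y(m := p)) * indicator (time_ordered_before (Suc m) t) (y(m := p)) \<partial>tuple_intensity m) =
      (\<integral>\<^sup>+y. indicator {0..<t} (snd p) * (F (y(m := p)) * indicator (time_ordered_before m (snd p)) y) \<partial>tuple_intensity m)"
    proof (rule nn_integral_cong)
      fix y assume "y \<in> space (tuple_intensity m)"
      then have "y \<in> {..<m} \<rightarrow>\<^sub>E UNIV" by (simp add: space_PiM space_mu)
      from time_ordered_before_fun_upd[OF this, of p t]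
      show "F (y(m := p)) * indicator (time_ordered_before (Suc m) t) (y(m := p)) =
          indicator {0..<t} (snd p) * (F (y(m := p)) * indicator (time_ordered_before m (snd p)) y)"
        by (cases "snd p \<in> {0..<t}"; cases "y \<in> time_ordered_before m (snd p)"; simp)
    qed
    also have "\<dots> = indicator {0..<t} (snd p) *
      (\<integral>\<^sup>+y. F (y(m := p)) * indicator (time_ordered_before m (snd p)) y \<partial>tuple_intensity m)"
      by (simp split: split_indicator)
    finally show "(\<integral>\<^sup>+y. F (y(m := p)) * indicator (time_ordered_before (Suc m) t) (y(m := p)) \<partial>tuple_intensity m) =
      indicator {0..<t} (snd p) *
      (\<integral>\<^sup>+y. F (y(m := p)) * indicator (time_ordered_before m (snd p)) y \<partial>tuple_intensity m)" .
  qed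
  finally show ?thesis .
qed

text \<open>One step of the recursion for the volume of a simplex of ordered times: the exponent
  rises by one and the new exponent appears in the denominator. Iterated, it yields the factorials
  of the later bounds.\<close>

lemma nn_integral_time_slice_bound:
  assumes t: "0 \<le> t" and c: "0 \<le> c" and a: "a \<in> borel_measurable borel"
  shows "(\<integral>\<^sup>+p. indicator {0..<t} (snd p) * (a (fst p) * ennreal (c * snd p ^ m)) \<partial>\<mu>) \<le>
    (\<integral>\<^sup>+x. a x \<partial>L) * ennreal (c * t ^ Suc m / real (Suc m))"
proof -
  have aL: "a \<in> borel_measurable L" using a by (simp add: measurable_cong_sets[OF sets_L[OF lf] refl])
  have meas: "(\<lambda>p. indicator {0..<t} (snd p) * (a (fst p) * ennreal (c * snd p ^ m))) \<in> borel_measurable (L \<Otimes>\<^sub>M lborel)"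
    using measurable_compose[OF measurable_fst aL] by measurable
  have "(\<integral>\<^sup>+p. indicator {0..<t} (snd p) * (a (fst p) * ennreal (c * snd p ^ m)) \<partial>\<mu>) =
    (\<integral>\<^sup>+x. (\<integral>\<^sup>+s. indicator {0..<t} s * (a x * ennreal (c * s ^ m)) \<partial>lborel) \<partial>L)"
    unfolding product_intensity_def by (subst lborel.nn_integral_fst[OF meas, symmetric]) simp
  also have "\<dots> = (\<integral>\<^sup>+x. a x * (\<integral>\<^sup>+s. indicator {0..<t} s * ennreal (c * s ^ m) \<partial>lborel) \<partial>L)"
    by (intro nn_integral_cong) (simp add: nn_integral_cmult[symmetric] mult.left_commute)
  also have "\<dots> \<le> (\<integral>\<^sup>+x. a x * ennreal (c * t ^ Suc m / real (Suc m)) \<partial>L)"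
    by (intro nn_integral_mono mult_left_mono nn_integral_power_bound t c) simp
  also have "\<dots> = (\<integral>\<^sup>+x. a x \<partial>L) * ennreal (c * t ^ Suc m / real (Suc m))"
    by (rule nn_integral_multc[OF aL])
  finally show ?thesis .
qed

lemma survival_integral_0: "survival_integral W 0 t v = 1"
proof -
  have "survival_integral W 0 t v = (\<integral>\<^sup>+x. indicator (time_ordered_before 0 t) x \<partial>PiM {} (\<lambda>_. \<mu>))"
    by (simp add: survival_integral_def survival_weight_def)
  also have "\<dots> = (\<integral>\<^sup>+x. 1 \<partial>PiM {} (\<lambda>_::nat. \<mu>))"
    by (intro nn_integral_cong) (simp add: space_PiM time_ordered_before_def time_ordered_def)
  also have "\<dots> = 1" by (simp add: emeasure_PiM_empty space_PiM)
  finally show ?thesis .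
qed

text \<open>Peeling the latest point with \<open>survival_weight_Suc\<close> and
  \<open>nn_integral_time_ordered_Suc\<close> reproduces the same integral one order lower, at the
  time and for the function that occur in the claimed equation.\<close>

lemma survival_integral_Suc:
  assumes W: "W \<in> sets borel" and v: "v \<in> borel_measurable borel" "\<And>x. v x \<in> {0..1}"
  shows "survival_integral W (Suc m) t v = (\<integral>\<^sup>+p. indicator {0..<t} (snd p) *
    (indicator W (fst p) * ennreal (1 - v (fst p)) * survival_integral W m (snd p) (H h v (fst p))) \<partial>\<mu>)"
proof -
  let ?c = "\<lambda>p q. h (fst p) (fst q)"
  let ?F = "\<lambda>x. (\<Prod>k<Suc m. indicator W (fst (x k))) * ennreal (survival_weight ?c (Suc m) (\<lambda>p. v (fst p)) x)"
  have comp: "(\<lambda>x. fst (x k)) \<in> tuple_borel (Suc m) \<rightarrow>\<^sub>M borel" if "k < Suc m" for k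
    by (rule measurable_component_fst[OF that])
  have F: "?F \<in> borel_measurable (tuple_borel (Suc m))"
  proof (intro borel_measurable_times_ennreal measurable_compose[OF _ measurable_ennreal])
    show "(\<lambda>x. \<Prod>k<Suc m. indicator W (fst (x k)) :: ennreal) \<in> borel_measurable (tuple_borel (Suc m))"
      by (intro borel_measurable_prod_ennreal measurable_compose[OF comp] borel_measurable_indicator W) auto
    show "survival_weight ?c (Suc m) (\<lambda>p. v (fst p)) \<in> borel_measurable (tuple_borel (Suc m))"
      by (rule survival_weight_measurable[OF h_meas, where u="\<lambda>_ p. v (fst p)" and x="\<lambda>x. x" and f="\<lambda>x. x"])
        (auto intro: comp measurable_compose[OF comp v(1)])
  qed
  have "survival_integral W (Suc m) t v = (\<integral>\<^sup>+p. indicator {0..<t} (snd p) *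
      (\<integral>\<^sup>+y. ?F (y(m := p)) * indicator (time_ordered_before m (snd p)) y \<partial>tuple_intensity m) \<partial>\<mu>)"
    unfolding survival_integral_def by (rule nn_integral_time_ordered_Suc[OF F])
  also have "\<dots> = (\<integral>\<^sup>+p. indicator {0..<t} (snd p) *
    (indicator W (fst p) * ennreal (1 - v (fst p)) * survival_integral W m (snd p) (H h v (fst p))) \<partial>\<mu>)"
  proof (intro nn_integral_cong arg_cong2[where f=times] refl)
    fix p :: point
    let ?G = "\<lambda>y. (\<Prod>k<m. indicator W (fst (y k))) *
      ennreal (survival_weight ?c m (\<lambda>q. H h v (fst p) (fst q)) y) * indicator (time_ordered_before m (snd p)) y"
    have "?F (y(m := p)) * indicator (time_ordered_before m (snd p)) y =
        (indicator W (fst p) * ennreal (1 - v (fst p))) * ?G y" for y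
    proof -
      have "survival_weight ?c (Suc m) (\<lambda>p. v (fst p)) (y(m := p)) =
          (1 - v (fst p)) * survival_weight ?c m (\<lambda>q. H h v (fst p) (fst q)) (y(m := p))"
        unfolding survival_weight_Suc H_def by simp
      also have "survival_weight ?c m (\<lambda>q. H h v (fst p) (fst q)) (y(m := p)) =
          survival_weight ?c m (\<lambda>q. H h v (fst p) (fst q)) y"
        by (rule survival_weight_cong) auto
      finally have 1: "survival_weight ?c (Suc m) (\<lambda>p. v (fst p)) (y(m := p)) =
          (1 - v (fst p)) * survival_weight ?c m (\<lambda>q. H h v (fst p) (fst q)) y" .
      have 2: "ennreal ((1 - v (fst p)) * survival_weight ?c m (\<lambda>q. H h v (fst p) (fst q)) y) =
          ennreal (1 - v (fst p)) * ennreal (survival_weight ?c m (\<lambda>q. H h v (fst p) (fst q)) y)"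
        using v(2)[of "fst p"] by (intro ennreal_mult') auto
      have 3: "(\<Prod>k<Suc m. indicator W (fst ((y(m := p)) k)) :: ennreal) =
          (\<Prod>k<m. indicator W (fst (y k))) * indicator W (fst p)"
        by simp
      show ?thesis unfolding 1 2 3 by (simp only: ac_simps)
    qed
    then have "(\<integral>\<^sup>+y. ?F (y(m := p)) * indicator (time_ordered_before m (snd p)) y \<partial>tuple_intensity m) =
        (\<integral>\<^sup>+y. (indicator W (fst p) * ennreal (1 - v (fst p))) * ?G y \<partial>tuple_intensity m)"
      by (intro nn_integral_cong)
    also have "\<dots> = (indicator W (fst p) * ennreal (1 - v (fst p))) * (\<integral>\<^sup>+y. ?G y \<partial>tuple_intensity m)"
    proof (rule nn_integral_cmult)
      have "(\<lambda>y. (p, y)) \<in> tuple_borel m \<rightarrow>\<^sub>M borel \<Otimes>\<^sub>M tuple_borel m"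
        by (rule measurable_Pair1') simp
      from measurable_compose[OF this survival_integrand_measurable[OF h_meas v(1) W]]
      show "?G \<in> borel_measurable (tuple_intensity m)"
        by (simp add: measurable_cong_sets[OF sets_PiM_mu refl])
    qed
    finally show "(\<integral>\<^sup>+y. ?F (y(m := p)) * indicator (time_ordered_before m (snd p)) y \<partial>tuple_intensity m) =
        indicator W (fst p) * ennreal (1 - v (fst p)) * survival_integral W m (snd p) (H h v (fst p))"
      by (simp only: survival_integral_def)
  qed
  finally show ?thesis .
qed

lemma H_unit: "(\<And>x. v x \<in> {0..1}) \<Longrightarrow> H h v x y \<in> {0..1}"
  unfolding H_def using h_range[of x y] by (intro unit_mult) auto

lemma H_measurable: "v \<in> borel_measurable borel \<Longrightarrow> H h v x \<in> borel_measurable borel"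
  unfolding H_def
  by (intro borel_measurable_times borel_measurable_diff borel_measurable_const measurable_kernel_pair[OF h_meas]) auto

lemma survival_integral_H_measurable:
  assumes W: "W \<in> sets borel" and v: "v \<in> borel_measurable borel"
  shows "(\<lambda>p. survival_integral W m (snd p) (H h v (fst p))) \<in> borel_measurable borel"
proof -
  interpret S: sigma_finite_measure "tuple_intensity m" by (rule mus.sigma_finite) simp
  have "sets (borel \<Otimes>\<^sub>M tuple_intensity m) = sets (borel \<Otimes>\<^sub>M tuple_borel m)"
    by (intro sets_pair_measure_cong refl sets_PiM_mu)
  from survival_integrand_measurable[OF h_meas v W, of m, folded measurable_cong_sets[OF this refl]]
  show ?thesis
    unfolding survival_integral_def by (rule S.borel_measurable_nn_integral)
qed

lemma emeasure_L_bounded: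
  assumes "bounded W"
  shows "emeasure L W = ennreal (measure L W)"
proof -
  obtain r where "W \<subseteq> cball 0 r" using assms unfolding bounded_iff by (auto simp: subset_iff)
  then have "emeasure L W \<le> emeasure L (cball 0 r)"
    by (intro emeasure_mono) (simp_all add: sets_L[OF lf])
  also have "\<dots> < \<infinity>" by (rule emeasure_cball_finite[OF lf])
  finally show ?thesis by (intro emeasure_eq_ennreal_measure) simp
qed

text \<open>All weights are at most 1, which leaves the measure of the ordered tuples in the window.
  The induction varies t and v because peeling changes both.\<close>

lemma survival_integral_bound:
  assumes W: "W \<in> sets borel" "bounded W" and t: "0 \<le> t"
    and v: "v \<in> borel_measurable borel" "\<And>x. v x \<in> {0..1}"
  shows "survival_integral W m t v \<le> ennreal ((measure L W * t) ^ m / fact m)"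
  using v t
proof (induction m arbitrary: t v)
  case 0
  then show ?case by (simp add: survival_integral_0)
next
  case (Suc m)
  let ?l = "measure L W"
  have LW: "emeasure L W = ennreal ?l" by (rule emeasure_L_bounded[OF W(2)])
  have "survival_integral W (Suc m) t v \<le> (\<integral>\<^sup>+p. indicator {0..<t} (snd p) *
      (indicator W (fst p) * ennreal (?l ^ m / fact m * snd p ^ m)) \<partial>\<mu>)"
    unfolding survival_integral_Suc[OF W(1) Suc.prems(1,2)]
  proof (rule nn_integral_mono)
    fix p :: point
    show "indicator {0..<t} (snd p) * (indicator W (fst p) * ennreal (1 - v (fst p)) *
        survival_integral W m (snd p) (H h v (fst p))) \<le>
      indicator {0..<t} (snd p) * (indicator W (fst p) * ennreal (?l ^ m / fact m * snd p ^ m))"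
    proof (cases "snd p \<in> {0..<t}")
      case True
      have "survival_integral W m (snd p) (H h v (fst p)) \<le> ennreal ((?l * snd p) ^ m / fact m)"
        using True by (intro Suc.IH H_measurable H_unit Suc.prems) auto
      moreover have "ennreal (1 - v (fst p)) \<le> 1"
        using Suc.prems(2)[of "fst p"] by (simp add: ennreal_le_1)
      ultimately have "ennreal (1 - v (fst p)) * survival_integral W m (snd p) (H h v (fst p)) \<le>
          1 * ennreal (?l ^ m / fact m * snd p ^ m)"
        by (intro mult_mono) (auto simp: power_mult_distrib)
      then show ?thesis by (auto simp: mult.assoc intro!: mult_left_mono)
    qed simp
  qed
  also have "\<dots> \<le> (\<integral>\<^sup>+x. indicator W x \<partial>L) * ennreal (?l ^ m / fact m * t ^ Suc m / real (Suc m))"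
    using W(1) by (intro nn_integral_time_slice_bound Suc.prems(3)) auto
  also have "\<dots> = ennreal (?l * (?l ^ m / fact m * t ^ Suc m / real (Suc m)))"
  proof -
    have "(\<integral>\<^sup>+x. indicator W x \<partial>L) = ennreal ?l"
      using W(1) LW by (simp add: sets_L[OF lf])
    then show ?thesis by (simp only: ennreal_mult'[OF measure_nonneg])
  qed
  also have "?l * (?l ^ m / fact m * t ^ Suc m / real (Suc m)) = (?l * t) ^ Suc m / fact (Suc m)"
    by (simp add: power_mult_distrib mult_ac)
  finally show ?case .
qed

text \<open>After the top point x is peeled off, the rest is a chain whose top is localised by
  \<open>h x\<close> in place of \<open>g\<close>. Each link therefore costs a factor
  \<open>M\<close>, and only the top pays the integral of \<open>g\<close>.\<close>

lemma chain_integral_bound: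
  assumes M: "\<And>x. (\<integral>\<^sup>+y. ennreal (h x y) \<partial>L) \<le> ennreal M" "0 \<le> M" and t: "0 \<le> t"
    and g: "g \<in> borel_measurable borel" "\<And>x. g x \<in> {0..1}" "(\<integral>\<^sup>+x. ennreal (g x) \<partial>L) \<le> ennreal K" "0 \<le> K"
  shows "(\<integral>\<^sup>+x. ennreal (chain_weight (Suc m) g x) * indicator (time_ordered_before (Suc m) t) x \<partial>tuple_intensity (Suc m))
    \<le> ennreal (K * M ^ m * t ^ Suc m / fact (Suc m))"
  using g t
proof (induction m arbitrary: t g K)
  case 0
  have cm: "(\<lambda>x. ennreal (chain_weight (Suc 0) g x)) \<in> borel_measurable (tuple_borel (Suc 0))"
    unfolding chain_weight_def using measurable_compose[OF measurable_component_fst[of 0 "Suc 0"] 0(1)] by simp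
  have "(\<integral>\<^sup>+x. ennreal (chain_weight (Suc 0) g x) * indicator (time_ordered_before (Suc 0) t) x \<partial>tuple_intensity (Suc 0)) =
    (\<integral>\<^sup>+p. indicator {0..<t} (snd p) * (\<integral>\<^sup>+y. ennreal (chain_weight (Suc 0) g (y(0 := p))) *
      indicator (time_ordered_before 0 (snd p)) y \<partial>tuple_intensity 0) \<partial>\<mu>)"
    by (rule nn_integral_time_ordered_Suc[OF cm])
  also have "\<dots> = (\<integral>\<^sup>+p. indicator {0..<t} (snd p) * (ennreal (g (fst p)) * ennreal (1 * snd p ^ 0)) \<partial>\<mu>)"
  proof (intro nn_integral_cong arg_cong2[where f=times] refl)
    fix p :: point
    have "(\<integral>\<^sup>+y. ennreal (chain_weight (Suc 0) g (y(0 := p))) * indicator (time_ordered_before 0 (snd p)) y \<partial>tuple_intensity 0) =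
        (\<integral>\<^sup>+y. ennreal (g (fst p)) \<partial>PiM {} (\<lambda>_::nat. \<mu>))"
      unfolding lessThan_0
      by (intro nn_integral_cong)
        (simp add: chain_weight_def space_PiM time_ordered_before_def time_ordered_def)
    also have "\<dots> = ennreal (g (fst p))" by (simp add: emeasure_PiM_empty space_PiM)
    finally show "(\<integral>\<^sup>+y. ennreal (chain_weight (Suc 0) g (y(0 := p))) * indicator (time_ordered_before 0 (snd p)) y \<partial>tuple_intensity 0) =
        ennreal (g (fst p)) * ennreal (1 * snd p ^ 0)" by simp
  qed
  also have "\<dots> \<le> (\<integral>\<^sup>+x. ennreal (g x) \<partial>L) * ennreal (1 * t ^ Suc 0 / real (Suc 0))"
    using 0 by (intro nn_integral_time_slice_bound) auto
  also have "\<dots> \<le> ennreal K * ennreal t"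
    using 0 by (intro mult_mono) auto
  finally show ?case using 0 by (simp add: ennreal_mult)
next
  case (Suc m)
  have hm: "h x \<in> borel_measurable borel" for x
    by (intro measurable_kernel_pair[OF h_meas]) auto
  have meas: "(\<lambda>x. ennreal (chain_weight (Suc m) g x)) \<in> borel_measurable (tuple_borel (Suc m))"
    if "g \<in> borel_measurable borel" for g m
  proof -
    have "(\<lambda>x. if Suc k < Suc m then h (fst (x (Suc k))) (fst (x k)) else 1) \<in> borel_measurable (tuple_borel (Suc m))"
      if "k \<in> {..<Suc m}" for k
    proof (cases "Suc k < Suc m")
      case True
      then have "(\<lambda>x. h (fst (x (Suc k))) (fst (x k))) \<in> borel_measurable (tuple_borel (Suc m))"
        by (intro measurable_kernel_pair[OF h_meas] measurable_component_fst) auto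
      with True show ?thesis by simp
    qed simp
    then show ?thesis
      unfolding chain_weight_def using that
      by (intro measurable_compose[OF _ measurable_ennreal] borel_measurable_times borel_measurable_prod
          measurable_compose[OF measurable_component_fst]) auto
  qed
  have "(\<integral>\<^sup>+x. ennreal (chain_weight (Suc (Suc m)) g x) * indicator (time_ordered_before (Suc (Suc m)) t) x \<partial>tuple_intensity (Suc (Suc m))) =
    (\<integral>\<^sup>+p. indicator {0..<t} (snd p) * (\<integral>\<^sup>+y. ennreal (chain_weight (Suc (Suc m)) g (y(Suc m := p))) *
      indicator (time_ordered_before (Suc m) (snd p)) y \<partial>tuple_intensity (Suc m)) \<partial>\<mu>)"
    by (rule nn_integral_time_ordered_Suc[OF meas[OF Suc.prems(1)]])
  also have "\<dots> = (\<integral>\<^sup>+p. indicator {0..<t} (snd p) * (ennreal (g (fst p)) *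
      (\<integral>\<^sup>+y. ennreal (chain_weight (Suc m) (h (fst p)) y) * indicator (time_ordered_before (Suc m) (snd p)) y
        \<partial>tuple_intensity (Suc m))) \<partial>\<mu>)"
  proof (intro nn_integral_cong arg_cong2[where f=times] refl)
    fix p :: point
    have "chain_weight (Suc (Suc m)) g (y(Suc m := p)) = g (fst p) * chain_weight (Suc m) (h (fst p)) y" for y
    proof -
      have "(\<Prod>k<m. if Suc k < Suc (Suc m) then h (fst ((y(Suc m := p)) (Suc k))) (fst ((y(Suc m := p)) k)) else 1) =
        (\<Prod>k<m. if Suc k < Suc m then h (fst (y (Suc k))) (fst (y k)) else 1)"
        by (intro prod.cong) auto
      then show ?thesis by (simp add: chain_weight_def lessThan_Suc)
    qed
    then have "ennreal (chain_weight (Suc (Suc m)) g (y(Suc m := p))) * indicator (time_ordered_before (Suc m) (snd p)) y =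
        ennreal (g (fst p)) * (ennreal (chain_weight (Suc m) (h (fst p)) y) * indicator (time_ordered_before (Suc m) (snd p)) y)" for y
      using Suc.prems(2)[of "fst p"] by (simp add: ennreal_mult' mult.assoc)
    then show "(\<integral>\<^sup>+y. ennreal (chain_weight (Suc (Suc m)) g (y(Suc m := p))) * indicator (time_ordered_before (Suc m) (snd p)) y \<partial>tuple_intensity (Suc m)) =
      ennreal (g (fst p)) * (\<integral>\<^sup>+y. ennreal (chain_weight (Suc m) (h (fst p)) y) * indicator (time_ordered_before (Suc m) (snd p)) y \<partial>tuple_intensity (Suc m))"
      using meas[OF hm] by (simp only:, intro nn_integral_cmult)
        (simp add: measurable_cong_sets[OF sets_PiM_mu refl])
  qed
  also have "\<dots> \<le> (\<integral>\<^sup>+p. indicator {0..<t} (snd p) * (ennreal (g (fst p)) * ennreal (M ^ Suc m / fact (Suc m) * snd p ^ Suc m)) \<partial>\<mu>)"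
  proof (rule nn_integral_mono)
    fix p :: point
    show "indicator {0..<t} (snd p) * (ennreal (g (fst p)) *
        (\<integral>\<^sup>+y. ennreal (chain_weight (Suc m) (h (fst p)) y) * indicator (time_ordered_before (Suc m) (snd p)) y \<partial>tuple_intensity (Suc m)))
      \<le> indicator {0..<t} (snd p) * (ennreal (g (fst p)) * ennreal (M ^ Suc m / fact (Suc m) * snd p ^ Suc m))"
    proof (cases "snd p \<in> {0..<t}")
      case True
      \<comment> \<open>The induction hypothesis is used with \<open>h (fst p)\<close> for
        \<open>g\<close> and hence with \<open>M\<close> for \<open>K\<close>.\<close>
      have "(\<integral>\<^sup>+y. ennreal (chain_weight (Suc m) (h (fst p)) y) * indicator (time_ordered_before (Suc m) (snd p)) y \<partial>tuple_intensity (Suc m))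
        \<le> ennreal (M * M ^ m * snd p ^ Suc m / fact (Suc m))"
        using True by (intro Suc.IH hm h_range M) auto
      also have "M * M ^ m * snd p ^ Suc m / fact (Suc m) = M ^ Suc m / fact (Suc m) * snd p ^ Suc m" by simp
      finally show ?thesis by (intro mult_left_mono) auto
    qed simp
  qed
  also have "\<dots> \<le> (\<integral>\<^sup>+x. ennreal (g x) \<partial>L) * ennreal (M ^ Suc m / fact (Suc m) * t ^ Suc (Suc m) / real (Suc (Suc m)))"
    using Suc.prems M(2) by (intro nn_integral_time_slice_bound) auto
  also have "\<dots> \<le> ennreal K * ennreal (M ^ Suc m / fact (Suc m) * t ^ Suc (Suc m) / real (Suc (Suc m)))"
    using Suc.prems by (intro mult_right_mono) auto
  also have "\<dots> = ennreal (K * M ^ Suc m * t ^ Suc (Suc m) / fact (Suc (Suc m)))"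
    using Suc.prems M(2) by (simp add: ennreal_mult[symmetric] ac_simps)
  finally show ?case .
qed

end

section \<open>Almost sure properties of the contention graph\<close>

text \<open>The left side is the probability that a Poisson variable of mean a is at least 2; 1 - a
  \<le> exp(- a) suffices.\<close>

lemma poisson_two_or_more_bound:
  assumes "0 \<le> (a::real)"
  shows "1 - exp (- a) - a * exp (- a) \<le> a\<^sup>2"
proof -
  have "(1 - a) * (1 + a) \<le> exp (- a) * (1 + a)"
    using assms exp_ge_add_one_self[of "- a"] by (intro mult_right_mono) auto
  then show ?thesis by (simp add: algebra_simps power2_eq_square)
qed

lemma summable_on_nn_integral_finite:
  fixes f :: "'a \<Rightarrow> real"
  assumes f: "\<And>x. x \<in> A \<Longrightarrow> 0 \<le> f x" and fin: "(\<integral>\<^sup>+x. ennreal (f x) \<partial>count_space A) < \<infinity>"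
  shows "f summable_on A"
proof (rule nonneg_bdd_above_summable_on[OF f])
  let ?I = "\<integral>\<^sup>+x. ennreal (f x) \<partial>count_space A"
  have "sum f F \<le> enn2real ?I" if F: "F \<subseteq> A" "finite F" for F
  proof -
    have "ennreal (sum f F) = (\<Sum>x\<in>F. ennreal (f x))"
      using F f by (subst sum_ennreal) auto
    also have "\<dots> = (\<integral>\<^sup>+x. ennreal (f x) \<partial>count_space F)"
      using F by (simp add: nn_integral_count_space_finite)
    also have "\<dots> = (\<integral>\<^sup>+x. ennreal (f x) * indicator {x. x \<in> F} x \<partial>count_space A)"
    proof -
      have "F = {x \<in> A. x \<in> F}" using F(1) by blast
      then show ?thesis
        using nn_integral_count_space_Collect[where f="\<lambda>x. ennreal (f x)" and A=A and Q="\<lambda>x. x \<in> F"] by simp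
    qed
    also have "\<dots> \<le> ?I"
      by (intro nn_integral_mono) (simp split: split_indicator)
    finally have "enn2real (ennreal (sum f F)) \<le> enn2real ?I"
      using fin by (intro enn2real_mono) auto
    moreover have "0 \<le> sum f F" using F(1) f by (intro sum_nonneg) auto
    ultimately show ?thesis by simp
  qed
  then show "bdd_above (sum f ` {F. F \<subseteq> A \<and> finite F})"
    by (auto simp: bdd_above_def)
qed

text \<open>The product over retained points is controlled only off a null set, where it agrees with
  a limit of measurable functions; the completion makes that enough.\<close>

lemma completion_measurable_AE_eq:
  fixes f g :: "'a \<Rightarrow> real"
  assumes g: "g \<in> borel_measurable M" and eq: "AE x in M. f x = g x"
  shows "f \<in> borel_measurable (completion M)"
proof (rule measurableI)
  fix B :: "real set" assume B: "B \<in> sets borel"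
  have "AE x in completion M. x \<in> g -` B \<inter> space M \<longleftrightarrow> x \<in> f -` B \<inter> space M"
    using AE_completion[OF eq] by eventually_elim auto
  moreover have "g -` B \<inter> space M \<in> sets (completion M)"
    using measurable_sets[OF g B] by auto
  ultimately have "f -` B \<inter> space M \<in> sets (completion M)"
    by (rule completion.in_sets_AE) auto
  then show "f -` B \<inter> space (completion M) \<in> sets (completion M)" by simp
qed auto

locale matern_setting = marked_points P L \<Phi> I \<xi> h C
  for P :: "'w measure" and L :: "(real^2) measure" and \<Phi> :: "'w \<Rightarrow> point set"
    and I :: "'w \<Rightarrow> nat set" and \<xi> :: "nat \<Rightarrow> 'w \<Rightarrow> point"
    and h :: "real^2 \<Rightarrow> real^2 \<Rightarrow> real" and C :: "'w \<Rightarrow> point \<Rightarrow> point \<Rightarrow> bool" +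
  fixes M :: real
  assumes M: "\<And>x. (\<integral>\<^sup>+y. ennreal (h x y) \<partial>L) \<le> ennreal M" and M0: "0 \<le> M"
begin

text \<open>Two points with the same timer fall into the same slot of every subdivision of [0,t)
  into n equal slots. Some slot contains two points with probability at most n (l t / n)^2 = (l t)^2
  / n, where l is the measure of \<open>W\<close>, and this tends to 0.\<close>

lemma AE_distinct_timers_window:
  assumes W: "W \<in> sets borel" "bounded W" and t: "0 < t"
  shows "AE \<omega> in P. inj_on snd (window_points W t \<omega>)"
proof -
  let ?l = "measure L W"
  define B where "B n j = W \<times> {real j * t / real n..<real (Suc j) * t / real n}" for n j :: nat
  have Bs: "B n j \<in> sets borel" for n j
    unfolding B_def borel_prod[symmetric] using W(1) by (intro pair_measureI) auto
  have Bb: "bounded (B n j)" for n j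
    unfolding B_def using W(2)
    by (intro bounded_Times bounded_subset[OF bounded_cbox[of "real j * t / real n" "real (Suc j) * t / real n"]]) auto
  have Bp: "B n j \<subseteq> UNIV \<times> {0..}" for n j
  proof -
    have "0 \<le> real j * t / real n" using t by simp
    then show ?thesis unfolding B_def by (auto intro: order_trans)
  qed
  have Bm: "measure \<mu> (B n j) = ?l * t / real n" if "0 < n" for n j
  proof -
    have "emeasure \<mu> (B n j) = emeasure L W * emeasure lborel {real j * t / real n..<real (Suc j) * t / real n}"
      unfolding product_intensity_def B_def using W(1)
      by (intro lborel.emeasure_pair_measure_Times) (auto simp: sets_L[OF lf])
    also have "\<dots> = ennreal ?l * ennreal (t / real n)"
      using t that emeasure_L_bounded[OF W(2)]
      by (simp add: divide_right_mono mult_right_mono diff_divide_distrib[symmetric] left_diff_distrib[symmetric])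
    also have "\<dots> = ennreal (?l * t / real n)"
      using t by (simp add: ennreal_mult'[symmetric])
    finally show ?thesis using t by (simp add: measure_def)
  qed
  \<comment> \<open>The measurable event that some slot of the n-th subdivision is hit twice; the
    intersection over all n contains the outcomes to be excluded.\<close>
  define N where "N n = (\<Union>j<n. {\<omega> \<in> space P. 2 \<le> card (\<Phi> \<omega> \<inter> B n j)})" for n
  have cm: "(\<lambda>\<omega>. card (\<Phi> \<omega> \<inter> B n j)) \<in> P \<rightarrow>\<^sub>M count_space UNIV" for n j
    by (rule count_measurable[OF Bs Bb Bp])
  have Nj: "{\<omega> \<in> space P. Q (card (\<Phi> \<omega> \<inter> B n j))} \<in> sets P" for n j Q
    using measurable_sets[OF cm[of n j], of "{k. Q k}"] by (simp add: vimage_def Int_def conj_commute)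
  have Ns: "N n \<in> sets P" for n unfolding N_def using Nj by auto
  have PN: "prob (N n) \<le> (?l * t)\<^sup>2 / real n" if n: "0 < n" for n
  proof -
    let ?a = "?l * t / real n"
    have a: "0 \<le> ?a" using t by simp
    have "prob {\<omega> \<in> space P. 2 \<le> card (\<Phi> \<omega> \<inter> B n j)} \<le> ?a\<^sup>2" for j
    proof -
      let ?X = "\<lambda>\<omega>. card (\<Phi> \<omega> \<inter> B n j)"
      have "prob {\<omega> \<in> space P. ?X \<omega> < 2} = prob ({\<omega> \<in> space P. ?X \<omega> = 0} \<union> {\<omega> \<in> space P. ?X \<omega> = 1})"
        by (intro arg_cong[where f=prob]) auto
      also have "\<dots> = prob {\<omega> \<in> space P. ?X \<omega> = 0} + prob {\<omega> \<in> space P. ?X \<omega> = 1}"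
        using Nj[of "\<lambda>k. k = 0"] Nj[of "\<lambda>k. k = 1"] by (intro finite_measure_Union) auto
      also have "\<dots> = exp (- ?a) + ?a * exp (- ?a)"
        unfolding count_distribution[OF Bs Bb Bp] Bm[OF n] by simp
      finally have "prob {\<omega> \<in> space P. ?X \<omega> < 2} = exp (- ?a) + ?a * exp (- ?a)" .
      moreover have "prob {\<omega> \<in> space P. 2 \<le> ?X \<omega>} = 1 - prob {\<omega> \<in> space P. ?X \<omega> < 2}"
        using prob_neg[of "\<lambda>\<omega>. ?X \<omega> < 2"] Nj[of "\<lambda>k. k < 2"] by (simp add: not_less)
      ultimately show ?thesis using poisson_two_or_more_bound[OF a] by simp
    qed
    then have "prob (N n) \<le> (\<Sum>j<n. ?a\<^sup>2)"
      unfolding N_def using Nj by (intro order_trans[OF finite_measure_subadditive_finite] sum_mono) auto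
    also have "\<dots> = (?l * t)\<^sup>2 / real n"
      using n by (simp add: power2_eq_square)
    finally show ?thesis .
  qed
  have "prob (\<Inter>n\<in>{0<..}. N n) = 0"
  proof (rule ccontr)
    let ?p = "prob (\<Inter>n\<in>{0<..}. N n)"
    assume "?p \<noteq> 0"
    then have p: "0 < ?p" by (simp add: zero_less_measure_iff)
    obtain n where n: "(?l * t)\<^sup>2 / ?p < real n" using reals_Archimedean2 by blast
    have "0 < real n" by (rule order_le_less_trans[OF _ n]) simp
    then have n0: "0 < n" by simp
    have "?p \<le> prob (N n)" using n0 Ns by (intro finite_measure_mono) auto
    also have "\<dots> \<le> (?l * t)\<^sup>2 / real n" by (rule PN[OF n0])
    finally show False using n p n0 by (simp add: field_simps)
  qed
  moreover have Ni: "(\<Inter>n\<in>{0<..}. N n) \<in> sets P"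
    using Ns by (intro sets.countable_INT') auto
  ultimately have null: "(\<Inter>n\<in>{0<..}. N n) \<in> null_sets P"
    by (simp add: null_sets_def emeasure_eq_measure)
  show ?thesis
  proof (rule AE_I'[OF null], rule subsetI)
    fix \<omega> assume "\<omega> \<in> {\<omega> \<in> space P. \<not> inj_on snd (window_points W t \<omega>)}"
    then have \<omega>: "\<omega> \<in> space P" and "\<not> inj_on snd (window_points W t \<omega>)" by auto
    then obtain p q where pq: "p \<in> window_points W t \<omega>" "q \<in> window_points W t \<omega>" "snd p = snd q" "p \<noteq> q"
      unfolding inj_on_def by blast
    have s: "0 \<le> snd p" "snd p < t"
      using pq(1) timer_nonneg[OF \<omega>, of p] by (auto simp: window_points_def)
    show "\<omega> \<in> (\<Inter>n\<in>{0<..}. N n)"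
    proof
      fix n :: nat assume "n \<in> {0<..}"
      then have n: "0 < real n" by simp
      \<comment> \<open>The number of the slot of length t / n that contains the common
        timer.\<close>
      define j where "j = nat \<lfloor>snd p * real n / t\<rfloor>"
      have nonneg: "0 \<le> snd p * real n / t" using s t by simp
      then have j1: "real j \<le> snd p * real n / t" and j2: "snd p * real n / t < real j + 1"
        unfolding j_def by (simp_all add: of_nat_nat)
      have "snd p * real n / t < real n" using s t n by (simp add: field_simps)
      with j1 have jn: "j < n" by linarith
      have lo: "real j * t / real n \<le> snd p" using j1 t n by (simp add: field_simps)
      have hi: "snd p < real (Suc j) * t / real n" using j2 t n by (simp add: field_simps)
      have "{p, q} \<subseteq> \<Phi> \<omega> \<inter> B n j"
        using pq lo hi by (auto simp: B_def window_points_def mem_Times_iff)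
      then have "card {p, q} \<le> card (\<Phi> \<omega> \<inter> B n j)"
        by (intro card_mono finite_points[OF \<omega> Bb])
      then have "2 \<le> card (\<Phi> \<omega> \<inter> B n j)" using pq(4) by simp
      then show "\<omega> \<in> N n" unfolding N_def using \<omega> jn by auto
    qed
  qed
qed

section \<open>Almost sure finiteness of descending chains\<close>

definition points_before :: "real \<Rightarrow> 'w \<Rightarrow> point set" where
  "points_before t \<omega> = \<Phi> \<omega> \<inter> UNIV \<times> {..<t}"

lemma thin_eq_points_before:
  assumes "\<omega> \<in> space P"
  shows "thin {0..<t} (\<Phi> \<omega>) = points_before t \<omega>"
proof (rule set_eqI)
  fix p
  have "p \<in> \<Phi> \<omega> \<Longrightarrow> 0 \<le> snd p" by (rule timer_nonneg[OF assms])
  then show "p \<in> thin {0..<t} (\<Phi> \<omega>) \<longleftrightarrow> p \<in> points_before t \<omega>"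
    unfolding thin_def points_before_def Int_iff mem_Collect_eq mem_Times_iff by (simp, blast)
qed

text \<open>Here m counts links, so the chains have \<open>Suc m\<close> points and their top is
  \<open>x m\<close>. The term m = 0 is a sum over single points.\<close>

definition chain_sum :: "(real^2 \<Rightarrow> real) \<Rightarrow> real \<Rightarrow> nat \<Rightarrow> 'w \<Rightarrow> ennreal" where
  "chain_sum g t m \<omega> = (\<integral>\<^sup>+x. ennreal (g (fst (x m))) \<partial>count_space (chains (Suc m) t \<omega>))"

text \<open>The expected total is at most K t exp(M t), where K is the integral of \<open>g\<close>.
  Finiteness of the sum over all lengths serves three purposes: m = 0 gives summability over points,
  m = 1 finite branching, and all m together well-foundedness.\<close>

lemma AE_chain_sum_finite:
  assumes t: "0 \<le> t"
    and g: "g \<in> borel_measurable borel" "\<And>x. g x \<in> {0..1}" "(\<integral>\<^sup>+x. ennreal (g x) \<partial>L) < \<infinity>"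
  shows "AE \<omega> in P. (\<Sum>m. chain_sum g t m \<omega>) < \<infinity>"
proof -
  define K where "K = enn2real (\<integral>\<^sup>+x. ennreal (g x) \<partial>L)"
  have K: "(\<integral>\<^sup>+x. ennreal (g x) \<partial>L) \<le> ennreal K" "0 \<le> K"
    using g(3) by (simp_all add: K_def)
  have meas: "chain_sum g t m \<in> borel_measurable P" for m
    using chain_mean(1)[of "Suc m" g t, OF _ g(1,2)] by (simp add: chain_sum_def[abs_def])
  have bound: "(\<integral>\<^sup>+\<omega>. chain_sum g t m \<omega> \<partial>P) \<le> ennreal (K * t * ((M * t) ^ m / fact m))" for m
  proof -
    have "(\<integral>\<^sup>+\<omega>. chain_sum g t m \<omega> \<partial>P) =
        (\<integral>\<^sup>+x. ennreal (chain_weight (Suc m) g x) * indicator (time_ordered_before (Suc m) t) x \<partial>tuple_intensity (Suc m))"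
      using chain_mean(2)[of "Suc m" g t, OF _ g(1,2)] by (simp add: chain_sum_def[abs_def])
    also have "\<dots> \<le> ennreal (K * M ^ m * t ^ Suc m / fact (Suc m))"
      by (rule chain_integral_bound[OF M M0 t g(1,2) K])
    \<comment> \<open>The factorial is weakened from m + 1 to m so that the bounds form an
      exponential series.\<close>
    also have "\<dots> \<le> ennreal (K * t * ((M * t) ^ m / fact m))"
    proof (rule ennreal_leI)
      have "K * M ^ m * t ^ Suc m / fact (Suc m) = (K * t * (M * t) ^ m) / fact (Suc m)"
        by (simp add: power_mult_distrib mult_ac)
      also have "\<dots> \<le> (K * t * (M * t) ^ m) / fact m"
        using K(2) M0 t by (intro divide_left_mono fact_mono) auto
      finally show "K * M ^ m * t ^ Suc m / fact (Suc m) \<le> K * t * ((M * t) ^ m / fact m)" by simp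
    qed
    finally show ?thesis .
  qed
  have "(\<integral>\<^sup>+\<omega>. (\<Sum>m. chain_sum g t m \<omega>) \<partial>P) = (\<Sum>m. \<integral>\<^sup>+\<omega>. chain_sum g t m \<omega> \<partial>P)"
    by (rule nn_integral_suminf[OF meas])
  also have "\<dots> \<le> (\<Sum>m. ennreal (K * t * ((M * t) ^ m / fact m)))"
    by (intro suminf_le bound) auto
  also have "\<dots> < \<infinity>"
  proof -
    have "summable (\<lambda>m. (M * t) ^ m / fact m)"
      using summable_exp_generic[of "M * t"] by (simp add: divide_inverse_commute)
    then have "summable (\<lambda>m. K * t * ((M * t) ^ m / fact m))"
      by (rule summable_mult)
    then show ?thesis using K(2) M0 t by (subst suminf_ennreal2) auto
  qed
  finally have "(\<integral>\<^sup>+\<omega>. (\<Sum>m. chain_sum g t m \<omega>) \<partial>P) < \<infinity>" .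
  then have "(\<integral>\<^sup>+\<omega>. (\<Sum>m. chain_sum g t m \<omega>) \<partial>P) \<noteq> \<infinity>" by simp
  then have "AE \<omega> in P. (\<Sum>m. chain_sum g t m \<omega>) \<noteq> \<infinity>"
    by (rule nn_integral_PInf_AE[OF borel_measurable_suminf_order[OF meas]])
  then show ?thesis by eventually_elim (simp add: less_top)
qed

lemma nn_integral_ge_infinite_set:
  assumes "infinite B" "B \<subseteq> A" "\<And>x. x \<in> B \<Longrightarrow> 1 \<le> f x"
  shows "(\<integral>\<^sup>+x. f x \<partial>count_space A) = \<infinity>"
proof -
  have "\<infinity> = (\<integral>\<^sup>+x. indicator B x \<partial>count_space A)"
    using assms by (subst nn_integral_indicator) (auto simp: emeasure_count_space_infinite)
  also have "\<dots> \<le> (\<integral>\<^sup>+x. f x \<partial>count_space A)"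
    using assms(3) by (intro nn_integral_mono) (auto split: split_indicator)
  finally show ?thesis by (simp add: top_unique)
qed

text \<open>Infinitely many earlier neighbours of \<open>p\<close> would give infinitely many
  two-point chains with top \<open>p\<close>, all counted with weight 1 for a ball containing
  \<open>p\<close>.\<close>

lemma finite_branching:
  assumes fin: "\<And>n. (\<Sum>m. chain_sum (indicator (cball 0 (real n))) t m \<omega>) < \<infinity>"
    and p: "p \<in> points_before t \<omega>"
  shows "finite {q. (q, p) \<in> earlier_nbr (points_before t \<omega>) (C \<omega>)}" (is "finite ?Q")
proof (rule ccontr)
  assume inf: "infinite ?Q"
  obtain n where n: "norm (fst p) \<le> real n" using real_arch_simple by blast
  let ?x = "\<lambda>q. (\<lambda>k\<in>{..<2}. if k = 0 then q else p) :: nat \<Rightarrow> point"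
  let ?g = "indicator (cball 0 (real n)) :: real^2 \<Rightarrow> real"
  have x: "?x q \<in> chains (Suc 1) t \<omega>" if "q \<in> ?Q" for q
  proof -
    have q: "q \<in> points_before t \<omega>" "snd q < snd p" "C \<omega> p q"
      using that by (auto simp: earlier_nbr_def)
    have "?x q \<in> ordered_tuples (Suc 1) (points_before t \<omega>)"
      using q p unfolding ordered_tuples_def by (auto simp: less_Suc_eq numeral_2_eq_2)
    moreover have "C \<omega> (?x q (Suc k)) (?x q k)" if "Suc k < Suc 1" for k
      using that q(3) by simp
    ultimately show ?thesis by (simp add: chains_def points_before_def)
  qed
  have "inj_on ?x ?Q"
  proof (rule inj_onI)
    fix q r assume "?x q = ?x r"
    from fun_cong[OF this, of 0] show "q = r" by simp
  qed
  then have "infinite (?x ` ?Q)" using inf by (simp add: finite_image_iff)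
  then have "chain_sum ?g t 1 \<omega> = \<infinity>"
    unfolding chain_sum_def
  proof (rule nn_integral_ge_infinite_set)
    show "?x ` ?Q \<subseteq> chains (Suc 1) t \<omega>" using x by blast
    show "1 \<le> ennreal (?g (fst (y 1)))" if "y \<in> ?x ` ?Q" for y
      using that n by auto
  qed
  moreover have "chain_sum ?g t 1 \<omega> \<le> (\<Sum>m. chain_sum ?g t m \<omega>)"
    using sum_le_suminf[of "\<lambda>m. chain_sum ?g t m \<omega>" "{1}"] by simp
  ultimately show False using fin[of n] by (simp add: top_unique)
qed

text \<open>An infinite descent from one point contains a chain of every length with that point as
  top. For a ball around the origin containing it, every term of the series would be at least
  1.\<close>

lemma wf_earlier_nbr:
  assumes fin: "\<And>n. (\<Sum>m. chain_sum (indicator (cball 0 (real n))) t m \<omega>) < \<infinity>"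
  shows "wf (earlier_nbr (points_before t \<omega>) (C \<omega>))"
  unfolding wf_iff_no_infinite_down_chain
proof
  let ?R = "earlier_nbr (points_before t \<omega>) (C \<omega>)"
  assume "\<exists>f. \<forall>i. (f (Suc i), f i) \<in> ?R"
  then obtain f where f: "\<And>i. (f (Suc i), f i) \<in> ?R" by blast
  obtain n where n: "norm (fst (f 0)) \<le> real n" using real_arch_simple by blast
  let ?g = "indicator (cball 0 (real n)) :: real^2 \<Rightarrow> real"
  have fin_f: "f i \<in> points_before t \<omega>" and f_less: "snd (f (Suc i)) < snd (f i)"
    and f_C: "C \<omega> (f i) (f (Suc i))" for i
    using f[of i] by (auto simp: earlier_nbr_def)
  have f_anti: "snd (f j) < snd (f i)" if "i < j" for i j
    using lift_Suc_mono_less[of "\<lambda>i. - snd (f i)" i j] f_less that by simp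
  have "1 \<le> chain_sum ?g t m \<omega>" for m
  proof -
    \<comment> \<open>The first m + 1 points of the descent in reverse, since tuples run forward in
      time; the top \<open>f 0\<close> lands at place m.\<close>
    let ?x = "\<lambda>k\<in>{..<Suc m}. f (m - k)"
    have x: "?x \<in> chains (Suc m) t \<omega>"
    proof -
      have "?x \<in> ordered_tuples (Suc m) (points_before t \<omega>)"
        using fin_f f_anti by (auto simp: ordered_tuples_def)
      moreover have "C \<omega> (?x (Suc k)) (?x k)" if "Suc k < Suc m" for k
      proof -
        have "m - k = Suc (m - Suc k)" using that by simp
        then show ?thesis using f_C[of "m - Suc k"] that by simp
      qed
      ultimately show ?thesis by (simp add: chains_def points_before_def)
    qed
    have "1 = (\<integral>\<^sup>+x. indicator {?x} x \<partial>count_space (chains (Suc m) t \<omega>))"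
      using x by (subst nn_integral_indicator) auto
    also have "\<dots> \<le> chain_sum ?g t m \<omega>"
      unfolding chain_sum_def using n by (intro nn_integral_mono) (auto split: split_indicator)
    finally show ?thesis .
  qed
  then have "(\<Sum>m::nat. 1 :: ennreal) \<le> (\<Sum>m. chain_sum ?g t m \<omega>)"
    by (intro suminf_le) auto
  moreover have "(\<Sum>m::nat. 1 :: ennreal) = \<infinity>"
    using nn_integral_count_space_nat[of "\<lambda>_. 1"] by simp
  ultimately show False using fin[of n] by (simp add: top_unique)
qed

text \<open>One-point chains are just the points, so the term m = 0 already dominates the sum. Its
  intended use is 1 - v for \<open>g\<close>.\<close>

lemma summable_points:
  assumes g: "\<And>x. g x \<in> {0..1}" and fin: "(\<Sum>m. chain_sum g t m \<omega>) < \<infinity>"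
  shows "(\<lambda>p. g (fst p)) summable_on points_before t \<omega>"
proof (rule summable_on_nn_integral_finite)
  show "0 \<le> g (fst p)" for p :: point using g[of "fst p"] by simp
  have bij: "bij_betw (\<lambda>p. \<lambda>k\<in>{..<Suc 0}. p) (points_before t \<omega>) (chains (Suc 0) t \<omega>)"
  proof (rule bij_betwI[where g="\<lambda>x. x 0"])
    show "(\<lambda>p. \<lambda>k\<in>{..<Suc 0}. p) \<in> points_before t \<omega> \<rightarrow> chains (Suc 0) t \<omega>"
      by (auto simp: chains_def ordered_tuples_def points_before_def)
    show "(\<lambda>x. x 0) \<in> chains (Suc 0) t \<omega> \<rightarrow> points_before t \<omega>"
      by (auto simp: chains_def ordered_tuples_def points_before_def PiE_def Pi_def)
    show "(\<lambda>k\<in>{..<Suc 0}. x 0) = x" if "x \<in> chains (Suc 0) t \<omega>" for x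
      using that by (auto simp: chains_def ordered_tuples_def PiE_def extensional_def fun_eq_iff)
  qed simp
  have "(\<integral>\<^sup>+p. ennreal (g (fst p)) \<partial>count_space (points_before t \<omega>)) = chain_sum g t 0 \<omega>"
    unfolding chain_sum_def using nn_integral_bij_count_space[OF bij, of "\<lambda>x. ennreal (g (fst (x 0)))"] by simp
  also have "\<dots> \<le> (\<Sum>m. chain_sum g t m \<omega>)"
    using sum_le_suminf[of "\<lambda>m. chain_sum g t m \<omega>" "{0}"] by simp
  finally show "(\<integral>\<^sup>+p. ennreal (g (fst p)) \<partial>count_space (points_before t \<omega>)) < \<infinity>"
    using fin by simp
qed

end

section \<open>The generating functional as a limit over windows\<close>

context matern_setting
begin

lemma AE_distinct_timers:
  assumes t: "0 \<le> t"
  shows "AE \<omega> in P. inj_on snd (points_before t \<omega>)"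
proof (cases "t = 0")
  case True
  have "points_before t \<omega> = {}" if "\<omega> \<in> space P" for \<omega>
    using thin_eq_points_before[OF that, of t] True by (auto simp: thin_def)
  then show ?thesis by (intro AE_I2) simp
next
  case False
  then have "AE \<omega> in P. \<forall>n. inj_on snd (window_points (cball 0 (real n)) t \<omega>)"
    using t by (subst AE_all_countable) (intro allI AE_distinct_timers_window, auto)
  then show ?thesis
  proof eventually_elim
    case (elim \<omega>)
    show ?case
    proof (rule inj_onI)
      fix p q assume pq: "p \<in> points_before t \<omega>" "q \<in> points_before t \<omega>" "snd p = snd q"
      obtain n where n: "max (norm (fst p)) (norm (fst q)) \<le> real n" using real_arch_simple by blast
      then have "p \<in> window_points (cball 0 (real n)) t \<omega>" "q \<in> window_points (cball 0 (real n)) t \<omega>"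
        using pq by (simp_all add: points_before_def window_points_def mem_Times_iff)
      with elim pq(3) show "p = q" by (auto dest: inj_onD)
    qed
  qed
qed

lemma of_bool_unit: "of_bool b \<in> {0..1 :: real}"
  by simp

lemma survival_sum_eq:
  assumes \<omega>: "\<omega> \<in> space P" and W: "bounded W" and v: "\<And>x. v x \<in> {0..1}"
  shows "enn2real (survival_sum W t v m \<omega>) =
    (\<Sum>x\<in>ordered_tuples m (window_points W t \<omega>). survival_weight (\<lambda>p q. of_bool (C \<omega> p q)) m (\<lambda>p. v (fst p)) x)"
    and "survival_sum W t v m \<omega> < \<infinity>"
proof -
  let ?w = "\<lambda>x. survival_weight (\<lambda>p q. of_bool (C \<omega> p q)) m (\<lambda>p. v (fst p)) x"
  have fin: "finite (ordered_tuples m (window_points W t \<omega>))"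
    by (intro finite_ordered_tuples finite_window_points \<omega> W)
  have "?w x \<in> {0..1}" for x by (intro survival_weight_unit of_bool_unit v)
  then have w0: "0 \<le> ?w x" for x by simp
  have "survival_sum W t v m \<omega> = ennreal (\<Sum>x\<in>ordered_tuples m (window_points W t \<omega>). ?w x)"
    unfolding survival_sum_def nn_integral_count_space_finite[OF fin] by (rule sum_ennreal) (rule w0)
  moreover have "0 \<le> (\<Sum>x\<in>ordered_tuples m (window_points W t \<omega>). ?w x)"
    by (intro sum_nonneg w0)
  ultimately show "enn2real (survival_sum W t v m \<omega>) = (\<Sum>x\<in>ordered_tuples m (window_points W t \<omega>). ?w x)"
    and "survival_sum W t v m \<omega> < \<infinity>" by simp_all
qed

lemma survival_sum_vanish:
  assumes \<omega>: "\<omega> \<in> space P" and W: "bounded W" and m: "card (window_points W t \<omega>) < m"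
  shows "survival_sum W t v m \<omega> = 0"
  unfolding survival_sum_def ordered_tuples_empty[OF finite_window_points[OF \<omega> W] m]
  by (simp add: nn_integral_empty)

text \<open>For each outcome only finitely many terms are nonzero, but their number is random.
  Writing an infinite series makes integration term by term possible.\<close>

definition window_series :: "nat \<Rightarrow> real \<Rightarrow> (real^2 \<Rightarrow> real) \<Rightarrow> 'w \<Rightarrow> real" where
  "window_series n t v \<omega> = (\<Sum>m. (-1)^m * enn2real (survival_sum (cball 0 (real n)) t v m \<omega>))"

definition window_functional :: "nat \<Rightarrow> real \<Rightarrow> (real^2 \<Rightarrow> real) \<Rightarrow> real" where
  "window_functional n t v = (\<Sum>m. (-1)^m * enn2real (survival_integral (cball 0 (real n)) m t v))"

lemma window_series_eq:
  assumes \<omega>: "\<omega> \<in> space P" and v: "\<And>x. v x \<in> {0..1}"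
    and inj: "inj_on snd (window_points (cball 0 (real n)) t \<omega>)"
  shows "window_series n t v \<omega> = (\<Prod>p\<in>matern_infinity (window_points (cball 0 (real n)) t \<omega>) (C \<omega>). v (fst p))"
proof -
  let ?W = "cball (0 :: real^2) (real n)" and ?S = "window_points (cball 0 (real n)) t \<omega>"
  have "window_series n t v \<omega> = (\<Sum>m\<le>card ?S. (-1)^m * enn2real (survival_sum ?W t v m \<omega>))"
    unfolding window_series_def
  proof (rule suminf_finite)
    fix m assume "m \<notin> {..card ?S}"
    then show "(-1)^m * enn2real (survival_sum ?W t v m \<omega>) = 0"
      using survival_sum_vanish[OF \<omega> bounded_cball, of 0 "real n" t m v] by simp
  qed simp
  also have "\<dots> = (\<Prod>p\<in>matern_infinity ?S (C \<omega>). v (fst p))"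
    unfolding survival_sum_eq(1)[OF \<omega> bounded_cball v]
    by (rule matern_inclusion_exclusion[symmetric, OF finite_window_points[OF \<omega> bounded_cball] inj])
  finally show ?thesis .
qed

lemma survival_integral_cball_bound:
  assumes t: "0 \<le> t" and v: "v \<in> borel_measurable borel" "\<And>x. v x \<in> {0..1}"
  shows "enn2real (survival_integral (cball 0 (real n)) m t v) \<le> (measure L (cball 0 (real n)) * t) ^ m / fact m"
    and "survival_integral (cball 0 (real n)) m t v < \<infinity>"
proof -
  have b: "survival_integral (cball 0 (real n)) m t v \<le> ennreal ((measure L (cball 0 (real n)) * t) ^ m / fact m)"
    by (intro survival_integral_bound t v) auto
  then show "survival_integral (cball 0 (real n)) m t v < \<infinity>"
    by (rule order_le_less_trans) simp
  have "0 \<le> (measure L (cball 0 (real n)) * t) ^ m / fact m" using t by simp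
  then show "enn2real (survival_integral (cball 0 (real n)) m t v) \<le> (measure L (cball 0 (real n)) * t) ^ m / fact m"
    by (rule enn2real_leI) (rule b)
qed

lemma summable_exp_series: "summable (\<lambda>m. (a :: real) ^ m / fact m)"
  using summable_exp_generic[of a] by (simp add: divide_inverse_commute)

text \<open>Sum and expectation may be exchanged because the means of the unsigned terms are
  dominated by the exponential series of l t, with l the measure of the ball.\<close>

lemma window_series_integral:
  assumes t: "0 \<le> t" and v: "v \<in> borel_measurable borel" "\<And>x. v x \<in> {0..1}"
  shows "window_series n t v \<in> borel_measurable P"
    and "(\<integral>\<omega>. window_series n t v \<omega> \<partial>P) = window_functional n t v"
proof -
  let ?W = "cball (0 :: real^2) (real n)"
  let ?S = "\<lambda>m \<omega>. enn2real (survival_sum ?W t v m \<omega>)"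
  have Wb: "?W \<in> sets borel" by simp
  have Sm: "survival_sum ?W t v m \<in> borel_measurable P" for m
    by (rule survival_sum_mean(1)[OF Wb v])
  have Sm': "?S m \<in> borel_measurable P" for m using Sm by simp
  then show "window_series n t v \<in> borel_measurable P"
    unfolding window_series_def[abs_def]
    by (intro borel_measurable_suminf borel_measurable_times borel_measurable_const)
  have nn: "(\<integral>\<^sup>+\<omega>. ennreal (?S m \<omega>) \<partial>P) = survival_integral ?W m t v" for m
  proof -
    have "(\<integral>\<^sup>+\<omega>. ennreal (?S m \<omega>) \<partial>P) = (\<integral>\<^sup>+\<omega>. survival_sum ?W t v m \<omega> \<partial>P)"
      using survival_sum_eq(2)[OF _ bounded_cball v(2)] by (intro nn_integral_cong ennreal_enn2real) auto
    also have "\<dots> = survival_integral ?W m t v" by (rule survival_sum_mean(2)[OF Wb v])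
    finally show ?thesis .
  qed
  have int: "integrable P (?S m)" for m
    using Sm' survival_integral_cball_bound(2)[OF t v, of n m]
    by (intro integrableI_nonneg) (simp_all add: nn)
  have intS: "(\<integral>\<omega>. ?S m \<omega> \<partial>P) = enn2real (survival_integral ?W m t v)" for m
    using Sm' by (subst integral_eq_nn_integral) (simp_all add: nn)
  have int': "integrable P (\<lambda>\<omega>. (-1)^m * ?S m \<omega>)" for m
    using int by simp
  have norm: "norm ((-1)^m * ?S m \<omega>) = ?S m \<omega>" for m \<omega>
    by (simp add: abs_mult power_abs)
  have "(\<integral>\<omega>. (\<Sum>m. (-1)^m * ?S m \<omega>) \<partial>P) = (\<Sum>m. \<integral>\<omega>. (-1)^m * ?S m \<omega> \<partial>P)"
  proof (rule integral_suminf[OF int'])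
    show "AE \<omega> in P. summable (\<lambda>m. norm ((-1)^m * ?S m \<omega>))"
    proof (rule AE_I2)
      fix \<omega> assume \<omega>: "\<omega> \<in> space P"
      show "summable (\<lambda>m. norm ((-1)^m * ?S m \<omega>))"
        unfolding norm
        by (rule summable_finite[of "{..card (window_points ?W t \<omega>)}"])
          (use survival_sum_vanish[OF \<omega> bounded_cball, of 0 "real n" t _ v] in auto)
    qed
    show "summable (\<lambda>m. \<integral>\<omega>. norm ((-1)^m * ?S m \<omega>) \<partial>P)"
      unfolding norm intS
      by (rule summable_comparison_test'[OF summable_exp_series[of "measure L ?W * t"], where N=0])
        (use survival_integral_cball_bound(1)[OF t v] in simp)
  qed
  then show "(\<integral>\<omega>. window_series n t v \<omega> \<partial>P) = window_functional n t v"
    unfolding window_series_def window_functional_def using int by (simp add: intS)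
qed

text \<open>Off one null set all pathwise conditions hold together: distinct timers identify the
  series with a finite product, finite chain sums for the countably many balls give well-foundedness
  and finite branching, and the chain sum of 1 - v gives summability.\<close>

lemma AE_window_series_limit:
  assumes t: "0 \<le> t" and v: "v \<in> borel_measurable borel" "\<And>x. v x \<in> {0..1}"
    and fin: "(\<integral>\<^sup>+x. ennreal (1 - v x) \<partial>L) < \<infinity>"
  shows "AE \<omega> in P. (\<forall>n. window_series n t v \<omega> \<in> {0..1}) \<and> (\<lambda>n. window_series n t v \<omega>) \<longlonglongrightarrow>
    unordered_prod (\<lambda>p. v (fst p)) (matern_infinity (thin {0..<t} (\<Phi> \<omega>)) (C \<omega>))"
proof -
  have "(\<integral>\<^sup>+x. ennreal (indicator (cball 0 (real n)) x) \<partial>L) < \<infinity>" for n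
    using emeasure_L_bounded[OF bounded_cball, of "0 :: real^2" "real n"] by (simp add: sets_L[OF lf] ennreal_indicator)
  then have "AE \<omega> in P. (\<Sum>m. chain_sum (indicator (cball 0 (real n))) t m \<omega>) < \<infinity>" for n
    by (intro AE_chain_sum_finite t borel_measurable_indicator) (auto split: split_indicator)
  then have "AE \<omega> in P. \<forall>n. (\<Sum>m. chain_sum (indicator (cball 0 (real n))) t m \<omega>) < \<infinity>"
    by (subst AE_all_countable) blast
  moreover have "AE \<omega> in P. (\<Sum>m. chain_sum (\<lambda>x. 1 - v x) t m \<omega>) < \<infinity>"
    using v by (intro AE_chain_sum_finite t fin) auto
  ultimately show ?thesis using AE_distinct_timers[OF t] AE_space
  proof eventually_elim
    case (elim \<omega>)
    let ?u = "\<lambda>p :: point. v (fst p)"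
    define V where "V n = window_points (cball 0 (real n)) t \<omega>" for n
    have \<omega>: "\<omega> \<in> space P" by (rule elim(4))
    have sub: "V n \<subseteq> points_before t \<omega>" for n
      by (auto simp: V_def window_points_def points_before_def)
    have finV: "finite (V n)" for n
      unfolding V_def by (rule finite_window_points[OF \<omega> bounded_cball])
    have series: "window_series n t v \<omega> = unordered_prod ?u (matern_infinity (V n) (C \<omega>))" for n
    proof -
      have "finite (matern_infinity (V n) (C \<omega>))"
        by (rule finite_subset[OF matern_infinity_subset finV])
      then have "unordered_prod ?u (matern_infinity (V n) (C \<omega>)) = prod ?u (matern_infinity (V n) (C \<omega>))"
        by (rule unordered_prod_finite)
      also have "\<dots> = window_series n t v \<omega>"
        unfolding V_def
        by (rule window_series_eq[symmetric, OF \<omega> v(2) inj_on_subset[OF elim(3) sub[unfolded V_def]]])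
      finally show ?thesis by (rule sym)
    qed
    have "incseq V"
      unfolding incseq_def V_def window_points_def by (auto simp: mem_Times_iff)
    moreover have "(\<Union>n. V n) = points_before t \<omega>"
    proof (rule equalityI)
      show "points_before t \<omega> \<subseteq> (\<Union>n. V n)"
      proof
        fix p assume p: "p \<in> points_before t \<omega>"
        obtain n where "norm (fst p) \<le> real n" using real_arch_simple by blast
        with p have "p \<in> V n" by (simp add: V_def window_points_def points_before_def mem_Times_iff)
        then show "p \<in> (\<Union>n. V n)" by blast
      qed
    qed (use sub in blast)
    moreover have "(\<lambda>p. 1 - ?u p) summable_on points_before t \<omega>"
      using v(2) elim(2) by (intro summable_points[where g="\<lambda>x. 1 - v x"]) auto
    ultimately have "(\<lambda>n. unordered_prod ?u (matern_infinity (V n) (C \<omega>))) \<longlonglongrightarrow>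
        unordered_prod ?u (matern_infinity (points_before t \<omega>) (C \<omega>))"
      using elim(1) by (intro matern_infinity_window_limit wf_earlier_nbr finite_branching v(2)) auto
    then show ?case
      unfolding series thin_eq_points_before[OF \<omega>]
      by (intro conjI allI unordered_prod_unit(2) v(2))
  qed
qed

text \<open>Dominated convergence with the constant 1. That the window functionals lie in [0,1] is
  inherited from the products of which they are means, and it later provides the domination in the
  integral equation.\<close>

lemma gen_functional_limit:
  assumes t: "0 \<le> t" and v: "v \<in> borel_measurable borel" "\<And>x. v x \<in> {0..1}"
    and fin: "(\<integral>\<^sup>+x. ennreal (1 - v x) \<partial>L) < \<infinity>"
  shows "(\<lambda>n. window_functional n t v) \<longlonglongrightarrow> gen_functional P \<Phi> C t v"
    and "window_functional n t v \<in> {0..1}"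
    and "gen_functional P \<Phi> C t v \<in> {0..1}"
proof -
  let ?Y = "\<lambda>n. window_series n t v"
  define Z where "Z \<omega> = unordered_prod (\<lambda>p. v (fst p)) (matern_infinity (thin {0..<t} (\<Phi> \<omega>)) (C \<omega>))" for \<omega>
  note ae = AE_window_series_limit[OF t v fin, folded Z_def]
  have Ym: "?Y n \<in> borel_measurable P" for n by (rule window_series_integral(1)[OF t v])
  \<comment> \<open>\<open>lim\<close> of measurable functions is measurable everywhere, convergent
    or not; this gives \<open>Z\<close> a measurable version.\<close>
  have lim: "AE \<omega> in P. Z \<omega> = lim (\<lambda>n. ?Y n \<omega>)"
    using ae by eventually_elim (metis limI)
  have Zm: "Z \<in> borel_measurable (completion P)"
    by (rule completion_measurable_AE_eq[OF borel_measurable_lim_metric[OF Ym] lim])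
  interpret cP: prob_space "completion P" by (rule prob_space_completion)
  have "(\<lambda>n. \<integral>\<omega>. ?Y n \<omega> \<partial>completion P) \<longlonglongrightarrow> (\<integral>\<omega>. Z \<omega> \<partial>completion P)"
  proof (rule integral_dominated_convergence[where w="\<lambda>_. 1"])
    show "?Y n \<in> borel_measurable (completion P)" for n by (rule measurable_completion[OF Ym])
    show "AE \<omega> in completion P. (\<lambda>n. ?Y n \<omega>) \<longlonglongrightarrow> Z \<omega>"
      by (rule AE_completion) (use ae in \<open>eventually_elim, blast\<close>)
    show "AE \<omega> in completion P. norm (?Y n \<omega>) \<le> 1" for n
      by (rule AE_completion) (use ae in \<open>eventually_elim, simp\<close>)
  qed (use Zm in simp_all)
  also have "(\<lambda>n. \<integral>\<omega>. ?Y n \<omega> \<partial>completion P) = (\<lambda>n. window_functional n t v)"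
    by (simp add: integral_completion[OF Ym] window_series_integral(2)[OF t v])
  finally show lim': "(\<lambda>n. window_functional n t v) \<longlonglongrightarrow> gen_functional P \<Phi> C t v"
    by (simp add: gen_functional_def Z_def)
  show unit: "window_functional n t v \<in> {0..1}" for n
  proof -
    have b: "AE \<omega> in P. 0 \<le> ?Y n \<omega>" "AE \<omega> in P. ?Y n \<omega> \<le> 1"
      using ae by (eventually_elim, simp)+
    have "integrable P (?Y n)"
      by (rule integrable_const_bound[where B=1]) (use b Ym in auto)
    then have "(\<integral>\<omega>. ?Y n \<omega> \<partial>P) \<le> (\<integral>\<omega>. 1 \<partial>P)"
      by (rule integral_mono_AE) (use b in simp_all)
    moreover have "0 \<le> (\<integral>\<omega>. ?Y n \<omega> \<partial>P)" using b(1) by (rule integral_nonneg_AE)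
    ultimately show ?thesis by (simp add: window_series_integral(2)[OF t v] prob_space)
  qed
  show "gen_functional P \<Phi> C t v \<in> {0..1}"
    using LIMSEQ_le_const[OF lim', of 0] LIMSEQ_le_const2[OF lim', of 1] unit by auto
qed

end

section \<open>The integral equation\<close>

context matern_setting
begin

abbreviation "GF \<equiv> gen_functional P \<Phi> C"

lemma window_functional_summable:
  assumes t: "0 \<le> t" and v: "v \<in> borel_measurable borel" "\<And>x. v x \<in> {0..1}"
  shows "summable (\<lambda>m. (-1)^m * enn2real (survival_integral (cball 0 (real n)) m t v))"
proof (rule summable_comparison_test'[OF summable_exp_series[of "measure L (cball 0 (real n)) * t"], where N=0])
  fix m
  show "norm ((-1)^m * enn2real (survival_integral (cball 0 (real n)) m t v)) \<le>
      (measure L (cball 0 (real n)) * t) ^ m / fact m"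
    using survival_integral_cball_bound(1)[OF t v, of n m] by (simp add: abs_mult power_abs)
qed

lemma window_functional_measurable:
  assumes v: "v \<in> borel_measurable borel"
  shows "(\<lambda>p. window_functional n (snd p) (H h v (fst p))) \<in> borel_measurable borel"
proof -
  have "(\<lambda>p. enn2real (survival_integral (cball 0 (real n)) m (snd p) (H h v (fst p)))) \<in> borel_measurable borel" for m
    using survival_integral_H_measurable[OF _ v, of "cball 0 (real n)" m] by simp
  then show ?thesis
    unfolding window_functional_def
    by (intro borel_measurable_suminf borel_measurable_times borel_measurable_const)
qed

lemma fst_snd_borel: "fst \<in> borel \<rightarrow>\<^sub>M (borel :: (real^2) measure)" "snd \<in> borel \<rightarrow>\<^sub>M (borel :: real measure)"
  by (auto intro!: borel_measurable_continuous_onI continuous_intros)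

text \<open>Each term of positive order is rewritten by \<open>survival_integral_Suc\<close>; after
  exchanging sum and integral, the lowered orders form the same series for \<open>H h v\<close> at
  the timer of the peeled point, with opposite sign.\<close>

lemma window_functional_eq:
  assumes t: "0 \<le> t" and v: "v \<in> borel_measurable borel" "\<And>x. v x \<in> {0..1}"
  shows "window_functional n t v = 1 - (\<integral>p. indicator {0..<t} (snd p) *
    (indicator (cball 0 (real n)) (fst p) * (1 - v (fst p)) * window_functional n (snd p) (H h v (fst p))) \<partial>\<mu>)"
proof -
  let ?W = "cball (0 :: real^2) (real n)"
  let ?J = "\<lambda>m t v. survival_integral ?W m t v"
  let ?e = "\<lambda>m t v. enn2real (?J m t v)"
  define a where "a m p = indicator {0..<t} (snd p) *
    (indicator ?W (fst p) * (1 - v (fst p)) * ?e m (snd p) (H h v (fst p)))" for m and p :: point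
  have W: "?W \<in> sets borel" by simp
  have am: "a m \<in> borel_measurable \<mu>" for m
  proof -
    have "(\<lambda>p. ?e m (snd p) (H h v (fst p))) \<in> borel_measurable borel"
      using survival_integral_H_measurable[OF W v(1), of m] by simp
    then have "a m \<in> borel_measurable borel"
      unfolding a_def[abs_def]
      by (intro borel_measurable_times borel_measurable_diff borel_measurable_const
          measurable_compose[OF fst_snd_borel(1)] measurable_compose[OF fst_snd_borel(2)]
          borel_measurable_indicator v(1)) auto
    then show ?thesis by (simp add: measurable_cong_sets[OF sets_mu refl])
  qed
  have a0: "0 \<le> a m p" for m p
    unfolding a_def using v(2)[of "fst p"] by (intro mult_nonneg_nonneg) auto
  have nn: "(\<integral>\<^sup>+p. ennreal (a m p) \<partial>\<mu>) = ?J (Suc m) t v" for m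
    unfolding survival_integral_Suc[OF W v]
  proof (rule nn_integral_cong)
    fix p :: point
    show "ennreal (a m p) = indicator {0..<t} (snd p) *
      (indicator ?W (fst p) * ennreal (1 - v (fst p)) * ?J m (snd p) (H h v (fst p)))"
    proof (cases "snd p \<in> {0..<t}")
      case True
      then have "?J m (snd p) (H h v (fst p)) < \<infinity>"
        by (intro survival_integral_cball_bound(2) H_measurable H_unit v) auto
      then have J: "ennreal (?e m (snd p) (H h v (fst p))) = ?J m (snd p) (H h v (fst p))"
        by (intro ennreal_enn2real) simp
      have "ennreal (a m p) = indicator ?W (fst p) * (ennreal (1 - v (fst p)) * ennreal (?e m (snd p) (H h v (fst p))))"
        using True v(2)[of "fst p"] by (simp add: a_def ennreal_mult' split: split_indicator)
      then show ?thesis using True by (simp add: J mult.assoc)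
    qed (simp add: a_def)
  qed
  have int: "integrable \<mu> (a m)" for m
    using am a0 survival_integral_cball_bound(2)[OF t v, of n "Suc m"]
    by (intro integrableI_nonneg) (simp_all add: nn)
  have inta: "(\<integral>p. a m p \<partial>\<mu>) = ?e (Suc m) t v" for m
    using am a0 by (subst integral_eq_nn_integral) (simp_all add: nn)
  have norm: "norm ((-1)^m * a m p) = a m p" for m p
    using a0[of m p] by (simp add: abs_mult power_abs)
  have series: "summable (\<lambda>m. (-1)^m * ?e m (snd p) (H h v (fst p)))" if "snd p \<in> {0..<t}" for p
    using that by (intro window_functional_summable H_measurable H_unit v) auto
  have abs_series: "summable (\<lambda>m. a m p)" for p
  proof (cases "snd p \<in> {0..<t}")
    case True
    have "summable (\<lambda>m. ?e m (snd p) (H h v (fst p)))"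
    proof (rule summable_comparison_test'[OF summable_exp_series[of "measure L ?W * snd p"], where N=0])
      fix m
      show "norm (?e m (snd p) (H h v (fst p))) \<le> (measure L ?W * snd p) ^ m / fact m"
      proof -
        have "?e m (snd p) (H h v (fst p)) \<le> (measure L ?W * snd p) ^ m / fact m"
          using True by (intro survival_integral_cball_bound(1) H_measurable H_unit v) auto
        then show ?thesis by simp
      qed
    qed
    then show ?thesis unfolding a_def by (intro summable_mult)
  qed (simp add: a_def)
  have "(\<integral>p. (\<Sum>m. (-1)^m * a m p) \<partial>\<mu>) = (\<Sum>m. \<integral>p. (-1)^m * a m p \<partial>\<mu>)"
  proof (rule integral_suminf)
    show "integrable \<mu> (\<lambda>p. (-1)^m * a m p)" for m using int by simp
    show "AE p in \<mu>. summable (\<lambda>m. norm ((-1)^m * a m p))"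
      unfolding norm using abs_series by simp
    have "summable (\<lambda>m. ?e (Suc m) t v)"
    proof (rule summable_comparison_test'[where N=0])
      show "summable (\<lambda>m. (measure L ?W * t) ^ Suc m / fact (Suc m))"
        using summable_exp_series[of "measure L ?W * t"] by (subst summable_Suc_iff)
      show "norm (?e (Suc m) t v) \<le> (measure L ?W * t) ^ Suc m / fact (Suc m)" for m
        using survival_integral_cball_bound(1)[OF t v, of n "Suc m"] by simp
    qed
    then show "summable (\<lambda>m. \<integral>p. norm ((-1)^m * a m p) \<partial>\<mu>)"
      unfolding norm inta .
  qed
  also have "\<dots> = (\<Sum>m. (-1)^m * ?e (Suc m) t v)"
    by (simp add: inta)
  also have "\<dots> = (\<Sum>m. - ((-1)^Suc m * ?e (Suc m) t v))" by simp
  also have "\<dots> = - (\<Sum>m. (-1)^Suc m * ?e (Suc m) t v)"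
  proof (rule suminf_minus)
    show "summable (\<lambda>m. (-1)^Suc m * ?e (Suc m) t v)"
      using window_functional_summable[OF t v, of n] by (rule summable_Suc_iff[THEN iffD2])
  qed
  \<comment> \<open>The missing head is the contribution of the empty tuple, which equals 1.\<close>
  also have "(\<Sum>m. (-1)^Suc m * ?e (Suc m) t v) = window_functional n t v - 1"
    unfolding window_functional_def
    by (subst suminf_split_head[OF window_functional_summable[OF t v, of n]]) (simp only: survival_integral_0, simp)
  also have "- (window_functional n t v - 1) = 1 - window_functional n t v" by simp
  finally have main: "(\<integral>p. (\<Sum>m. (-1)^m * a m p) \<partial>\<mu>) = 1 - window_functional n t v" .
  have "(\<Sum>m. (-1)^m * a m p) = indicator {0..<t} (snd p) *
    (indicator ?W (fst p) * (1 - v (fst p)) * window_functional n (snd p) (H h v (fst p)))" for p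
  proof (cases "snd p \<in> {0..<t}")
    case True
    have "(\<Sum>m. (-1)^m * a m p) = (\<Sum>m. (indicator ?W (fst p) * (1 - v (fst p))) * ((-1)^m * ?e m (snd p) (H h v (fst p))))"
      using True by (simp add: a_def mult_ac)
    also have "\<dots> = (indicator ?W (fst p) * (1 - v (fst p))) * window_functional n (snd p) (H h v (fst p))"
      unfolding window_functional_def by (rule suminf_mult[OF series[OF True]])
    finally show ?thesis using True by simp
  qed (simp add: a_def)
  with main show ?thesis by simp
qed

text \<open>Because 1 - v (1 - h) \<le> (1 - v) + h for values in [0,1]. The admissible functions
  are thus stable under \<open>H\<close>, with a deficit that grows by at most \<open>M\<close>,
  uniformly in \<open>x\<close>.\<close>

lemma H_deficit:
  assumes v: "v \<in> borel_measurable borel" "\<And>x. v x \<in> {0..1}"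
    and fin: "(\<integral>\<^sup>+y. ennreal (1 - v y) \<partial>L) \<le> ennreal d" "0 \<le> d"
  shows "(\<integral>\<^sup>+y. ennreal (1 - H h v x y) \<partial>L) \<le> ennreal (d + M)"
proof -
  have hm: "h x \<in> borel_measurable borel"
    by (intro measurable_kernel_pair[OF h_meas]) auto
  have "(\<integral>\<^sup>+y. ennreal (1 - H h v x y) \<partial>L) \<le> (\<integral>\<^sup>+y. ennreal (1 - v y) + ennreal (h x y) \<partial>L)"
  proof (rule nn_integral_mono)
    fix y
    have "v y * h x y \<le> 1 * h x y"
      using v(2)[of y] h_range[of x y] by (intro mult_right_mono) auto
    then have "1 - H h v x y \<le> (1 - v y) + h x y" by (simp add: H_def algebra_simps)
    then have "ennreal (1 - H h v x y) \<le> ennreal ((1 - v y) + h x y)" by (rule ennreal_leI)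
    also have "\<dots> = ennreal (1 - v y) + ennreal (h x y)"
      using v(2)[of y] h_range[of x y] by (intro ennreal_plus) auto
    finally show "ennreal (1 - H h v x y) \<le> ennreal (1 - v y) + ennreal (h x y)" .
  qed
  also have "\<dots> = (\<integral>\<^sup>+y. ennreal (1 - v y) \<partial>L) + (\<integral>\<^sup>+y. ennreal (h x y) \<partial>L)"
    using v(1) hm by (intro nn_integral_add) (simp_all add: measurable_cong_sets[OF sets_L[OF lf] refl])
  also have "\<dots> \<le> ennreal d + ennreal M"
    by (intro add_mono fin M)
  also have "\<dots> = ennreal (d + M)"
    using fin(2) M0 by (simp add: ennreal_plus)
  finally show ?thesis .
qed

section \<open>Integral equation and Lipschitz bound for a fixed function\<close>

context
  fixes v :: "real^2 \<Rightarrow> real" and d :: real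
  assumes v: "v \<in> borel_measurable borel" "\<And>x. v x \<in> {0..1}"
    and d: "(\<integral>\<^sup>+x. ennreal (1 - v x) \<partial>L) \<le> ennreal d" "0 \<le> d"
begin

lemma deficit_finite: "(\<integral>\<^sup>+x. ennreal (1 - v x) \<partial>L) < \<infinity>"
  using d(1) by (rule order_le_less_trans) simp

lemma H_deficit_finite: "(\<integral>\<^sup>+y. ennreal (1 - H h v x y) \<partial>L) < \<infinity>"
  using H_deficit[OF v d] by (rule order_le_less_trans) simp

lemma GF_H_limit:
  assumes "0 \<le> t"
  shows "(\<lambda>n. window_functional n t (H h v x)) \<longlonglongrightarrow> GF t (H h v x)"
    and "GF t (H h v x) \<in> {0..1}" "window_functional n t (H h v x) \<in> {0..1}"
  using gen_functional_limit[OF assms H_measurable[OF v(1)] H_unit[OF v(2)] H_deficit_finite] by auto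

lemma integrable_deficit: "integrable L (\<lambda>x. 1 - v x)"
  using v(2) deficit_finite v(1)
  by (intro integrableI_nonneg) (auto simp: measurable_cong_sets[OF sets_L[OF lf] refl])

lemma integral_deficit: "(\<integral>x. 1 - v x \<partial>L) \<le> d" "0 \<le> (\<integral>x. 1 - v x \<partial>L)"
proof -
  have v0: "0 \<le> 1 - v x" for x using v(2)[of x] by simp
  have "ennreal (\<integral>x. 1 - v x \<partial>L) = (\<integral>\<^sup>+x. ennreal (1 - v x) \<partial>L)"
    using integrable_deficit v0 by (intro nn_integral_eq_integral[symmetric]) auto
  then have "ennreal (\<integral>x. 1 - v x \<partial>L) \<le> ennreal d" using d(1) by simp
  then show "(\<integral>x. 1 - v x \<partial>L) \<le> d" using d(2) by simp
  show "0 \<le> (\<integral>x. 1 - v x \<partial>L)" using v0 by (intro Bochner_Integration.integral_nonneg)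
qed

lemma integrable_slab:
  "integrable \<mu> (\<lambda>p. indicator {0..<t} (snd p) * (1 - v (fst p)))"
proof (rule integrableI_nonneg)
  have 1: "(\<lambda>p. indicator {0..<t} (snd p) * (1 - v (fst p)) :: real) \<in> borel_measurable borel"
    by (intro borel_measurable_times borel_measurable_diff borel_measurable_const
          measurable_compose[OF fst_snd_borel(1)] measurable_compose[OF fst_snd_borel(2)]
          borel_measurable_indicator v(1)) auto
  then show "(\<lambda>p. indicator {0..<t} (snd p) * (1 - v (fst p))) \<in> borel_measurable \<mu>"
    by (simp add: measurable_cong_sets[OF sets_mu refl])
  show "AE p in \<mu>. 0 \<le> indicator {0..<t} (snd p) * (1 - v (fst p))"
    using v(2) by (intro AE_I2 mult_nonneg_nonneg) auto
  \<comment> \<open>The slice bound wants a nonnegative length, while t is arbitrary here; for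
    negative t the slab is empty, so \<open>max t 0\<close> does no harm.\<close>
  have "(\<integral>\<^sup>+p. ennreal (indicator {0..<t} (snd p) * (1 - v (fst p))) \<partial>\<mu>) \<le>
      (\<integral>\<^sup>+p. indicator {0..<max t 0} (snd p) * (ennreal (1 - v (fst p)) * ennreal (1 * snd p ^ 0)) \<partial>\<mu>)"
    by (intro nn_integral_mono) (auto split: split_indicator)
  also have "\<dots> \<le> (\<integral>\<^sup>+x. ennreal (1 - v x) \<partial>L) * ennreal (1 * max t 0 ^ Suc 0 / real (Suc 0))"
    using v(1) by (intro nn_integral_time_slice_bound) auto
  also have "\<dots> < \<infinity>" using deficit_finite by (auto simp: ennreal_mult_less_top)
  finally show "(\<integral>\<^sup>+p. ennreal (indicator {0..<t} (snd p) * (1 - v (fst p))) \<partial>\<mu>) < \<infinity>" .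
qed

text \<open>The negative of the derivative to be established.\<close>

definition rate :: "real \<Rightarrow> real" where
  "rate t = (\<integral>x. GF t (H h v x) * (1 - v x) \<partial>L)"

lemma slab_integrand_limit:
  "(\<lambda>n. indicator {0..<t} (snd p) * (indicator (cball 0 (real n)) (fst p) * (1 - v (fst p)) *
      window_functional n (snd p) (H h v (fst p))))
    \<longlonglongrightarrow> indicator {0..<t} (snd p) * (GF (snd p) (H h v (fst p)) * (1 - v (fst p)))"
proof (cases "snd p \<in> {0..<t}")
  case True
  obtain N where "norm (fst p) \<le> real N" using real_arch_simple by blast
  then have "eventually (\<lambda>n. indicator (cball 0 (real n)) (fst p) = (1 :: real)) sequentially"
    by (intro eventually_sequentiallyI[of N]) (auto simp: indicator_def)
  then have "(\<lambda>n. indicator (cball 0 (real n)) (fst p) :: real) \<longlonglongrightarrow> 1"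
    by (rule tendsto_eventually)
  moreover have "(\<lambda>n. window_functional n (snd p) (H h v (fst p))) \<longlonglongrightarrow> GF (snd p) (H h v (fst p))"
    using True by (intro GF_H_limit) auto
  ultimately have "(\<lambda>n. indicator {0..<t} (snd p) * (indicator (cball 0 (real n)) (fst p) * (1 - v (fst p)) *
      window_functional n (snd p) (H h v (fst p))))
    \<longlonglongrightarrow> indicator {0..<t} (snd p) * (1 * (1 - v (fst p)) * GF (snd p) (H h v (fst p)))"
    by (intro tendsto_mult tendsto_const)
  then show ?thesis by (simp add: mult_ac)
qed simp

lemma slab_window_measurable:
  "(\<lambda>p. indicator {0..<t} (snd p) * (indicator (cball 0 (real n)) (fst p) * (1 - v (fst p)) *
      window_functional n (snd p) (H h v (fst p)))) \<in> borel_measurable \<mu>"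
proof -
  have "(\<lambda>p. indicator {0..<t} (snd p) * (indicator (cball 0 (real n)) (fst p) * (1 - v (fst p)) *
      window_functional n (snd p) (H h v (fst p)))) \<in> borel_measurable borel"
    by (intro borel_measurable_times borel_measurable_diff borel_measurable_const
          measurable_compose[OF fst_snd_borel(1)] measurable_compose[OF fst_snd_borel(2)]
          borel_measurable_indicator v(1) window_functional_measurable) auto
  then show ?thesis by (simp add: measurable_cong_sets[OF sets_mu refl])
qed

text \<open>As an expectation depending on parameters, \<open>GF (snd p) (H h v (fst p))\<close> has
  no evident measurability in \<open>p\<close>; it is obtained from the pointwise limit of the
  window functionals.\<close>

lemma slab_measurable:
  "(\<lambda>p. indicator {0..<t} (snd p) * (GF (snd p) (H h v (fst p)) * (1 - v (fst p)))) \<in> borel_measurable \<mu>"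
  by (rule borel_measurable_LIMSEQ_real[OF slab_integrand_limit slab_window_measurable])

lemma slab_integrable:
  "integrable \<mu> (\<lambda>p. indicator {0..<t} (snd p) * (GF (snd p) (H h v (fst p)) * (1 - v (fst p))))"
proof (rule Bochner_Integration.integrable_bound[OF integrable_slab slab_measurable])
  show "AE p in \<mu>. norm (indicator {0..<t} (snd p) * (GF (snd p) (H h v (fst p)) * (1 - v (fst p)))) \<le>
      norm (indicator {0..<t} (snd p) * (1 - v (fst p)))"
  proof (rule AE_I2)
    fix p :: point
    show "norm (indicator {0..<t} (snd p) * (GF (snd p) (H h v (fst p)) * (1 - v (fst p)))) \<le>
      norm (indicator {0..<t} (snd p) * (1 - v (fst p)))"
    proof (cases "snd p \<in> {0..<t}")
      case True
      then have "GF (snd p) (H h v (fst p)) \<in> {0..1}" by (intro GF_H_limit) auto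
      then show ?thesis using True v(2)[of "fst p"] by (simp add: abs_mult mult_left_le_one_le)
    qed simp
  qed
qed

text \<open>The window equation passes to the limit by dominated convergence; the dominating
  function is 1 - v on the slab, integrable by the hypothesis on \<open>v\<close>.\<close>

lemma GF_integral_eq:
  assumes t: "0 \<le> t"
  shows "GF t v = 1 - (\<integral>p. indicator {0..<t} (snd p) * (GF (snd p) (H h v (fst p)) * (1 - v (fst p))) \<partial>\<mu>)"
proof -
  let ?f = "\<lambda>n p. indicator {0..<t} (snd p) * (indicator (cball 0 (real n)) (fst p) * (1 - v (fst p)) *
      window_functional n (snd p) (H h v (fst p)))"
  have "(\<lambda>n. \<integral>p. ?f n p \<partial>\<mu>) \<longlonglongrightarrow>
      (\<integral>p. indicator {0..<t} (snd p) * (GF (snd p) (H h v (fst p)) * (1 - v (fst p))) \<partial>\<mu>)"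
  proof (rule integral_dominated_convergence[OF slab_measurable slab_window_measurable integrable_slab[of t]])
    show "AE p in \<mu>. (\<lambda>n. ?f n p) \<longlonglongrightarrow> indicator {0..<t} (snd p) * (GF (snd p) (H h v (fst p)) * (1 - v (fst p)))"
      by (intro AE_I2 slab_integrand_limit)
    show "AE p in \<mu>. norm (?f n p) \<le> indicator {0..<t} (snd p) * (1 - v (fst p))" for n
    proof (rule AE_I2)
      fix p :: point
      show "norm (?f n p) \<le> indicator {0..<t} (snd p) * (1 - v (fst p))"
      proof (cases "snd p \<in> {0..<t}")
        case True
        then have "window_functional n (snd p) (H h v (fst p)) \<in> {0..1}" by (intro GF_H_limit(3)) auto
        then show ?thesis using True v(2)[of "fst p"]
          by (auto simp: abs_mult mult_left_le split: split_indicator)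
      qed simp
    qed
  qed
  from tendsto_diff[OF tendsto_const[of 1] this]
  have "(\<lambda>n. window_functional n t v) \<longlonglongrightarrow>
      1 - (\<integral>p. indicator {0..<t} (snd p) * (GF (snd p) (H h v (fst p)) * (1 - v (fst p))) \<partial>\<mu>)"
    by (simp add: window_functional_eq[OF t v, symmetric])
  with gen_functional_limit(1)[OF t v deficit_finite] show ?thesis by (rule LIMSEQ_unique)
qed

lemma GF_rate_eq:
  assumes t: "0 \<le> t"
  shows "GF t v = 1 - (\<integral>u. indicator {0..<t} u * rate u \<partial>lborel)"
proof -
  interpret L: sigma_finite_measure L by (rule sigma_finite_L[OF lf])
  interpret pair_sigma_finite L lborel ..
  have "(\<integral>p. indicator {0..<t} (snd p) * (GF (snd p) (H h v (fst p)) * (1 - v (fst p))) \<partial>\<mu>) =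
    (\<integral>u. (\<integral>x. indicator {0..<t} u * (GF u (H h v x) * (1 - v x)) \<partial>L) \<partial>lborel)"
    using slab_integrable[of t] unfolding product_intensity_def
    by (subst integral_snd) (simp_all add: case_prod_unfold)
  then show ?thesis unfolding GF_integral_eq[OF t] rate_def by simp
qed

lemma rate_integrable:
  assumes t: "0 \<le> t"
  shows "integrable L (\<lambda>x. GF t (H h v x) * (1 - v x))"
proof (rule Bochner_Integration.integrable_bound[OF integrable_deficit])
  have "(\<lambda>x. window_functional n t (H h v x)) \<in> borel_measurable borel" for n
  proof -
    have "(\<lambda>x. (x, t)) \<in> borel \<rightarrow>\<^sub>M (borel :: point measure)"
      by (intro borel_measurable_continuous_onI continuous_intros)
    from measurable_compose[OF this window_functional_measurable[OF v(1), of n]] show ?thesis by simp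
  qed
  then have "(\<lambda>x. GF t (H h v x)) \<in> borel_measurable borel"
    by (intro borel_measurable_LIMSEQ_real[OF GF_H_limit(1)[OF t]])
  then show "(\<lambda>x. GF t (H h v x) * (1 - v x)) \<in> borel_measurable L"
    using v(1) by (simp add: measurable_cong_sets[OF sets_L[OF lf] refl])
  show "AE x in L. norm (GF t (H h v x) * (1 - v x)) \<le> norm (1 - v x)"
  proof (rule AE_I2)
    fix x
    have "GF t (H h v x) \<in> {0..1}" by (rule GF_H_limit(2)[OF t])
    then show "norm (GF t (H h v x) * (1 - v x)) \<le> norm (1 - v x)"
      by (simp add: abs_mult mult_left_le_one_le)
  qed
qed

text \<open>By the integral equation the increment is an integral over the slab between the two
  times, with an integrand between 0 and 1 - v. The constant depends on \<open>v\<close> only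
  through the bound \<open>d\<close>, which is what makes it uniform over the functions
  \<open>H h v x\<close>.\<close>

lemma GF_Lipschitz:
  assumes s: "0 \<le> s" "s \<le> t"
  shows "\<bar>GF t v - GF s v\<bar> \<le> d * (t - s)"
proof -
  let ?f = "\<lambda>r p. indicator {0..<r} (snd p) * (GF (snd p) (H h v (fst p)) * (1 - v (fst p)))"
  let ?s = "\<lambda>p. indicator {s..<t} (snd p) * (1 - v (fst p)) :: real"
  have t: "0 \<le> t" using s by simp
  have split: "indicator {s..<t} u = (indicator {0..<t} u - indicator {0..<s} u :: real)" for u
    using s by (auto split: split_indicator)
  have int_s: "integrable \<mu> ?s"
    unfolding split left_diff_distrib
    by (intro Bochner_Integration.integrable_diff integrable_slab)
  have "GF s v - GF t v = (\<integral>p. ?f t p - ?f s p \<partial>\<mu>)"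
    unfolding GF_integral_eq[OF s(1)] GF_integral_eq[OF t]
    by (subst Bochner_Integration.integral_diff) (simp_all add: slab_integrable)
  moreover have "norm (\<integral>p. ?f t p - ?f s p \<partial>\<mu>) \<le> (\<integral>p. ?s p \<partial>\<mu>)"
  proof (rule Bochner_Integration.integral_norm_bound_integral[OF Bochner_Integration.integrable_diff[OF slab_integrable slab_integrable] int_s])
    fix p :: point
    have "?f t p - ?f s p = indicator {s..<t} (snd p) * (GF (snd p) (H h v (fst p)) * (1 - v (fst p)))"
      unfolding split by (simp add: left_diff_distrib)
    moreover have "GF (snd p) (H h v (fst p)) \<in> {0..1}" if "snd p \<in> {s..<t}"
      using that s by (intro GF_H_limit(2)) auto
    ultimately show "norm (?f t p - ?f s p) \<le> ?s p"
      using v(2)[of "fst p"] by (cases "snd p \<in> {s..<t}") (auto simp: abs_mult mult_left_le_one_le)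
  qed
  moreover have "(\<integral>p. ?s p \<partial>\<mu>) = (\<integral>x. 1 - v x \<partial>L) * (t - s)"
  proof -
    interpret L: sigma_finite_measure L by (rule sigma_finite_L[OF lf])
    interpret pair_sigma_finite L lborel ..
    have "(\<integral>p. ?s p \<partial>\<mu>) = (\<integral>u. (\<integral>x. indicator {s..<t} u * (1 - v x) \<partial>L) \<partial>lborel)"
      using int_s unfolding product_intensity_def
      by (subst integral_snd) (simp_all add: case_prod_unfold)
    also have "\<dots> = (\<integral>u. indicator {s..<t} u * (\<integral>x. 1 - v x \<partial>L) \<partial>lborel)" by simp
    also have "\<dots> = (\<integral>x. 1 - v x \<partial>L) * (t - s)" using s by simp
    finally show ?thesis .
  qed
  ultimately have "\<bar>GF t v - GF s v\<bar> \<le> (\<integral>x. 1 - v x \<partial>L) * (t - s)"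
    by (simp add: abs_minus_commute)
  also have "\<dots> \<le> d * (t - s)"
    using integral_deficit(1) s by (intro mult_right_mono) auto
  finally show ?thesis .
qed

end

text \<open>\<open>GF_Lipschitz\<close> is applied to \<open>H h v x\<close>, whose deficit is at
  most d + M for every \<open>x\<close>; integrating against 1 - v contributes the second factor
  d.\<close>

lemma rate_Lipschitz:
  assumes v: "v \<in> borel_measurable borel" "\<And>x. v x \<in> {0..1}"
    and d: "(\<integral>\<^sup>+x. ennreal (1 - v x) \<partial>L) \<le> ennreal d" "0 \<le> d"
    and s: "0 \<le> s" "s \<le> t"
  shows "\<bar>rate v t - rate v s\<bar> \<le> (d + M) * (t - s) * d"
proof -
  have t: "0 \<le> t" using s by simp
  let ?f = "\<lambda>t x. GF t (H h v x) * (1 - v x)"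
  have "rate v t - rate v s = (\<integral>x. ?f t x - ?f s x \<partial>L)"
    unfolding rate_def[OF v d]
    by (rule Bochner_Integration.integral_diff[symmetric, OF rate_integrable[OF v d t] rate_integrable[OF v d s(1)]])
  moreover have "norm (\<integral>x. ?f t x - ?f s x \<partial>L) \<le> (\<integral>x. (d + M) * (t - s) * (1 - v x) \<partial>L)"
  proof (rule Bochner_Integration.integral_norm_bound_integral)
    show "integrable L (\<lambda>x. ?f t x - ?f s x)"
      by (intro Bochner_Integration.integrable_diff rate_integrable[OF v d] t s)
    show "integrable L (\<lambda>x. (d + M) * (t - s) * (1 - v x))"
      using integrable_deficit[OF v d] by simp
    fix x
    have "\<bar>GF t (H h v x) - GF s (H h v x)\<bar> \<le> (d + M) * (t - s)"
      using H_deficit[OF v d] M0 d(2) by (intro GF_Lipschitz s H_measurable H_unit v) auto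
    then have "\<bar>GF t (H h v x) - GF s (H h v x)\<bar> * (1 - v x) \<le> (d + M) * (t - s) * (1 - v x)"
      using v(2)[of x] by (intro mult_right_mono) auto
    then show "norm (?f t x - ?f s x) \<le> (d + M) * (t - s) * (1 - v x)"
      using v(2)[of x] by (simp add: left_diff_distrib[symmetric] abs_mult)
  qed
  moreover have "(\<integral>x. (d + M) * (t - s) * (1 - v x) \<partial>L) \<le> (d + M) * (t - s) * d"
    using integral_deficit(1)[OF v d] M0 d(2) s by (simp add: mult_left_mono)
  ultimately show ?thesis by simp
qed

text \<open>A Lipschitz rate is continuous, so the fundamental theorem of calculus differentiates
  the integral equation at every time and not merely almost everywhere.\<close>

lemma GF_derivative:
  assumes v: "v \<in> borel_measurable borel" "\<And>x. v x \<in> {0..1}"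
    and fin: "(\<integral>\<^sup>+x. ennreal (1 - v x) \<partial>L) < \<infinity>" and t: "0 \<le> t"
  shows "integrable L (\<lambda>x. GF t (H h v x) * (1 - v x))"
    and "((\<lambda>s. GF s v) has_real_derivative - (\<integral>x. GF t (H h v x) * (1 - v x) \<partial>L)) (at t within {0..})"
proof -
  define d where "d = enn2real (\<integral>\<^sup>+x. ennreal (1 - v x) \<partial>L)"
  have d: "(\<integral>\<^sup>+x. ennreal (1 - v x) \<partial>L) \<le> ennreal d" "0 \<le> d"
    using fin by (simp_all add: d_def)
  show "integrable L (\<lambda>x. GF t (H h v x) * (1 - v x))" by (rule rate_integrable[OF v d t])
  let ?g = "rate v"
  have lip: "dist (?g x) (?g y) \<le> ((d + M) * d) * dist x y" if "0 \<le> x" "0 \<le> y" for x y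
    using rate_Lipschitz[OF v d, of x y] rate_Lipschitz[OF v d, of y x] that
    by (cases "x \<le> y") (auto simp: dist_real_def mult_ac abs_minus_commute)
  have "((d + M) * d)-lipschitz_on {0..} ?g"
    using lip d(2) M0 by (intro lipschitz_onI) auto
  then have cont: "continuous_on {0..} ?g" by (rule lipschitz_on_continuous_on)
  have cont': "continuous_on {0..b} ?g" for b by (rule continuous_on_subset[OF cont]) auto
  have GF: "GF s v = 1 - integral {0..s} ?g" if "s \<in> {0..}" for s
  proof -
    have s: "0 \<le> s" using that by simp
    have si: "set_integrable lborel {0..s} ?g"
      by (rule borel_integrable_atLeastAtMost'[OF cont'])
    then have m: "(\<lambda>u. indicator {0..s} u * ?g u) \<in> borel_measurable lborel"
      unfolding set_integrable_def by auto
    have m': "(\<lambda>u. indicator {0..<s} u * ?g u) \<in> borel_measurable lborel"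
    proof -
      have "(\<lambda>u. indicator {0..<s} u * (indicator {0..s} u * ?g u)) \<in> borel_measurable lborel"
        by (rule borel_measurable_times[OF borel_measurable_indicator m]) simp
      also have "(\<lambda>u. indicator {0..<s} u * (indicator {0..s} u * ?g u)) = (\<lambda>u. indicator {0..<s} u * ?g u)"
        by (auto simp: fun_eq_iff split: split_indicator)
      finally show ?thesis .
    qed
    \<comment> \<open>The half-open interval stems from the timers strictly below s; the calculus
      theorem uses the closed one, which differs by a null set.\<close>
    have "(\<integral>u. indicator {0..<s} u * ?g u \<partial>lborel) = (\<integral>u. indicator {0..s} u * ?g u \<partial>lborel)"
    proof (rule integral_cong_AE[OF m' m])
      have "AE u in lborel. u \<noteq> s" by (rule AE_lborel_singleton)
      then show "AE u in lborel. indicator {0..<s} u * ?g u = indicator {0..s} u * ?g u"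
        by eventually_elim (auto split: split_indicator)
    qed
    also have "\<dots> = integral {0..s} ?g"
      using set_borel_integral_eq_integral(2)[OF si] by (simp add: set_lebesgue_integral_def)
    finally show ?thesis using GF_rate_eq[OF v d s] by simp
  qed
  have "((\<lambda>s. integral {0..s} ?g) has_real_derivative ?g t) (at t within {0..t + 1})"
    using t by (intro integral_has_real_derivative cont') auto
  then have "((\<lambda>s. 1 - integral {0..s} ?g) has_real_derivative 0 - ?g t) (at t within {0..t + 1})"
    by (intro DERIV_diff DERIV_const)
  \<comment> \<open>The compact interval of the calculus theorem extends beyond t, so near t it
    coincides with the half line. At t = 0 both filters are one-sided.\<close>
  also have "at t within {0..t + 1} = at t within {0..}"
    by (rule at_within_nhd[of t "{..<t + 1}"]) auto
  finally have "((\<lambda>s. 1 - integral {0..s} ?g) has_real_derivative - ?g t) (at t within {0..})" by simp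
  then have "((\<lambda>s. GF s v) has_real_derivative - ?g t) (at t within {0..})"
    by (rule has_field_derivative_transform_within[where d=1]) (use t GF in auto)
  then show "((\<lambda>s. GF s v) has_real_derivative - (\<integral>x. GF t (H h v x) * (1 - v x) \<partial>L)) (at t within {0..})"
    unfolding rate_def[OF v d] .
qed

lemma GF_0: "GF 0 v = 1"
proof -
  have "thin {0..<0} (\<Phi> \<omega>) = {}" for \<omega> by (auto simp: thin_def)
  moreover have "matern_infinity {} c = {}" for c using matern_infinity_subset[of "{}" c] by simp
  ultimately have "GF 0 v = (\<integral>\<omega>. 1 \<partial>completion P)"
    unfolding gen_functional_def by (simp add: unordered_prod_finite)
  also have "\<dots> = 1"
  proof -
    interpret cP: prob_space "completion P" by (rule prob_space_completion)
    show ?thesis by (simp add: prob_space)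
  qed
  finally show ?thesis .
qed

end

theorem theorem1:
  fixes P :: "'w measure"
    and L :: "(real^2) measure"
    and h :: "real^2 \<Rightarrow> real^2 \<Rightarrow> real"
    and \<Phi> :: "'w \<Rightarrow> point set"
    and C :: "'w \<Rightarrow> point \<Rightarrow> point \<Rightarrow> bool"
    and v :: "real^2 \<Rightarrow> real"
  assumes "case_prod h \<in> borel_measurable borel"
    and "\<And>x y. h x y \<in> {0..1}"
    and "\<And>x y. h x y = h y x"
    and "\<And>x y. h x y = h 0 (y - x)"
    and "locally_finite_measure L"
    and "(SUP x. \<integral>\<^sup>+ y. ennreal (h x y) \<partial>L) < \<infinity>"
    and "prob_space P"
    and "poisson_point_process P (timed_intensity L) \<Phi>"
    and "contention_variables P h \<Phi> C"
    and "v \<in> borel_measurable borel"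
    and "\<And>x. v x \<in> {0..1}"
    and "(\<integral>\<^sup>+ x. ennreal \<bar>1 - v x\<bar> \<partial>L) < \<infinity>"
  shows "gen_functional P \<Phi> C 0 v = 1 \<and>
    (\<forall>t\<ge>0.
       integrable L (\<lambda>x. gen_functional P \<Phi> C t (H h v x) * (1 - v x)) \<and>
       ((\<lambda>s. gen_functional P \<Phi> C s v) has_real_derivative
          - (\<integral>x. gen_functional P \<Phi> C t (H h v x) * (1 - v x) \<partial>L)) (at t within {0..}))"
proof -
  \<comment> \<open>A real bound for the integrals of \<open>h\<close>; it is faithful because the
    supremum is finite.\<close>
  define M where "M = enn2real (SUP x. \<integral>\<^sup>+ y. ennreal (h x y) \<partial>L)"
  have M: "(\<integral>\<^sup>+y. ennreal (h x y) \<partial>L) \<le> ennreal M" for x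
  proof -
    have "(\<integral>\<^sup>+y. ennreal (h x y) \<partial>L) \<le> (SUP x. \<integral>\<^sup>+ y. ennreal (h x y) \<partial>L)"
      by (rule SUP_upper) simp
    also have "\<dots> = ennreal M" using assms(6) by (simp add: M_def)
    finally show ?thesis .
  qed
  have M0: "0 \<le> M" by (simp add: M_def)
  have "\<bar>1 - v x\<bar> = 1 - v x" for x using assms(11)[of x] by simp
  then have fin: "(\<integral>\<^sup>+ x. ennreal (1 - v x) \<partial>L) < \<infinity>" using assms(12) by simp
  have C_sym: "\<forall>\<omega>\<in>space P. \<forall>p\<in>\<Phi> \<omega>. \<forall>q\<in>\<Phi> \<omega>. C \<omega> p q = C \<omega> q p"
    using assms(9) unfolding contention_variables_def by (rule conjunct1)
  \<comment> \<open>The claim does not mention the enumeration, so any one provided by the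
    hypothesis may be fixed to enter the locales.\<close>
  from assms(9)[unfolded contention_variables_def, THEN conjunct2] show ?thesis
  proof (elim exE conjE)
    fix I \<xi>
    assume enum: "measurable_enumeration P \<Phi> I \<xi>"
      and C_meas: "\<forall>i j. i < j \<longrightarrow>
        {\<omega> \<in> space P. i \<in> I \<omega> \<and> j \<in> I \<omega> \<and> C \<omega> (\<xi> i \<omega>) (\<xi> j \<omega>)} \<in> sets P"
      and C_cond: "\<forall>F b. finite F \<longrightarrow> F \<subseteq> {(i, j). i < j} \<longrightarrow>
        (AE \<omega> in P. real_cond_exp P (enumeration_algebra P I \<xi>)
            (indicator {\<omega> \<in> space P. \<forall>(i, j)\<in>F. i \<in> I \<omega> \<and> j \<in> I \<omega> \<and>
                            (C \<omega> (\<xi> i \<omega>) (\<xi> j \<omega>) \<longleftrightarrow> b (i, j))}) \<omega>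
          = indicator {\<omega> \<in> space P. \<forall>(i, j)\<in>F. i \<in> I \<omega> \<and> j \<in> I \<omega>} \<omega> *
            (\<Prod>(i, j)\<in>F. if b (i, j) then h (fst (\<xi> i \<omega>)) (fst (\<xi> j \<omega>))
                           else 1 - h (fst (\<xi> i \<omega>)) (fst (\<xi> j \<omega>))))"
    interpret prob_space P by fact
    interpret poisson_points P L \<Phi>
      by (unfold_locales; fact assms)
    interpret enumerated_points P L \<Phi> I \<xi>
      by (unfold_locales; fact enum)
    interpret marked_points P L \<Phi> I \<xi> h C
    proof
      show "case_prod h \<in> borel_measurable borel" "\<And>x y. h x y \<in> {0..1}" "\<And>x y. h x y = h y x"
        by (fact assms)+
      show "C \<omega> p q = C \<omega> q p" if "\<omega> \<in> space P" "p \<in> \<Phi> \<omega>" "q \<in> \<Phi> \<omega>" for \<omega> p q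
        using C_sym that by simp
    qed (rule C_meas[rule_format] C_cond[rule_format]; assumption)+
    interpret matern_setting P L \<Phi> I \<xi> h C M
      by (unfold_locales; fact M M0)
    show ?thesis
      by (intro conjI allI impI GF_0 GF_derivative assms fin)
  qed
qed

end
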